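(* Let $\Pi_n$ be any cyclic $n$-gon (a polygon with $n$ sides inscribed in a circle) in the Euclidean plane, with side lengths $a_1,\dots,a_n$, perimeter $L_n$, pseudo-perimeter $\hat L_n$ and area $A_n$, and let $\tau_n=\varphi_n/\varphi_n^0$ and $\nu_n=(L_n/\hat L_n)^{\frac n2-2}$ be the associated constants. Then: (i) The inequality $\tau_n\le 1$ implies both that $\varphi_n\le 1$ and that $\hat L_n^2-4\left(n\tan\frac{\pi}{n}\right)A_n\ge 0$ with equality if and only if $\Pi_n$ is regular. Moreover, this implication is strict (its converse does not hold). (ii) The inequalities $1\le\tau_n\le\nu_n$ imply both that $\frac{e}{\pi}\le\varphi_n$ and that $\hat L_n^2-4\left(n\tan\frac{\pi}{n}\right)A_n\ge 0$ with equality if and only if $\Pi_n$ is regular. (iii) The inequality $\nu_n<\tau_n$ contradicts the assertion that $\hat L_n^2-4\left(n\tan\frac{\pi}{n}\right)A_n\ge 0$ with equality if and only if $\Pi_n$ is regular. In these three cases, the equality $1=\tau_n=\nu_n$ holds if and only if $\Pi_n$ is regular.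
   Context: For a plane $n$-gon $\Pi_n$ with side lengths $a_1,\dots,a_n$, perimeter $L_n=a_1+\dots+a_n$ and area $A_n$, define $$P_n=\frac{L_n^2}{4}\sqrt{\prod_{i=1}^n\left(1-\frac{2a_i}{L_n}\right)},\qquad \varphi_n=\frac{A_n}{P_n},$$ and the pseudo-perimeter $$\hat L_n=L_n\,\frac{n}{n-2}\left[\prod_{i=1}^n\left(1-\frac{2a_i}{L_n}\right)\right]^{1/n}.$$ The value of $\varphi_n$ for the regular $n$-gon is $$\varphi_n^0=\frac{1}{n\tan\frac{\pi}{n}\,\left(1-\frac2n\right)^{n/2}}.$$ Set $\tau_n=\varphi_n/\varphi_n^0$ and $\nu_n=\left(L_n/\hat L_n\right)^{\frac n2-2}$.
   Formalization: The isoperimetric half of (i) and its strictness are stated for n ≥ 5, the isoperimetric half of (ii) and the final equivalence for n ≠ 4: non-equilateral triangles (τ=1, negative deficit) and non-square cyclic quadrilaterals (τ=ν=1, zero deficit) refute them otherwise. *)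

theory Defs
  imports "HOL-Analysis.Analysis"
begin

text \<open>
  A plane \<open>n\<close>-gon is given by its vertices \<open>v 0, \<dots>, v (n - 1)\<close>, listed along the boundary in either
  direction; indices are read modulo \<open>n\<close> and values of \<open>v\<close> beyond \<open>n - 1\<close> are never used.
\<close>

definition side_ends :: "nat \<Rightarrow> (nat \<Rightarrow> real^2) \<Rightarrow> nat \<Rightarrow> (real^2) set" where
  "side_ends n v i = {v i, v (Suc i mod n)}"

definition side :: "nat \<Rightarrow> (nat \<Rightarrow> real^2) \<Rightarrow> nat \<Rightarrow> (real^2) set" where
  "side n v i = closed_segment (v i) (v (Suc i mod n))"

definition side_length :: "nat \<Rightarrow> (nat \<Rightarrow> real^2) \<Rightarrow> nat \<Rightarrow> real" where
  "side_length n v i = dist (v i) (v (Suc i mod n))"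

text \<open>
  Polygons are not self-intersecting: two different sides meet at most in a common end point.
\<close>

definition polygon :: "nat \<Rightarrow> (nat \<Rightarrow> real^2) \<Rightarrow> bool" where
  "polygon n v \<longleftrightarrow> 3 \<le> n \<and> inj_on v {..<n} \<and>
     (\<forall>i<n. \<forall>j<n. i \<noteq> j \<longrightarrow> side n v i \<inter> side n v j \<subseteq> side_ends n v i \<inter> side_ends n v j)"

definition cyclic_polygon :: "nat \<Rightarrow> (nat \<Rightarrow> real^2) \<Rightarrow> bool" where
  "cyclic_polygon n v \<longleftrightarrow> polygon n v \<and> (\<exists>c r. \<forall>i<n. v i \<in> sphere c r)"

text \<open>
  The angle between the two sides at \<open>v i\<close>, in \<open>[0, pi]\<close>. It is the interior angle when the polygon
  is convex, which every cyclic polygon is.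
\<close>

definition vertex_angle :: "nat \<Rightarrow> (nat \<Rightarrow> real^2) \<Rightarrow> nat \<Rightarrow> real" where
  "vertex_angle n v i =
     (let x = v ((i + n - 1) mod n) - v i; y = v (Suc i mod n) - v i
      in arccos ((x \<bullet> y) / (norm x * norm y)))"

definition regular_polygon :: "nat \<Rightarrow> (nat \<Rightarrow> real^2) \<Rightarrow> bool" where
  "regular_polygon n v \<longleftrightarrow> polygon n v \<and>
     (\<forall>i<n. \<forall>j<n. side_length n v i = side_length n v j) \<and>
     (\<forall>i<n. \<forall>j<n. vertex_angle n v i = vertex_angle n v j)"

definition perimeter :: "nat \<Rightarrow> (nat \<Rightarrow> real^2) \<Rightarrow> real" where
  "perimeter n v = (\<Sum>i<n. side_length n v i)"

text \<open>
  \<^const>\<open>inside\<close> of a set is the union of the bounded components of its complement, so this is the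
  Lebesgue measure of the region enclosed by the sides.
\<close>

definition area :: "nat \<Rightarrow> (nat \<Rightarrow> real^2) \<Rightarrow> real" where
  "area n v = measure lebesgue (inside (\<Union>i<n. side n v i))"

definition side_prod :: "nat \<Rightarrow> (nat \<Rightarrow> real^2) \<Rightarrow> real" where
  "side_prod n v = (\<Prod>i<n. 1 - 2 * side_length n v i / perimeter n v)"

definition P_const :: "nat \<Rightarrow> (nat \<Rightarrow> real^2) \<Rightarrow> real" where
  "P_const n v = (perimeter n v)\<^sup>2 / 4 * sqrt (side_prod n v)"

definition phi :: "nat \<Rightarrow> (nat \<Rightarrow> real^2) \<Rightarrow> real" where
  "phi n v = area n v / P_const n v"

definition pseudo_perimeter :: "nat \<Rightarrow> (nat \<Rightarrow> real^2) \<Rightarrow> real" where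
  "pseudo_perimeter n v = perimeter n v * (real n / (real n - 2)) * root n (side_prod n v)"

definition phi0 :: "nat \<Rightarrow> real" where
  "phi0 n = 1 / (real n * tan (pi / real n) * (1 - 2 / real n) powr (real n / 2))"

definition tau :: "nat \<Rightarrow> (nat \<Rightarrow> real^2) \<Rightarrow> real" where
  "tau n v = phi n v / phi0 n"

definition nu :: "nat \<Rightarrow> (nat \<Rightarrow> real^2) \<Rightarrow> real" where
  "nu n v = (perimeter n v / pseudo_perimeter n v) powr (real n / 2 - 2)"

definition pseudo_deficit :: "nat \<Rightarrow> (nat \<Rightarrow> real^2) \<Rightarrow> real" where
  "pseudo_deficit n v =
     (pseudo_perimeter n v)\<^sup>2 - 4 * (real n * tan (pi / real n)) * area n v"

text \<open>
  For cyclic polygons the deficit has the sign of \<open>nu - tau\<close>. Small \<open>n\<close> are exceptional: a triangle has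
  \<open>tau = 1\<close> and, unless it is equilateral, \<open>nu < 1\<close>; a cyclic quadrilateral always has
  \<open>tau = nu = 1\<close> and deficit \<open>0\<close>, regular or not.
\<close>

definition pseudo_isoperimetric :: "nat \<Rightarrow> (nat \<Rightarrow> real^2) \<Rightarrow> bool" where
  "pseudo_isoperimetric n v \<longleftrightarrow>
     pseudo_deficit n v \<ge> 0 \<and> (pseudo_deficit n v = 0 \<longleftrightarrow> regular_polygon n v)"

end

theory Submission
  imports Defs
begin

text \<open>
  Let \<open>t i\<close> be half the central angle over the \<open>i\<close>-th side of a cyclic polygon. Then \<open>\<Sum> t i = pi\<close>, and
  after scaling to circumradius 1 the half perimeter is \<open>\<Sum> sin (t i)\<close> and the area is
  \<open>\<Sum> sin (t i) * cos (t i)\<close>. As \<open>tau / nu = 4 n tan (pi / n) A / L'^2\<close> with the pseudo-perimeter \<open>L'\<close>, the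
  pseudo-isoperimetric property for \<open>n \<ge> 5\<close> says that the regular polygon is the only maximizer of
  \<open>A ^ n / \<Prod> x i ^ 2\<close>, where \<open>x i = \<Sum> sin (t j) - 2 sin (t i)\<close>.

  A maximizer exists by compactness. By induction on \<open>n\<close>, starting from Brahmagupta's formula
  \<open>A^2 = \<Prod> x i\<close> for \<open>n = 4\<close>, all its angles are positive. The first-order conditions then place all points
  \<open>cis (t i)\<close> on one rectangular hyperbola, which meets the unit circle in four points whose arguments
  add up to \<open>pi\<close>. If three angles were different, Vieta's formulas would give equality in the strict
  subadditivity of the sine. If exactly two were different, the critical equation would factor and reduce to an
  inequality between tangents. So the maximizer is regular.
\<close>

section \<open>Trigonometric inequalities\<close>

text \<open>Two kinds of boundary configuration shape the argument. Where a slack vanishes, only two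
  angles or one are left and the ratio has the form 0/0, so compactness is available only on a
  superlevel set, after an estimate showing that a vanishing slack forces the ratio to 0; that
  estimate has a factor to spare exactly from n = 5 on. Zero angles with positive slacks are
  harmless for continuity and stay in the domain, at the price of one-sided first-order conditions;
  the induction excludes them afterwards. The inequality 2 < k (k - 1) tan^2 (pi / (2 k)) with k = n
  - 1 decides twice: when a zero angle of the regular (n - 1)-gon is opened, and at the extreme case
  of the two-angle equation. The claims on \<phi> come from \<phi> = \<tau> * \<phi>0 and e / pi
  \<le> \<phi>0 \<le> 1. For strictness in (i), a square with n - 4 zero angles has \<phi> = 1,
  hence \<tau> = 1 / \<phi>0 > 1, and is deformed into the regular n-gon.\<close>

lemma tan_scale_le:
  fixes l x :: real
  assumes "0 \<le> l" "l \<le> 1" "0 \<le> x" "x < pi/2"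
  shows "tan (l * x) \<le> l * tan x"
proof -
  have "0 * tan 0 - tan (0::real) \<le> l * tan x - tan (l * x)"
  proof -
    have "(\<lambda>y. l * tan y - tan (l * y)) 0 \<le> (\<lambda>y. l * tan y - tan (l * y)) x"
    proof (rule DERIV_nonneg_imp_nondecreasing[OF assms(3)])
      fix y assume y: "0 \<le> y" "y \<le> x"
      have ly: "l * y \<le> y" "0 \<le> l * y" using assms y by (auto simp: mult_left_le_one_le)
      have c: "cos y > 0" "cos (l * y) > 0"
        by (rule cos_gt_zero_pi; use assms y ly in linarith)+
      have cl: "cos y \<le> cos (l * y)"
        by (rule cos_monotone_0_pi_le; use assms y ly pi_gt_zero in linarith)
      have "((\<lambda>y. l * tan y - tan (l * y)) has_real_derivative
          (l * inverse ((cos y)\<^sup>2) - l * inverse ((cos (l * y))\<^sup>2))) (at y)"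
        using c by (auto intro!: derivative_eq_intros)
      moreover have "inverse ((cos (l * y))\<^sup>2) \<le> inverse ((cos y)\<^sup>2)"
        using c cl by (intro le_imp_inverse_le power_mono) auto
      ultimately show "\<exists>d. ((\<lambda>y. l * tan y - tan (l * y)) has_real_derivative d) (at y) \<and> 0 \<le> d"
        using assms(1) by (intro exI[of _ "l * inverse ((cos y)\<^sup>2) - l * inverse ((cos (l * y))\<^sup>2)"] conjI) (simp_all add: mult_left_mono)
    qed
    then show ?thesis by simp
  qed
  then show ?thesis by simp
qed

lemma tan_scale_less:
  fixes l x :: real
  assumes "0 < l" "l < 1" "0 < x" "x < pi/2"
  shows "tan (l * x) < l * tan x"
proof -
  have "(\<lambda>y. l * tan y - tan (l * y)) 0 < (\<lambda>y. l * tan y - tan (l * y)) x"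
  proof (rule DERIV_pos_imp_increasing_open[OF assms(3)])
    fix y assume y: "0 < y" "y < x"
    have ly: "l * y < y" "0 < l * y" using assms y by auto
    have c: "cos y > 0" "cos (l * y) > 0"
      by (rule cos_gt_zero_pi; use assms y ly in linarith)+
    have cl: "cos y < cos (l * y)"
      by (rule cos_monotone_0_pi; use assms y ly pi_gt_zero in linarith)
    have "((\<lambda>y. l * tan y - tan (l * y)) has_real_derivative
        (l * inverse ((cos y)\<^sup>2) - l * inverse ((cos (l * y))\<^sup>2))) (at y)"
      using c by (auto intro!: derivative_eq_intros)
    moreover have "inverse ((cos (l * y))\<^sup>2) < inverse ((cos y)\<^sup>2)"
      using c cl by (intro less_imp_inverse_less power_strict_mono) auto
    ultimately show "\<exists>d. ((\<lambda>y. l * tan y - tan (l * y)) has_real_derivative d) (at y) \<and> 0 < d"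
      using assms(1) by (intro exI[of _ "l * inverse ((cos y)\<^sup>2) - l * inverse ((cos (l * y))\<^sup>2)"] conjI) simp_all
  next
    have "cos y \<noteq> 0" "cos (l*y) \<noteq> 0" if "0 \<le> y" "y \<le> x" for y
    proof -
      have "l * y \<le> y" "0 \<le> l * y" using assms that by (auto simp: mult_left_le_one_le)
      then have "cos y > 0" "cos (l*y) > 0"
        by (auto intro!: cos_gt_zero_pi; use assms that in linarith)+
      then show "cos y \<noteq> 0" "cos (l*y) \<noteq> 0" by auto
    qed
    then show "continuous_on {0..x} (\<lambda>y. l * tan y - tan (l * y))"
      by (intro continuous_intros) auto
  qed
  then show ?thesis by simp
qed

lemma tan_add_cubic_le:
  fixes x :: real
  assumes "0 \<le> x" "x < pi/2"
  shows "x + x^3/3 \<le> tan x"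
proof -
  have tanx: "y \<le> tan y" if "0 \<le> y" "y < pi/2" for y :: real
  proof -
    have "(\<lambda>y. tan y - y) 0 \<le> (\<lambda>y. tan y - y) y"
    proof (rule DERIV_nonneg_imp_nondecreasing[OF that(1)])
      fix z assume z: "0 \<le> z" "z \<le> y"
      have c: "cos z > 0" by (rule cos_gt_zero_pi; use that z in linarith)
      have "((\<lambda>y. tan y - y) has_real_derivative (1 + (tan z)^2) - 1) (at z)"
        using c by (auto intro!: derivative_eq_intros simp: tan_sec power_inverse)
      then show "\<exists>d. ((\<lambda>y. tan y - y) has_real_derivative d) (at z) \<and> 0 \<le> d" by force
    qed
    then show ?thesis by simp
  qed
  have "(\<lambda>y. tan y - (y + y^3/3)) 0 \<le> (\<lambda>y. tan y - (y + y^3/3)) x"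
  proof (rule DERIV_nonneg_imp_nondecreasing[OF assms(1)])
    fix z assume z: "0 \<le> z" "z \<le> x"
    have c: "cos z > 0" by (rule cos_gt_zero_pi; use assms z in linarith)
    have "((\<lambda>y. tan y - (y + y^3/3)) has_real_derivative (1 + (tan z)^2) - (1 + z^2)) (at z)"
      using c by (auto intro!: derivative_eq_intros simp: tan_sec power_inverse)
    moreover have "z^2 \<le> (tan z)^2" using tanx[of z] z assms by (intro power_mono) auto
    ultimately show "\<exists>d. ((\<lambda>y. tan y - (y + y^3/3)) has_real_derivative d) (at z) \<and> 0 \<le> d"
      by (intro exI[of _ "(1 + (tan z)^2) - (1 + z^2)"] conjI) simp_all
  qed
  then show ?thesis by simp
qed

lemma tan_ge_self:
  fixes x :: real
  assumes "0 \<le> x" "x < pi/2"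
  shows "x \<le> tan x"
proof -
  have "0 \<le> x^3" using assms by simp
  with tan_add_cubic_le[OF assms] show ?thesis by linarith
qed

lemma pi_bounds: "314/100 < pi" "pi < 315/100"
  using pi_approx by auto

text \<open>The substitution \<open>pi / r = pi / 4 - y\<close> turns \<open>2 \<le> (r - 2) * tan (pi / r)\<close> into \<open>tan y \<le> 4 * y / pi\<close>.\<close>

lemma tan_pi_div_ge_aux:
  fixes r :: real
  assumes "4 \<le> r"
  defines "y \<equiv> pi/4 - pi/r" and "u \<equiv> tan (pi/4 - pi/r)"
  shows "0 \<le> y" "y < pi/4" "0 \<le> u" "u < 1" "tan (pi/r) = (1 - u)/(1 + u)" 
    "(r - 2) * tan (pi/r) - 2 = r / pi * (4 * y - pi * u) / (1 + u)"
proof -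
  show y: "0 \<le> y" "y < pi/4" using assms by (auto simp: y_def field_simps)
  have c: "cos y > 0" by (rule cos_gt_zero_pi; use y in linarith)
  show u: "0 \<le> u" "u < 1"
    using y tan_ge_self[of y] tan_monotone[of y "pi/4"] by (simp_all add: u_def flip: y_def) (simp_all add: tan_45)
  have eq: "pi/r = pi/4 - y" by (simp add: y_def)
  have "cos (pi/r) > 0" by (rule cos_gt_zero_pi; use y eq pi_gt_zero in linarith)
  then have "tan (pi/4 - y) = (tan (pi/4) - tan y)/(1 + tan (pi/4) * tan y)"
    using c eq by (intro tan_diff) (auto simp: cos_45)
  then show t: "tan (pi/r) = (1 - u)/(1 + u)"
    unfolding eq by (simp add: tan_45 u_def y_def)
  have "r * (pi/4 - y) = pi" using assms by (simp add: y_def)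
  then have r: "r * (pi - 4 * y) = 4 * pi" by (simp add: field_simps)
  have "((r - 2) * (1 - u) - 2 * (1 + u)) = r - 4 - r * u" by (simp add: algebra_simps)
  moreover have "pi * (r - 4 - r * u) = r * (4 * y - pi * u)" using r by (simp add: algebra_simps)
  ultimately show "(r - 2) * tan (pi/r) - 2 = r / pi * (4 * y - pi * u) / (1 + u)"
    unfolding t using u by (simp add: divide_simps) (simp add: algebra_simps)
qed

lemma tan_pi_div_ge:
  fixes r :: real
  assumes "4 \<le> r"
  shows "2 \<le> (r - 2) * tan (pi/r)"
proof -
  note a = tan_pi_div_ge_aux[OF assms]
  define y where "y = pi/4 - pi/r"
  \<comment> \<open>Convexity: on [0, pi/4] the graph of tan lies below its chord to (pi/4, 1).
    Equality at y = 0 is the case r = 4.\<close>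
  have "tan (y / (pi/4) * (pi/4)) \<le> y / (pi/4) * tan (pi/4)"
    by (rule tan_scale_le) (use a(1,2) assms pi_gt_zero in \<open>auto simp: divide_le_eq y_def field_simps\<close>)
  then have "pi * tan y \<le> 4 * y" by (simp add: tan_45 field_simps)
  then have "pi * tan (pi/4 - pi/r) \<le> 4 * (pi/4 - pi/r)"
    unfolding y_def .
  then have "0 \<le> r / pi * (4 * (pi/4 - pi/r) - pi * tan (pi/4 - pi/r)) / (1 + tan (pi/4 - pi/r))"
    using a(3) assms by simp
  with a(6) show ?thesis by linarith
qed

text \<open>At k = 4 the right side is only about 2.06, and tan x >= x would give 1.85, so the cubic
  term of tan is kept. For large k the right side tends to pi^2 / 4.\<close>

lemma tan_pi_div_double_gt:
  fixes k :: real
  assumes "4 \<le> k"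
  shows "2 < k * (k - 1) * (tan (pi/(2*k)))\<^sup>2"
proof -
  define x where "x = pi/(2*k)"
  define z where "z = 1/k"
  have z: "0 < z" "z \<le> 1/4" using assms by (auto simp: z_def field_simps)
  have x: "0 < x" "x < pi/2" using assms by (auto simp: x_def field_simps)
  have xz: "x = pi * z / 2" by (simp add: x_def z_def)
  have p: "98596/10000 < pi^2" using pi_bounds power_strict_mono[of "314/100" pi 2] by (simp add: power2_eq_square)
  have "(x + x^3/3)^2 \<le> (tan x)^2"
    using tan_add_cubic_le[of x] x by (intro power_mono) auto
  moreover have "x^2 * (1 + 2*x^2/3) \<le> (x + x^3/3)^2"
    using zero_le_power[of "x^2" 3] by (simp add: power2_eq_square power3_eq_cube algebra_simps)
  ultimately have t: "x^2 * (1 + 2*x^2/3) \<le> (tan x)^2" by linarith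
  have kk: "k * (k - 1) = (1 - z) / z^2" using assms by (simp add: z_def field_simps power2_eq_square)
  define Q where "Q = (1 - z) * z^2"
  \<comment> \<open>The tangent of z^2 at z = 1/4, the critical end of the range, makes the
    remaining estimate linear in z.\<close>
  have "z/2 - 1/16 \<le> z^2" using zero_le_power2[of "z - 1/4"] by (simp add: power2_eq_square algebra_simps)
  moreover have "3/4 * z^2 \<le> Q" unfolding Q_def using z by (intro mult_right_mono) auto
  ultimately have b: "3/8 * z - 3/64 \<le> Q" by linarith
  have "0 \<le> Q" using z by (simp add: Q_def)
  then have "98596/60000 * Q \<le> pi^2/6 * Q"
    using p by (intro mult_right_mono) auto
  \<comment> \<open>The linear bound decreases in z, so z = 1/4 is the worst case. The constant is
    chosen just above 8 / pi^2, with 3.14^2 as the lower bound for pi^2.\<close>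
  with b z have "81141/100000 < (1 - z) + pi^2/6 * Q" by linarith
  also have "\<dots> = (1 - z) * (1 + pi^2 * z^2 / 6)"
    by (simp add: Q_def field_simps)
  finally have c: "81141/100000 < (1 - z) * (1 + pi^2 * z^2 / 6)" .
  have "2 < pi^2 / 4 * (81141/100000)" using p by simp
  also have "\<dots> < pi^2 / 4 * ((1 - z) * (1 + pi^2 * z^2 / 6))"
    using c p by (intro mult_strict_left_mono) auto
  also have "\<dots> = (1 - z) / z^2 * (x^2 * (1 + 2*x^2/3))"
    using z by (simp add: xz power2_eq_square field_simps)
  also have "\<dots> \<le> (1 - z) / z^2 * (tan x)^2"
    using t z by (intro mult_left_mono) auto
  finally show ?thesis unfolding kk x_def by simp
qed

lemma tan_add_less:
  fixes a b :: real
  assumes "0 < a" "0 < b" "a + b < pi/2"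
  shows "tan a + tan b < tan (a + b)"
proof -
  have c: "cos a > 0" "cos b > 0" "cos (a + b) > 0"
    by (rule cos_gt_zero_pi; use assms in linarith)+
  have "tan a + tan b = tan (a + b) * (1 - tan a * tan b)"
    using add_tan_eq[of a b] lemma_tan_add1[of a b] c by (simp add: tan_def)
  moreover have "0 < tan (a + b)" "0 < tan a" "0 < tan b" using assms by (auto intro: tan_gt_zero)
  ultimately show ?thesis by (simp add: right_diff_distrib)
qed

lemma tan_superadditive:
  fixes t :: "'a \<Rightarrow> real"
  assumes "finite J" "\<And>i. i \<in> J \<Longrightarrow> 0 < t i" "sum t J < pi/2"
  shows "(\<Sum>i\<in>J. tan (t i)) \<le> tan (sum t J)"
  using assms
proof (induction J rule: finite_induct)
  case (insert a J)
  have s: "0 \<le> sum t J" using insert.prems by (intro sum_nonneg) (auto intro: less_imp_le)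
  have ta: "0 < t a" using insert.prems by auto
  have lt: "t a + sum t J < pi/2" using insert by simp
  have "tan (t a) + tan (sum t J) \<le> tan (t a + sum t J)"
    using tan_add_less[OF ta _ lt] s by (cases "sum t J = 0") auto
  moreover have "(\<Sum>i\<in>J. tan (t i)) \<le> tan (sum t J)"
    using insert.prems(1) lt ta by (intro insert.IH) (blast, linarith)
  ultimately show ?case using insert.hyps by simp
qed simp

text \<open>The product form makes the sign visible. It is the source of the subadditivity of the
  sine, of the triangle inequality for sines, and of the orientation formula for three points on a
  circle.\<close>

lemma sin_add_sin_diff:
  fixes a b :: real
  shows "sin a + sin b - sin (a + b) = 4 * sin (a/2) * sin (b/2) * sin ((a+b)/2)"
proof -
  define x y where "x = a/2" and "y = b/2"
  have e: "a = 2*x" "b = 2*y" "(2*x + 2*y)/2 = x+y" "2*x + 2*y = 2*(x+y)" by (auto simp: x_def y_def)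
  have 1: "(cos x)^2 = 1 - (sin x)^2" "(cos y)^2 = 1 - (sin y)^2" by (simp_all add: cos_squared_eq)
  have "2 * sin x * cos x + 2 * sin y * cos y - 2 * (sin x * cos y + cos x * sin y) * (cos x * cos y - sin x * sin y) =
    4 * sin x * sin y * (sin x * cos y + cos x * sin y)"
    using 1 by algebra
  then have "sin (2*x) + sin (2*y) - sin (2*(x+y)) = 4 * sin x * sin y * sin (x+y)"
    unfolding sin_double sin_add cos_add .
  then show ?thesis by (simp add: x_def y_def add_divide_distrib)
qed

lemma sin_subadditive:
  fixes t :: "'a \<Rightarrow> real"
  assumes "finite J" "\<And>i. i \<in> J \<Longrightarrow> 0 \<le> t i" "sum t J \<le> pi"
  shows "sin (sum t J) \<le> (\<Sum>i\<in>J. sin (t i))"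
  using assms
proof (induction J rule: finite_induct)
  case (insert a J)
  have s: "0 \<le> sum t J" using insert.prems by (intro sum_nonneg) auto
  have ta: "0 \<le> t a" and le: "t a + sum t J \<le> pi" using insert by auto
  have "0 \<le> 4 * sin (t a/2) * sin (sum t J/2) * sin ((t a + sum t J)/2)"
    using s ta le by (intro mult_nonneg_nonneg sin_ge_zero) auto
  then have "sin (t a + sum t J) \<le> sin (t a) + sin (sum t J)"
    using sin_add_sin_diff[of "t a" "sum t J"] by linarith
  with insert ta le show ?case by simp
qed simp

lemma sin_subadditive_strict:
  fixes t :: "'a \<Rightarrow> real"
  assumes J: "finite J" "\<And>i. i \<in> J \<Longrightarrow> 0 \<le> t i" "sum t J \<le> pi"
    and ab: "a \<in> J" "b \<in> J" "a \<noteq> b" "0 < t a" "0 < t b"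
  shows "sin (sum t J) < (\<Sum>i\<in>J. sin (t i))"
proof -
  define R where "R = sum t (J - {a})"
  have R: "sum t J = t a + R" unfolding R_def using J ab by (simp add: sum.remove)
  have "t b \<le> R" unfolding R_def using J ab by (intro member_le_sum) auto
  with ab have R0: "0 < R" by simp
  have "sin R \<le> (\<Sum>i\<in>J-{a}. sin (t i))"
    unfolding R_def using J R ab R0 by (intro sin_subadditive) (auto simp: R_def)
  moreover have "0 < 4 * sin (t a/2) * sin (R/2) * sin ((t a + R)/2)"
    using R0 R ab J by (intro mult_pos_pos sin_gt_zero) auto
  then have "sin (t a + R) < sin (t a) + sin R" using sin_add_sin_diff[of "t a" R] by linarith
  moreover have "(\<Sum>i\<in>J. sin (t i)) = sin (t a) + (\<Sum>i\<in>J-{a}. sin (t i))"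
    using J ab by (simp add: sum.remove)
  ultimately show ?thesis using R by simp
qed

text \<open>This is x/2 \<le> tan (x/2) combined with sin x = 2 sin (x/2) cos (x/2); it gives linear
  lower bounds for the sine on every interval that stays away from pi.\<close>

lemma sin_ge_cos_half:
  fixes x :: real
  assumes "0 \<le> x" "x < pi"
  shows "x * (cos (x/2))\<^sup>2 \<le> sin x"
proof -
  have c: "cos (x/2) > 0" by (rule cos_gt_zero_pi; use assms in linarith)
  have "x/2 \<le> tan (x/2)" using assms by (intro tan_ge_self) auto
  then have "x/2 * cos (x/2) \<le> sin (x/2)" using c by (simp add: tan_def field_simps)
  then have "2 * (x/2 * cos (x/2)) * cos (x/2) \<le> 2 * sin (x/2) * cos (x/2)"
    using c by (intro mult_right_mono) auto
  also have "\<dots> = sin x" using sin_double[of "x/2"] by simp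
  finally show ?thesis by (simp add: power2_eq_square algebra_simps)
qed

text \<open>Here y may exceed pi/2, so monotonicity of the sine does not apply; in the product
  formula for the difference only x + y \<le> pi matters.\<close>

lemma sin_le_sin_sum_le_pi:
  fixes x y :: real
  assumes "0 \<le> x" "x \<le> y" "x + y \<le> pi"
  shows "sin x \<le> sin y"
proof -
  have "0 \<le> 2 * sin ((y - x)/2) * cos ((y + x)/2)"
    using assms by (intro mult_nonneg_nonneg sin_ge_zero cos_ge_zero) auto
  then show ?thesis using sin_diff_sin[of y x] by linarith
qed

text \<open>With \<open>r = 2 / N\<close> and \<open>e = pi / 2 - w\<close> this is \<open>tan_two_scale_bound\<close>. The difference of the two sides
  increases and then decreases in \<open>e\<close>, hence is positive if it is positive at the end point \<open>E\<close>.\<close>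

lemma arctan_rational_bound:
  fixes r e :: real
  assumes r: "0 < r" "r < 1" and e: "0 < e" "e \<le> E" and E: "E < pi/2"
    and fin: "arctan (r * tan E * (1 + r * (tan E)\<^sup>2) / (1 + (1 + r - r\<^sup>2) * (tan E)\<^sup>2)) < r * E"
  shows "arctan (r * tan e * (1 + r * (tan e)\<^sup>2) / (1 + (1 + r - r\<^sup>2) * (tan e)\<^sup>2)) < r * e"
proof -
  define q where "q = 1 + r - r\<^sup>2"
  have q: "q > 0" using r unfolding q_def by (simp add: power2_eq_square algebra_simps) (smt (verit) mult_left_le mult_less_cancel_left_pos)
  define \<rho> where "\<rho> = (\<lambda>t. r * t * (1 + r * t\<^sup>2) / (1 + q * t\<^sup>2))"
  define g where "g = (\<lambda>x. r * x - arctan (\<rho> (tan x)))"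
  \<comment> \<open>With q = 1 + r - r^2 the numerator factors, and the derivative has the sign of 2
    - (r + r^2) tan^2 x, which changes at most once because tan increases.\<close>
  define g' where "g' = (\<lambda>x. r * (1 - r\<^sup>2) * (tan x)\<^sup>2 * (2 - (r + r\<^sup>2) * (tan x)\<^sup>2) * (1 + (tan x)\<^sup>2)
     / ((1 + q * (tan x)\<^sup>2)\<^sup>2 + (r * tan x * (1 + r * (tan x)\<^sup>2))\<^sup>2))"
  have der: "(g has_real_derivative g' x) (at x)" if x: "0 \<le> x" "x < pi/2" for x
  proof -
    have c: "cos x > 0" by (rule cos_gt_zero_pi; use x in linarith)
    define t where "t = tan x"
    define w where "w = t\<^sup>2"
    define D where "D = 1 + q * w"
    have D: "D > 0" unfolding D_def w_def using q by (intro add_pos_nonneg) auto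
    have dt: "(tan has_real_derivative (1 + w)) (at x)"
      using c by (auto intro!: derivative_eq_intros simp: tan_sec w_def t_def power_inverse)
    have dr: "(\<rho> has_real_derivative (r * (1 + (3*r - q) * w + r * q * w\<^sup>2) / D\<^sup>2)) (at t)"
    proof -
      have "(\<rho> has_real_derivative (((r * (1 + r * t\<^sup>2) + r * t * (r * (2 * t))) * (1 + q * t\<^sup>2)
           - (r * t * (1 + r * t\<^sup>2)) * (q * (2 * t))) / ((1 + q * t\<^sup>2) * (1 + q * t\<^sup>2)))) (at t)"
        unfolding \<rho>_def using D unfolding D_def w_def
        by (auto intro!: derivative_eq_intros simp: algebra_simps)
      moreover have "((r * (1 + r * t\<^sup>2) + r * t * (r * (2 * t))) * (1 + q * t\<^sup>2)
           - (r * t * (1 + r * t\<^sup>2)) * (q * (2 * t))) = r * (1 + (3*r - q) * w + r * q * w\<^sup>2)"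
        unfolding w_def by algebra
      moreover have "(1 + q * t\<^sup>2) * (1 + q * t\<^sup>2) = D\<^sup>2" by (simp add: D_def w_def power2_eq_square)
      ultimately show ?thesis by simp
    qed
    have "(g has_real_derivative (r - (r * (1 + (3*r - q) * w + r * q * w\<^sup>2) / D\<^sup>2) * (1 + w) / (1 + (\<rho> t)\<^sup>2))) (at x)"
    proof -
      have "((\<lambda>x. \<rho> (tan x)) has_real_derivative (r * (1 + (3*r - q) * w + r * q * w\<^sup>2) / D\<^sup>2) * (1 + w)) (at x)"
        using DERIV_chain2[OF dr[unfolded t_def] dt] .
      then show ?thesis unfolding g_def
        by (auto intro!: derivative_eq_intros simp: t_def divide_inverse)
    qed
    moreover have "(r - (r * (1 + (3*r - q) * w + r * q * w\<^sup>2) / D\<^sup>2) * (1 + w) / (1 + (\<rho> t)\<^sup>2)) = g' x"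
    proof -
      define M where "M = r * t * (1 + r * w)"
      have rho: "\<rho> t = M / D" by (simp add: \<rho>_def M_def D_def w_def)
      have pos: "D\<^sup>2 + M\<^sup>2 > 0" using D by (intro add_pos_nonneg) auto
      have aux: "r - Z/P = (r*P - Z)/P" if "P > 0" for Z P :: real
        using that by (simp add: diff_divide_distrib)
      have "(r * (1 + (3*r - q) * w + r * q * w\<^sup>2) / D\<^sup>2) * (1 + w) / (1 + (\<rho> t)\<^sup>2)
          = r * (1 + (3*r - q) * w + r * q * w\<^sup>2) * (1 + w) / (D\<^sup>2 + M\<^sup>2)"
        unfolding rho using D by (simp add: power_divide add_frac_eq divide_simps)
      then have "r - (r * (1 + (3*r - q) * w + r * q * w\<^sup>2) / D\<^sup>2) * (1 + w) / (1 + (\<rho> t)\<^sup>2)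
          = (r * (D\<^sup>2 + M\<^sup>2) - r * (1 + (3*r - q) * w + r * q * w\<^sup>2) * (1 + w)) / (D\<^sup>2 + M\<^sup>2)"
        using aux[OF pos] by metis
      moreover have "r * (D\<^sup>2 + M\<^sup>2) - r * (1 + (3*r - q) * w + r * q * w\<^sup>2) * (1 + w)
          = r * (1 - r\<^sup>2) * w * (2 - (r + r\<^sup>2) * w) * (1 + w)"
      proof -
        have M2: "M\<^sup>2 = r\<^sup>2 * w * (1 + r * w)\<^sup>2" by (simp add: M_def w_def power_mult_distrib)
        show ?thesis unfolding M2 D_def q_def by algebra
      qed
      ultimately show ?thesis unfolding g'_def D_def M_def w_def t_def by simp
    qed
    ultimately show ?thesis by simp
  qed
  have tm: "tan x \<le> tan y \<and> 0 \<le> tan x" if "0 \<le> x" "x \<le> y" "y < pi/2" for x y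
    using that tan_ge_self[of x] tan_monotone[of x y] by (cases "x = y") auto
  have den: "(1 + q * (tan x)\<^sup>2)\<^sup>2 + (r * tan x * (1 + r * (tan x)\<^sup>2))\<^sup>2 > 0" for x
    using q by (intro add_pos_nonneg zero_less_power) (auto intro!: add_pos_nonneg)
  have r2: "r\<^sup>2 < 1" using r by (simp add: power_less_one_iff)
  show ?thesis
  proof (cases "(r + r\<^sup>2) * (tan e)\<^sup>2 \<le> 2")
    case True
    have "g 0 < g e"
    proof (rule DERIV_pos_imp_increasing_open[OF e(1)])
      fix x assume x: "0 < x" "x < e"
      have t: "0 < tan x" "tan x < tan e" using x e E tan_monotone[of x e] tan_gt_zero[of x] by auto
      then have "(tan x)\<^sup>2 < (tan e)\<^sup>2" by (intro power_strict_mono) auto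
      then have "(r + r\<^sup>2) * (tan x)\<^sup>2 < (r + r\<^sup>2) * (tan e)\<^sup>2" using r by (intro mult_strict_left_mono) (auto intro: add_pos_pos)
      with True have "(r + r\<^sup>2) * (tan x)\<^sup>2 < 2" by simp
      then have "g' x > 0" unfolding g'_def using r r2 t den[of x]
        by (intro divide_pos_pos mult_pos_pos) (auto intro: add_pos_nonneg)
      with der[of x] x e E show "\<exists>d. (g has_real_derivative d) (at x) \<and> 0 < d" by auto
    next
      show "continuous_on {0..e} g"
        by (rule DERIV_continuous_on[where D=g'], rule has_field_derivative_at_within, rule der) (use e E in auto)
    qed
    then show ?thesis by (simp add: g_def \<rho>_def q_def)
  next
    case False
    have "g E \<le> g e"
    proof (rule DERIV_nonpos_imp_nonincreasing[OF e(2)])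
      fix x assume x: "e \<le> x" "x \<le> E"
      have "(tan e)\<^sup>2 \<le> (tan x)\<^sup>2" using tm[of e x] x e E by (intro power_mono) auto
      then have "(r + r\<^sup>2) * (tan e)\<^sup>2 \<le> (r + r\<^sup>2) * (tan x)\<^sup>2" using r by (intro mult_left_mono) (auto intro: add_pos_pos)
      with False have n: "2 - (r + r\<^sup>2) * (tan x)\<^sup>2 \<le> 0" by simp
      have "r * (1 - r\<^sup>2) * (tan x)\<^sup>2 * (2 - (r + r\<^sup>2) * (tan x)\<^sup>2) * (1 + (tan x)\<^sup>2) \<le> 0"
        using r r2 n by (intro mult_nonpos_nonneg mult_nonneg_nonpos) auto
      then have "g' x \<le> 0" unfolding g'_def using den[of x] by (simp add: divide_nonpos_pos)
      with der[of x] x e E show "\<exists>d. (g has_real_derivative d) (at x) \<and> d \<le> 0" by auto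
    qed
    with fin show ?thesis by (simp add: g_def \<rho>_def q_def)
  qed
qed

text \<open>Here N is n - 2 and w is the mean of the two angle values. The smallest w, pi / (2 N +
  2), belongs to n - 1 equal angles and one zero angle, and this end point is the critical
  one.\<close>

lemma tan_two_scale_bound:
  fixes N w :: real
  assumes N: "3 \<le> N" and w: "pi / (2*N + 2) \<le> w" "w < pi/2"
  shows "4 < N\<^sup>2 * (tan w)\<^sup>2 - (N + 2) * N * tan w * tan (((N + 2) * w - pi)/N)"
proof -
  define r where "r = 2/N"
  have r: "0 < r" "r < 1" using N by (auto simp: r_def)
  define e where "e = pi/2 - w"
  define E where "E = pi/(2 + r)"
  have E': "pi/2 - E = pi/(2*N+2)" using N by (simp add: E_def r_def field_simps)
  have E: "E < pi/2" "0 < E" using r by (auto simp: E_def field_simps)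
  have e: "0 < e" "e \<le> E" using w E' by (auto simp: e_def)
  define q where "q = 1 + r - r\<^sup>2"
  have q: "q > 0" using r unfolding q_def by (simp add: power2_eq_square algebra_simps) (smt (verit) mult_left_le mult_less_cancel_left_pos)
  define \<rho> where "\<rho> = (\<lambda>t. r * t * (1 + r * t\<^sup>2) / (1 + q * t\<^sup>2))"
  have Eq: "pi/4 < E" using r by (simp add: E_def field_simps)
  have tE: "1 < tan E" using tan_monotone[of "pi/4" E] E Eq by (simp add: tan_45)
  have cotE: "tan E = inverse (tan (pi/(2*N+2)))" using tan_cot[of E] E' by simp
  \<comment> \<open>At the end point r E = pi - 2 E, so tan (r E) is rational in tan E and the claim
    reduces to \<open>tan_pi_div_double_gt\<close> with k = N + 1.\<close>
  have fin: "\<rho> (tan E) < tan (r * E)"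
  proof -
    define t where "t = tan E"
    define v where "v = t\<^sup>2"
    have v: "v > 1" using tE power_strict_mono[of 1 "tan E" 2] by (simp add: v_def t_def)
    have rE: "r * E = pi - 2 * E" using r by (simp add: E_def field_simps)
    have "cos (2 * E) \<noteq> 0" 
    proof -
      have "cos (2*E) < cos (pi/2)" by (rule cos_monotone_0_pi) (use E Eq in auto)
      then show ?thesis by simp
    qed
    moreover have "cos E \<noteq> 0" using E cos_gt_zero_pi[of E] by auto
    ultimately have "tan (2*E) = 2 * t / (1 - v)" unfolding t_def v_def by (rule tan_double[rotated])
    moreover have "tan (r * E) = - tan (2*E)" unfolding rE by (simp add: tan_def sin_diff cos_diff)
    ultimately have tr: "tan (r*E) = 2 * t / (v - 1)" using v by (simp add: field_simps)
    have rv: "r\<^sup>2 * v < 2 + r"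
    proof -
      have tp: "tan (pi/(2*N+2)) > 0" by (rule tan_gt_zero) (use N in \<open>auto simp: field_simps\<close>)
      have "2 < (N+1) * ((N+1) - 1) * (tan (pi/(2*(N+1))))\<^sup>2"
        by (rule tan_pi_div_double_gt) (use N in simp)
      then have "2 < (N+1)*N * (tan (pi/(2*N+2)))\<^sup>2" by (simp add: algebra_simps)
      then have "2 * v < (N+1)*N" unfolding v_def t_def cotE using tp by (simp add: field_simps)
      then have "4 / N\<^sup>2 * v < 2 + 2/N" using N by (simp add: field_simps power2_eq_square)
      then show ?thesis by (simp add: r_def power_divide)
    qed
    have "2 * (1 + q * v) - r * (1 + r * v) * (v - 1) = (1 + v) * (2 + r - r\<^sup>2 * v)"
      unfolding q_def by algebra
    moreover have "\<dots> > 0" using v rv by simp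
    ultimately have "r * (1 + r * v) * (v - 1) < 2 * (1 + q * v)" by linarith
    moreover have "1 + q * v > 0" using q v by (intro add_pos_pos) auto
    ultimately have "r * (1 + r * v) / (1 + q * v) < 2 / (v - 1)" using v by (simp add: divide_simps)
    then have "t * (r * (1 + r * v) / (1 + q * v)) < t * (2 / (v - 1))"
      using tE by (intro mult_strict_left_mono) (auto simp: t_def)
    then show ?thesis unfolding tr \<rho>_def t_def[symmetric] v_def[symmetric] by (simp add: algebra_simps)
  qed
  have rE: "-(pi/2) < r * E" "r * E < pi/2" 
    using r E by (auto intro: less_le_trans[OF _ mult_nonneg_nonneg] simp: mult_less_cancel_right1 intro: less_trans[of _ E])
      (smt (verit) mult_left_le_one_le)+
  have "arctan (\<rho> (tan E)) < r * E"
    using fin arctan_less_iff[of "\<rho> (tan E)" "tan (r*E)"] arctan_tan[OF rE] by simp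
  then have "arctan (\<rho> (tan e)) < r * e"
    unfolding \<rho>_def q_def by (rule arctan_rational_bound[OF r e E(1)])
  moreover have re: "-(pi/2) < r * e" "r * e < pi/2" "0 < r * e"
    using r e E by (auto intro: less_le_trans[of _ 0]) (smt (verit) mult_left_le_one_le)+
  ultimately have tau: "\<rho> (tan e) < tan (r * e)"
    using tan_monotone[of "arctan (\<rho> (tan e))" "r * e"] arctan_lbound[of "\<rho> (tan e)"] by (simp add: tan_arctan)
  define t where "t = tan e"
  define \<tau> where "\<tau> = tan (r*e)"
  have t: "t > 0" "\<tau> > 0" unfolding t_def \<tau>_def using e E re by (auto intro: tan_gt_zero)
  have ce: "cos e > 0" "cos (r*e) > 0" by (rule cos_gt_zero_pi; use e E re in linarith)+
  have tw: "tan w = 1/t" using tan_cot[of e] by (simp add: t_def e_def inverse_eq_divide)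
  have arg: "((N + 2) * w - pi)/N = pi/2 - (e + r * e)" using N by (simp add: e_def r_def field_simps)
  have "tan (pi/2 - (e + r*e)) = cos (e + r*e) / sin (e + r*e)"
    by (simp add: tan_def sin_diff cos_diff)
  also have "\<dots> = (1 - t * \<tau>) / (t + \<tau>)"
  proof -
    have "cos (e + r*e) = cos e * cos (r*e) * (1 - t * \<tau>)" "sin (e + r*e) = cos e * cos (r*e) * (t + \<tau>)"
      using ce by (auto simp: t_def \<tau>_def tan_def cos_add sin_add field_simps)
    then show ?thesis using ce by simp
  qed
  finally have targ: "tan (((N + 2) * w - pi)/N) = (1 - t * \<tau>) / (t + \<tau>)" unfolding arg .
  have "r * t * (1 + r * t\<^sup>2) < \<tau> * (1 + q * t\<^sup>2)"
    using tau q t unfolding \<rho>_def t_def[symmetric] \<tau>_def[symmetric] by (simp add: divide_less_eq add_pos_nonneg)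
  \<comment> \<open>Clearing denominators and collecting the terms in \<tau> is where q = 1 + r -
    r^2 comes from.\<close>
  moreover have "(t + \<tau>) * (1 - r\<^sup>2 * t\<^sup>2) - (1 + r) * t * (1 - t * \<tau>) = \<tau> * (1 + q * t\<^sup>2) - r * t * (1 + r * t\<^sup>2)"
    unfolding q_def by algebra
  ultimately have "(1 + r) * t * (1 - t * \<tau>) < (t + \<tau>) * (1 - r\<^sup>2 * t\<^sup>2)" by linarith
  then have "(1 + r) * t * ((1 - t * \<tau>) / (t + \<tau>)) < 1 - r\<^sup>2 * t\<^sup>2" using t by (simp add: field_simps)
  then have "(N\<^sup>2 / t\<^sup>2) * ((1 + r) * t * ((1 - t * \<tau>) / (t + \<tau>))) < (N\<^sup>2 / t\<^sup>2) * (1 - r\<^sup>2 * t\<^sup>2)"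
    using t N by (intro mult_strict_left_mono) auto
  moreover have "(N\<^sup>2 / t\<^sup>2) * (1 - r\<^sup>2 * t\<^sup>2) = N\<^sup>2 * (1/t)\<^sup>2 - 4"
    using t N by (simp add: r_def field_simps power2_eq_square)
  moreover have k3: "(N\<^sup>2 / t\<^sup>2) * ((1 + r) * t * X) = (N+2) * N * (1/t) * X" for X
    using t N by (simp add: r_def power2_eq_square field_simps)
  ultimately show ?thesis unfolding targ tw using k3[of "(1 - t * \<tau>) / (t + \<tau>)"] by linarith
qed

section \<open>Critical configurations with two or three different angles\<close>

text \<open>In terms of the half sum w and half difference d, the critical equation is divisible by
  sin d and then splits into two factors. One is positive; the other one says N^2 t^2 + n e t u = 4
  with t = tan w, u = tan d, e = m1 - m2 and N = n - 2. The constraint n w + e d = pi contradicts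
  this.\<close>

lemma two_angle_not_critical:
  fixes m1 m2 :: nat and a b :: real
  defines "n \<equiv> real (m1 + m2)"
  defines "\<sigma> \<equiv> m1 * sin a + m2 * sin b"
  assumes m: "1 \<le> m1" "1 \<le> m2" "5 \<le> m1 + m2"
    and ab: "0 < b" "b < a" "m1 * a + m2 * b = pi"
    and crit: "n * (cos a - cos b) * (\<sigma> - 2 * sin a) * (\<sigma> - 2 * sin b)
      = 4 * (m1 * (sin a * cos a) + m2 * (sin b * cos b)) * (sin b - sin a)"
  shows False
proof -
  define w d where "w = (a + b)/2" and "d = (a - b)/2"
  define e where "e = real m1 - real m2"
  define N where "N = n - 2"
  have nr: "n = real m1 + real m2" by (simp add: n_def)
  have N3: "3 \<le> N" using m by (simp add: N_def n_def)
  have wd: "a = w + d" "b = w - d" "0 < d" "d < w" using ab by (auto simp: w_def d_def field_simps)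
  have sumw: "n * w + e * d = pi" using ab unfolding nr e_def wd by (simp add: algebra_simps)
  have "1 * a + 1 * b < m1 * a + m2 * b"
  proof (cases "2 \<le> m1")
    case True
    then have "2 * a \<le> real m1 * a" "1 * b \<le> real m2 * b" using m ab by (intro mult_right_mono; simp)+
    then show ?thesis using ab by linarith
  next
    case False
    then have "2 * b \<le> real m2 * b" "1 * a \<le> real m1 * a" using m ab by (intro mult_right_mono; simp)+
    then show ?thesis using ab by linarith
  qed
  then have w2: "w < pi/2" using ab by (simp add: w_def)
  define S C s c :: real where "S = sin w" and "C = cos w" and "s = sin d" and "c = cos d"
  have pos: "S > 0" "C > 0" "s > 0" "c > 0"
    unfolding S_def C_def s_def c_def using wd w2 by (auto intro!: sin_gt_zero cos_gt_zero_pi)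
  have sc: "sin a = S * c + C * s" "cos a = C * c - S * s" "sin b = S * c - C * s" "cos b = C * c + S * s"
    unfolding wd S_def C_def s_def c_def by (auto simp: sin_add cos_add sin_diff cos_diff)
  have "sin b > 0" using ab wd w2 by (intro sin_gt_zero) auto
  then have CsSc: "C * s < S * c" using sc by simp
  \<comment> \<open>Both cos a - cos b = - 2 S s and sin b - sin a = - 2 C s contain the factor
    s.\<close>
  have "s * (n * S * (\<sigma> - 2 * sin a) * (\<sigma> - 2 * sin b) - 4 * (m1 * (sin a * cos a) + m2 * (sin b * cos b)) * C) = 0"
    using crit unfolding sc by algebra
  then have "n * S * (\<sigma> - 2 * sin a) * (\<sigma> - 2 * sin b) - 4 * (m1 * (sin a * cos a) + m2 * (sin b * cos b)) * C = 0"
    using pos by simp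
  moreover have "n * S * (\<sigma> - 2 * sin a) * (\<sigma> - 2 * sin b) - 4 * (m1 * (sin a * cos a) + m2 * (sin b * cos b)) * C
      = (n*S * c + e*C * s) * (N\<^sup>2*S\<^sup>2 * c + n*e*S*C * s - 4*C\<^sup>2 * c)"
    unfolding \<sigma>_def sc N_def e_def nr by algebra
  moreover have "n*S * c + e*C * s > 0"
  proof -
    have "- n * (S * c) < - n * (C * s)" using CsSc m by (simp add: n_def)
    also have "\<dots> \<le> e * (C * s)" using pos by (intro mult_right_mono) (auto simp: e_def nr)
    finally show ?thesis by (simp add: algebra_simps)
  qed
  ultimately have fac: "N\<^sup>2*S\<^sup>2 * c + n*e*S*C * s = 4*C\<^sup>2 * c" by simp
  define t u where "t = tan w" and "u = tan d"
  have key: "N\<^sup>2 * t\<^sup>2 + n * e * t * u = 4"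
  proof -
    have St: "S = t * C" "s = u * c" using pos by (auto simp: t_def u_def tan_def S_def C_def s_def c_def)
    have "C\<^sup>2 * c * (N\<^sup>2 * t\<^sup>2 + n * e * t * u) = C\<^sup>2 * c * 4" using fac unfolding St by algebra
    then show ?thesis using pos by simp
  qed
  have tu: "t > 0" "u > 0" unfolding t_def u_def using wd w2 by (auto intro: tan_gt_zero)
  have n0: "n > 0" using m by (simp add: n_def)
  show False
  \<comment> \<open>Replacing e tan d by N tan (e d / N) uses convexity of tan, which points the
    right way for e >= 0; for m1 = 1 one has e = - N and nothing is lost. A negative e with m1 >= 2
    needs another argument.\<close>
  proof (cases "0 \<le> e \<or> m1 = 1")
    case True
    have eN: "\<bar>e\<bar> \<le> N" unfolding e_def N_def nr using m by auto
    have "e * d \<le> N * d" using eN wd by (intro mult_right_mono) auto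
    also have "\<dots> \<le> N * w" using N3 wd by (intro mult_left_mono) auto
    finally have "pi \<le> (2*N + 2) * w" using sumw by (simp add: N_def algebra_simps)
    then have w1: "pi / (2*N + 2) \<le> w" using N3 by (simp add: divide_le_eq mult.commute)
    have G: "4 < N\<^sup>2 * t\<^sup>2 - (N + 2) * N * t * tan (((N + 2) * w - pi)/N)"
      unfolding t_def by (rule tan_two_scale_bound[OF N3 w1 w2])
    have "(N + 2) * w - pi = - (e * d)" using sumw by (simp add: N_def)
    then have arg: "((N + 2) * w - pi)/N = - (e / N * d)" by simp
    have G': "4 < N\<^sup>2 * t\<^sup>2 + n * N * t * tan (e / N * d)" using G unfolding arg by (simp add: N_def)
    have "N * tan (e / N * d) \<le> e * u"
    proof (cases "0 \<le> e")
      case True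
      then have "tan (e / N * d) \<le> e / N * tan d" using eN N3 wd w2
        by (intro tan_scale_le) (auto simp: field_simps)
      then show ?thesis using N3 by (simp add: u_def field_simps)
    next
      case False
      then have "e = - N" using \<open>0 \<le> e \<or> m1 = 1\<close> by (auto simp: e_def N_def nr)
      then show ?thesis using N3 by (simp add: u_def)
    qed
    then have "n * t * (N * tan (e / N * d)) \<le> n * t * (e * u)"
      using n0 tu by (intro mult_left_mono) auto
    with G' key show False by (simp add: algebra_simps)
  next
    case False
    then have e: "e < 0" "2 \<le> m1" using m by auto
    define f where "f = - e"
    have f: "0 < f" "f \<le> N - 2" using e by (auto simp: f_def e_def N_def nr)
    have fd: "f * d = n * w - pi" using sumw by (simp add: f_def)
    have "f * d < (N - 2) * w" using f wd by (intro mult_le_less_imp_less) auto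
    \<comment> \<open>The smaller angle now occurs at least four times more often than 2 - N allows
      in the extreme case m1 = 1, that is f \<le> n - 4; with d < w this pushes w below
      pi/4.\<close>
    then have w4: "4 * w < pi" using fd by (simp add: N_def algebra_simps)
    have "tan (d / w * w) < d / w * tan w" using wd w2 by (intro tan_scale_less) auto
    then have ud: "u * w < d * t" using wd by (simp add: u_def t_def field_simps)
    \<comment> \<open>Written as w = pi / r, w is the half angle of a regular r-gon with real r
      between 4 and n; hence \<open>tan_pi_div_ge\<close> is stated for real r.\<close>
    define r where "r = pi / w"
    have "0 < f * d" using f wd by simp
    then have "pi < n * w" using fd by linarith
    moreover have "0 < w" using wd by linarith
    ultimately have r: "4 \<le> r" "r < n"
      using w4 by (auto simp: r_def divide_less_eq le_divide_eq)
    have fu: "f * u < (n - r) * t"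
    proof -
      have "f * (u * w) < f * (d * t)" using ud f by simp
      also have "\<dots> = (n * w - pi) * t" using fd by (simp add: mult.assoc)
      also have "\<dots> = ((n - r) * t) * w" using wd by (simp add: r_def left_diff_distrib)
      finally have "(f * u) * w < ((n - r) * t) * w" by (simp add: mult.assoc)
      then show ?thesis using wd by (simp add: mult_less_cancel_right)
    qed
    have "n * t * (f * u) < n * t * ((n - r) * t)" using fu n0 tu by (intro mult_strict_left_mono) auto
    moreover have "n * t * (f * u) = N\<^sup>2 * t\<^sup>2 - 4" using key by (simp add: f_def algebra_simps)
    ultimately have lt: "N\<^sup>2 * t\<^sup>2 - 4 < n * (n - r) * t\<^sup>2" by (simp add: power2_eq_square algebra_simps)
    have "pi / r = w" using wd by (simp add: r_def)
    then have "2 \<le> (r - 2) * t" using tan_pi_div_ge[OF r(1)] by (simp add: t_def)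
    then have "4 \<le> ((r - 2) * t)\<^sup>2" using power_mono[of 2 "(r-2)*t" 2] by simp
    also have "\<dots> = (r - 2)\<^sup>2 * t\<^sup>2" by (simp add: power_mult_distrib)
    also have "\<dots> \<le> (n * (r - 4) + 4) * t\<^sup>2"
    proof (rule mult_right_mono)
      have "r * (r - 4) \<le> n * (r - 4)" using r by (intro mult_right_mono) auto
      then show "(r - 2)\<^sup>2 \<le> n * (r - 4) + 4" by (simp add: power2_eq_square algebra_simps)
    qed simp
    also have "\<dots> = N\<^sup>2 * t\<^sup>2 - n * (n - r) * t\<^sup>2" unfolding N_def by (simp add: power2_eq_square algebra_simps)
    finally show False using lt by linarith
  qed
qed

text \<open>The points \<open>cis a\<close>, \<open>cis b\<close>, \<open>cis d\<close> lie on a rectangular hyperbola meeting the unit circle in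
  four points; Vieta's formulas for that quartic give \<open>Y\<close> as the sum of the four sines.\<close>

lemma three_angle_vieta:
  fixes a b d X Y B :: real
  assumes eqs: "sin (2*a) = X * sin a + Y * cos a - B" "sin (2*b) = X * sin b + Y * cos b - B"
      "sin (2*d) = X * sin d + Y * cos d - B"
    and neq: "sin ((a - b)/2) \<noteq> 0" "sin ((a - d)/2) \<noteq> 0" "sin ((b - d)/2) \<noteq> 0"
  shows "Y = sin a + sin b + sin d + sin (a + b + d)"
proof -
  define p q r where "p = a/2" and "q = b/2" and "r = d/2"
  have h: "a = 2*p" "b = 2*q" "d = 2*r" by (auto simp: p_def q_def r_def)
  \<comment> \<open>Subtracting two of the equations removes B and leaves a common factor sin (x -
    y), so each pair of angles yields one linear equation for X and Y.\<close>
  have pair: "2 * cos (2*x + 2*y) * cos (x - y) = X * cos (x + y) - Y * sin (x + y)"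
    if "sin (4*x) = X * sin (2*x) + Y * cos (2*x) - B" "sin (4*y) = X * sin (2*y) + Y * cos (2*y) - B"
      "sin (x - y) \<noteq> 0" for x y
  proof -
    have 1: "sin (4*x) - sin (4*y) = 2 * (2 * sin (x-y) * cos (x-y)) * cos (2*x+2*y)"
    proof -
      have "(4*x - 4*y)/2 = 2*(x-y)" "(4*x + 4*y)/2 = 2*x + 2*y" by auto
      then show ?thesis using sin_diff_sin[of "4*x" "4*y"] sin_double[of "x-y"] by metis
    qed
    have 2: "sin (2*x) - sin (2*y) = 2 * sin (x-y) * cos (x+y)"
    proof -
      have "(2*x - 2*y)/2 = x-y" "(2*x + 2*y)/2 = x + y" by auto
      then show ?thesis using sin_diff_sin[of "2*x" "2*y"] by metis
    qed
    have 3: "cos (2*x) - cos (2*y) = - 2 * sin (x-y) * sin (x+y)"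
    proof -
      have "(2*y - 2*x)/2 = -(x-y)" "(2*x + 2*y)/2 = x + y" by auto
      then show ?thesis using cos_diff_cos[of "2*x" "2*y"] sin_minus[of "x-y"] by (metis (no_types, opaque_lifting) minus_mult_right mult.assoc mult.commute mult_minus_left)
    qed
    have "sin (4*x) - sin (4*y) = X * (sin (2*x) - sin (2*y)) + Y * (cos (2*x) - cos (2*y))"
      using that by (simp add: algebra_simps)
    then have "(2 * sin (x-y)) * (2 * cos (2*x+2*y) * cos (x-y)) = (2 * sin (x-y)) * (X * cos (x+y) - Y * sin (x+y))"
      unfolding 1 2 3 by (simp add: algebra_simps)
    then show ?thesis using that(3) by simp
  qed
  have hd: "(a-b)/2 = p-q" "(a-d)/2 = p-r" "(b-d)/2 = q-r" by (auto simp: h)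
  have A: "2 * cos (2*p + 2*q) * cos (p - q) = X * cos (p + q) - Y * sin (p + q)"
    by (rule pair) (use eqs neq[unfolded hd] in \<open>auto simp: h\<close>)
  have B: "2 * cos (2*p + 2*r) * cos (p - r) = X * cos (p + r) - Y * sin (p + r)"
    by (rule pair) (use eqs neq[unfolded hd] in \<open>auto simp: h\<close>)
  \<comment> \<open>The determinant of the two linear equations; Cramer's rule then gives Y.\<close>
  have det: "sin (p+r) * cos (p+q) - sin (p+q) * cos (p+r) = sin (r - q)"
    using sin_diff[of "p+r" "p+q"] by (simp add: mult.commute)
  have "Y * sin (r - q) = (2 * cos (2*p + 2*q) * cos (p - q)) * cos (p+r) - (2 * cos (2*p + 2*r) * cos (p - r)) * cos (p+q)"
    unfolding A B det[symmetric] by (simp add: algebra_simps)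
  also have "\<dots> = sin (r - q) * (sin (2*p) + sin (2*q) + sin (2*r) + sin (2*(p+q+r)))"
  proof -
    define sp cp sq cq sr cr where "sp = sin p" "cp = cos p" "sq = sin q" "cq = cos q" "sr = sin r" "cr = cos r"
    have e: "sp\<^sup>2 + cp\<^sup>2 = 1" "sq\<^sup>2 + cq\<^sup>2 = 1" "sr\<^sup>2 + cr\<^sup>2 = 1"
      by (auto simp: sp_cp_sq_cq_sr_cr_def)
    show ?thesis
      unfolding cos_add sin_add cos_diff sin_diff sin_double cos_double distrib_left
      unfolding sp_cp_sq_cq_sr_cr_def[symmetric]
      using e by algebra
  qed
  finally have "sin (r - q) * (Y - (sin (2*p) + sin (2*q) + sin (2*r) + sin (2*(p+q+r)))) = 0"
    by (simp add: algebra_simps)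
  moreover have "sin (r - q) \<noteq> 0" using neq(3) sin_minus[of "r-q"] by (simp add: h diff_divide_distrib)
  ultimately have "Y - (sin (2*p) + sin (2*q) + sin (2*r) + sin (2*(p+q+r))) = 0" by simp
  then show ?thesis by (simp add: h algebra_simps)
qed

section \<open>Area and perimeter as functions of the half central angles\<close>

text \<open>Index sets are arbitrary finite sets, so that the induction can delete a vanishing angle
  without renumbering the others.\<close>

definition sine_sum :: "'a set \<Rightarrow> ('a \<Rightarrow> real) \<Rightarrow> real" where
  "sine_sum I t = (\<Sum>i\<in>I. sin (t i))"

definition area_sum :: "'a set \<Rightarrow> ('a \<Rightarrow> real) \<Rightarrow> real" where
  "area_sum I t = (\<Sum>i\<in>I. sin (t i) * cos (t i))"

definition slack :: "'a set \<Rightarrow> ('a \<Rightarrow> real) \<Rightarrow> 'a \<Rightarrow> real" where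
  "slack I t i = sine_sum I t - 2 * sin (t i)"

definition proper_angles :: "'a set \<Rightarrow> ('a \<Rightarrow> real) \<Rightarrow> bool" where
  "proper_angles I t \<longleftrightarrow> finite I \<and> (\<forall>i\<in>I. 0 \<le> t i) \<and> sum t I = pi \<and> (\<forall>i\<in>I. 0 < slack I t i)"

definition area_ratio :: "'a set \<Rightarrow> ('a \<Rightarrow> real) \<Rightarrow> real" where
  "area_ratio I t = area_sum I t ^ card I / (\<Prod>i\<in>I. slack I t i)\<^sup>2"

lemma slack_remove:
  assumes "finite I" "i \<in> I" 
  shows "slack I t i = (\<Sum>j\<in>I-{i}. sin (t j)) - sin (t i)"
  using assms by (simp add: slack_def sine_sum_def sum.remove)

lemma sum_remove_eq:
  fixes t :: "'a \<Rightarrow> real"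
  assumes "finite I" "i \<in> I"
  shows "sum t (I-{i}) = sum t I - t i"
  using assms by (simp add: sum.remove)

text \<open>The generalized triangle inequality for sides: t i and pi - t i have the same sine, and
  pi - t i is the sum of at least two positive angles.\<close>

lemma slack_pos:
  assumes "finite I" "i \<in> I" "\<And>i. i \<in> I \<Longrightarrow> 0 < t i" "sum t I = pi" "3 \<le> card I"
  shows "0 < slack I t i"
proof -
  have s: "sum t (I-{i}) = pi - t i" using assms by (simp add: sum_remove_eq)
  have "2 \<le> card (I - {i})" using assms by simp
  then obtain a b where "a \<in> I-{i}" "b \<in> I-{i}" "a \<noteq> b"
    by (meson card_2_iff' ex_card subset_iff)
  then have "sin (sum t (I-{i})) < (\<Sum>j\<in>I-{i}. sin (t j))"
    using assms s by (intro sin_subadditive_strict[of _ _ a b]) (auto simp: less_imp_le)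
  then show ?thesis using assms s by (simp add: slack_remove)
qed

lemma adm_pos:
  assumes "finite I" "\<And>i. i \<in> I \<Longrightarrow> 0 < t i" "sum t I = pi" "3 \<le> card I"
  shows "proper_angles I t"
  using assms by (auto simp: proper_angles_def slack_pos less_imp_le)

lemma slack_le: 
  assumes "finite I" "i \<in> I" "\<And>i. i \<in> I \<Longrightarrow> 0 \<le> t i" "sum t I = pi"
  shows "slack I t i \<le> sine_sum I t"
proof -
  have "t i \<le> pi" using member_le_sum[of i I t] assms by auto
  then have "0 \<le> sin (t i)" using assms by (intro sin_ge_zero) auto
  then show ?thesis by (simp add: slack_def)
qed

lemma sum_slack:
  assumes "finite I"
  shows "(\<Sum>i\<in>I. slack I t i) = (real (card I) - 2) * sine_sum I t"
  by (simp add: slack_def sum_subtractf sine_sum_def algebra_simps flip: sum_distrib_left)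

lemma area_sum_double:
  "2 * area_sum I t = (\<Sum>i\<in>I. sin (2 * t i))"
  by (simp add: area_sum_def sum_distrib_left sin_double mult.assoc)

lemma area_sum_nonneg:
  assumes I: "finite I" "\<And>i. i \<in> I \<Longrightarrow> 0 \<le> t i" "sum t I = pi"
  shows "0 \<le> area_sum I t"
proof (cases "\<forall>i\<in>I. t i \<le> pi/2")
  case True
  have "0 \<le> sin (t i) * cos (t i)" if "i \<in> I" for i
  proof -
    have "0 \<le> t i" "t i \<le> pi/2" using that I True by auto
    then show ?thesis by (intro mult_nonneg_nonneg sin_ge_zero cos_ge_zero) auto
  qed
  then show ?thesis unfolding area_sum_def by (intro sum_nonneg)
next
  \<comment> \<open>One angle is obtuse and contributes a negative term. The doubled other angles
    add up to 2 pi - 2 t i < pi, so subadditivity of the sine compensates for it.\<close>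
  case False
  then obtain i where i: "i \<in> I" "pi/2 < t i" by auto
  have s: "sum t (I-{i}) = pi - t i" using I i by (simp add: sum_remove_eq)
  have s2: "(\<Sum>j\<in>I-{i}. 2 * t j) = 2 * pi - 2 * t i" using s by (simp flip: sum_distrib_left)
  have "sin (\<Sum>j\<in>I-{i}. 2 * t j) \<le> (\<Sum>j\<in>I-{i}. sin (2 * t j))"
    unfolding s2 by (rule order_trans[OF _ sin_subadditive]) (use I i s2 in auto)
  moreover have "sin (2 * pi - 2 * t i) = - sin (2 * t i)" by (simp add: sin_diff)
  moreover have "2 * area_sum I t = sin (2 * t i) + (\<Sum>j\<in>I-{i}. sin (2 * t j))"
    unfolding area_sum_double using I i by (simp add: sum.remove)
  ultimately show ?thesis unfolding s2 by simp
qed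

text \<open>With d = 0 this is Heron's formula for a triangle with half central angles a, b,
  c.\<close>

lemma brahmagupta:
  fixes a b c d :: real
  assumes "a + b + c + d = pi"
  defines "\<sigma> \<equiv> sin a + sin b + sin c + sin d"
  shows "(sin a * cos a + sin b * cos b + sin c * cos c + sin d * cos d)\<^sup>2 =
    (\<sigma> - 2 * sin a) * (\<sigma> - 2 * sin b) * (\<sigma> - 2 * sin c) * (\<sigma> - 2 * sin d)"
proof -
  \<comment> \<open>These coordinates absorb the constraint: c and d become complements of w - f and
    w + f, and the claim is polynomial in the sines and cosines of three free angles.\<close>
  define w e f where "w = (a+b)/2" and "e = (a-b)/2" and "f = (c-d)/2"
  have h: "a = w + e" "b = w - e" "c = pi/2 - (w - f)" "d = pi/2 - (w + f)"
    using assms by (auto simp: w_def e_def f_def field_simps)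
  have sc: "sin c = cos (w - f)" "cos c = sin (w - f)" "sin d = cos (w + f)" "cos d = sin (w + f)"
  proof -
    have "sin (pi/2 - x) = cos x" "cos (pi/2 - x) = sin x" for x :: real
      by (simp_all add: sin_diff cos_diff)
    then show "sin c = cos (w - f)" "cos c = sin (w - f)" "sin d = cos (w + f)" "cos d = sin (w + f)"
      unfolding h(3,4) by blast+
  qed
  have p: "(sin w)\<^sup>2 + (cos w)\<^sup>2 = 1" "(sin e)\<^sup>2 + (cos e)\<^sup>2 = 1" "(sin f)\<^sup>2 + (cos f)\<^sup>2 = 1" by auto
  show ?thesis
    unfolding \<sigma>_def sc unfolding h(1,2) sin_add cos_add sin_diff cos_diff using p by algebra
qed

section \<open>Area estimates for nearly degenerate angles\<close>

lemma diff_sin_le: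
  fixes x :: real
  assumes "0 \<le> x"
  shows "x - sin x \<le> x^3 / 4"
proof (cases "x < pi")
  case True
  have "(sin (x/2))\<^sup>2 \<le> (x/2)\<^sup>2" using sin_x_le_x[of "x/2"] assms True
    by (intro power_mono sin_ge_zero) auto
  then have "x * (1 - (x/2)\<^sup>2) \<le> x * (cos (x/2))\<^sup>2" 
    using assms by (intro mult_left_mono) (auto simp: cos_squared_eq)
  also have "\<dots> \<le> sin x" using assms True by (rule sin_ge_cos_half)
  finally show ?thesis by (simp add: power2_eq_square power3_eq_cube field_simps)
next
  case False
  then have x: "3 \<le> x" using pi_bounds by linarith
  have "3 * 3 * x \<le> x * x * x" using x by (intro mult_mono) auto
  then have "9 * x \<le> x^3" by (simp add: power3_eq_cube)
  moreover have "x - sin x \<le> x + 1" using sin_ge_minus_one[of x] by linarith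
  ultimately show ?thesis using x by linarith
qed

text \<open>The slope of a linear lower bound of the sine on [0, pi - pi/n]. That range covers the
  sum of all angles but the largest, since the largest of n angles is at least pi/n.\<close>

definition sine_low :: "nat \<Rightarrow> real" where "sine_low n = (cos ((pi - pi/n)/2))\<^sup>2"

lemma sine_low_pos: "1 \<le> n \<Longrightarrow> 0 < sine_low n"
proof -
  assume n: "1 \<le> n"
  have "cos ((pi - pi/n)/2) > 0" by (rule cos_gt_zero_pi) (use n in \<open>auto simp: field_simps\<close>)
  then show ?thesis by (simp add: sine_low_def)
qed

lemma sin_ge_sine_low:
  assumes n: "1 \<le> n" and x: "0 \<le> x" "x \<le> pi - pi / real n"
  shows "sine_low n * x \<le> sin x"
proof -
  have xp: "x < pi" using x n by (smt (verit) divide_pos_pos of_nat_0_less_iff pi_gt_zero zero_less_one le_eq_less_or_eq less_le_trans)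
  have "cos ((pi - pi/n)/2) \<le> cos (x/2)"
    by (rule cos_monotone_0_pi_le) (use x xp n in \<open>auto simp: field_simps\<close>)
  moreover have "0 \<le> cos ((pi - pi/n)/2)" by (rule cos_ge_zero) (use n in \<open>auto simp: field_simps\<close>)
  ultimately have "sine_low n \<le> (cos (x/2))\<^sup>2" unfolding sine_low_def by (intro power_mono)
  then have "x * sine_low n \<le> x * (cos (x/2))\<^sup>2" using x by (intro mult_left_mono)
  also have "\<dots> \<le> sin x" by (rule sin_ge_cos_half) (use x xp in auto)
  finally show ?thesis by (simp add: mult.commute)
qed

text \<open>The area exceeds that of the comparison triangle by at most g^3, where g is the sum of
  all but the two largest angles, and g^3 is at most n / (2 c^3) times the triangle area, with c =
  \<open>sine_low n\<close>.\<close>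

definition area_factor :: "nat \<Rightarrow> real" where "area_factor n = 1 + n / (2 * sine_low n ^ 3)"

text \<open>Compares the polygon with the triangle of its two largest angles and the sum of all others.\<close>

lemma area_sum_sq_le:
  assumes I: "finite I" "\<And>i. i \<in> I \<Longrightarrow> 0 \<le> t i" "sum t I = pi" and n: "3 \<le> card I"
    and ij: "i \<in> I" "j \<in> I" "i \<noteq> j" "t j \<le> t i" "\<And>l. l \<in> I \<Longrightarrow> l \<noteq> i \<Longrightarrow> t l \<le> t j"
  shows "(area_sum I t)\<^sup>2 \<le> (area_factor (card I))\<^sup>2 * (slack I t i * slack I t j) * (sine_sum I t)\<^sup>2"
proof -
  define n where "n = card I"
  define J where "J = I - {i, j}"
  define a b g where "a = t i" and "b = t j" and "g = sum t J"
  define T where "T = (\<Sum>l\<in>J. sin (t l))"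
  have J: "finite J" "i \<notin> J" "j \<notin> J" "I = insert i (insert j J)" using I ij by (auto simp: J_def)
  have JI: "J \<subseteq> I" by (auto simp: J_def)
  have abg: "a + b + g = pi" using I(3) ij J unfolding J(4) by (simp add: a_def b_def g_def)
  have nn: "0 \<le> a" "0 \<le> b" "0 \<le> g" using I ij by (auto simp: a_def b_def g_def J_def intro!: sum_nonneg)
  have T: "sin g \<le> T" unfolding g_def T_def
    using I(1,2) abg nn JI by (intro sin_subadditive) (auto simp: J(1) simp flip: g_def)
  have \<sigma>: "sine_sum I t = sin a + sin b + T" using J ij unfolding J(4) by (simp add: sine_sum_def a_def b_def T_def)
  have s0: "0 \<le> sin a" "0 \<le> sin b" "0 \<le> sin g" using nn abg by (auto intro!: sin_ge_zero)
  define A3 where "A3 = 2 * sin a * sin b * sin g"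
  have A3: "A3 = sin a * cos a + sin b * cos b + sin g * cos g"
  proof -
    have g: "g = pi - (a + b)" using abg by simp
    have p: "(sin a)\<^sup>2 + (cos a)\<^sup>2 = 1" "(sin b)\<^sup>2 + (cos b)\<^sup>2 = 1" by auto
    have "sin g = sin a * cos b + cos a * sin b" "cos g = sin a * sin b - cos a * cos b"
      unfolding g by (simp_all add: sin_add cos_add sin_diff cos_diff)
    then show ?thesis unfolding A3_def using p by algebra
  qed
  have area: "area_sum I t = sin a * cos a + sin b * cos b + (\<Sum>l\<in>J. sin (t l) * cos (t l))"
    using J ij unfolding J(4) by (simp add: area_sum_def a_def b_def)
  \<comment> \<open>The angles in J contribute at most g, while the single merged angle g
    contributes at least g - g^3.\<close>
  have "(\<Sum>l\<in>J. sin (t l) * cos (t l)) \<le> (\<Sum>l\<in>J. t l)"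
  proof (rule sum_mono)
    fix l assume l: "l \<in> J"
    have "2 * (sin (t l) * cos (t l)) = sin (2 * t l)" by (simp add: sin_double)
    also have "\<dots> \<le> 2 * t l" using sin_x_le_x[of "2 * t l"] I(2)[of l] l by (auto simp: J_def)
    finally show "sin (t l) * cos (t l) \<le> t l" by simp
  qed
  moreover have "2 * g - 2 * (sin g * cos g) \<le> 2 * g^3"
    using diff_sin_le[of "2*g"] nn by (simp add: sin_double power_mult_distrib)
  ultimately have AA: "area_sum I t \<le> A3 + g^3" unfolding area A3 by (simp add: g_def)
  define c where "c = sine_low n"
  have c: "c > 0" using n sine_low_pos[of n] by (simp add: c_def n_def)
  have nI: "pi \<le> n * a"
  proof -
    have "sum t I \<le> (\<Sum>l\<in>I. a)" using ij by (intro sum_mono) (force simp: a_def)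
    then show ?thesis using I by (simp add: n_def)
  qed
  then have "pi / n \<le> a" using n by (simp add: n_def field_simps)
  \<comment> \<open>This keeps b, g and b + g within the range of the linear lower bound for the
    sine.\<close>
  then have lim: "b + g \<le> pi - pi/n" using abg by simp
  have "c * (b + g) \<le> sin (b + g)" "c * b \<le> sin b" "c * g \<le> sin g"
    unfolding c_def by (rule sin_ge_sine_low; use n lim nn in \<open>simp add: n_def\<close>)+
  moreover have "sin (b + g) = sin a"
  proof -
    have "b + g = pi - a" using abg by simp
    then show ?thesis by simp
  qed
  ultimately have "c * g \<le> sin a" "c * b \<le> sin b" "c * g \<le> sin g"
    using c nn by (auto intro: order_trans[OF mult_left_mono[of g "b+g" c]])
  then have "2 * (c * g) * (c * b) * (c * g) \<le> A3" unfolding A3_def using c nn s0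
    by (intro mult_mono mult_nonneg_nonneg) auto
  then have A3l: "2 * c^3 * (g\<^sup>2 * b) \<le> A3" by (simp add: power2_eq_square power3_eq_cube algebra_simps)
  have gb: "g \<le> n * b"
  proof -
    have "g \<le> (\<Sum>l\<in>J. b)" unfolding g_def using ij by (intro sum_mono) (auto simp: b_def J_def)
    also have "\<dots> \<le> n * b" using I nn card_mono[of I J] by (auto simp: n_def J_def intro!: mult_right_mono)
    finally show ?thesis .
  qed
  have "g^3 = g\<^sup>2 * g" by (simp add: power2_eq_square power3_eq_cube)
  also have "\<dots> \<le> g\<^sup>2 * (n * b)" using gb by (intro mult_left_mono) auto
  also have "\<dots> = n / (2 * c^3) * (2 * c^3 * (g\<^sup>2 * b))" using c by simp
  also have "\<dots> \<le> n / (2 * c^3) * A3" using A3l c by (intro mult_left_mono) auto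
  finally have AK: "area_sum I t \<le> area_factor n * A3"
    using AA by (simp add: area_factor_def c_def algebra_simps)
  have K: "0 \<le> area_factor n" unfolding area_factor_def using c by (simp add: c_def)
  have "(area_sum I t)\<^sup>2 \<le> (area_factor n * A3)\<^sup>2" using AK area_sum_nonneg[OF I] by (intro power_mono)
  also have "\<dots> = (area_factor n)\<^sup>2 * A3\<^sup>2" by (simp add: power_mult_distrib)
  finally have AA3: "(area_sum I t)\<^sup>2 \<le> (area_factor n)\<^sup>2 * A3\<^sup>2" .
  \<comment> \<open>Heron's formula. Replacing sin g by the larger sum T of the separate sines
    increases each factor that is kept, and the factor with - sin g is bounded by the sine
    sum.\<close>
  have "A3\<^sup>2 = (sin b + sin g - sin a) * (sin a + sin g - sin b) * (sin a + sin b - sin g) * (sin a + sin b + sin g)"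
    using brahmagupta[of a b g 0] abg unfolding A3 by (simp add: algebra_simps)
  also have "\<dots> \<le> slack I t i * slack I t j * sine_sum I t * sine_sum I t"
  proof -
    have tr: "sin x \<le> sin y + sin z" if "x + y + z = pi" "0 \<le> x" "0 \<le> y" "0 \<le> z" for x y z :: real
    proof -
      have x: "x = pi - (y + z)" using that by simp
      have "0 \<le> 4 * sin (y/2) * sin (z/2) * sin ((y+z)/2)"
        using that by (intro mult_nonneg_nonneg sin_ge_zero) auto
      then show ?thesis unfolding x using sin_add_sin_diff[of y z] by simp
    qed
    have t3: "sin a \<le> sin b + sin g" "sin b \<le> sin a + sin g" "sin g \<le> sin a + sin b"
      using abg nn by (auto intro!: tr)
    show ?thesis
      unfolding slack_def \<sigma> a_def[symmetric] b_def[symmetric]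
      using T t3 s0 by (intro mult_mono mult_nonneg_nonneg) auto
  qed
  finally have "A3\<^sup>2 \<le> slack I t i * slack I t j * sine_sum I t * sine_sum I t" .
  then have "(area_factor n)\<^sup>2 * A3\<^sup>2 \<le> (area_factor n)\<^sup>2 * (slack I t i * slack I t j * sine_sum I t * sine_sum I t)"
    by (rule mult_left_mono) simp
  with AA3 show ?thesis by (simp add: n_def power2_eq_square mult.assoc)
qed

section \<open>Existence of a maximizer\<close>

lemma obtain_max:
  fixes t :: "'a \<Rightarrow> real"
  assumes "finite I" "I \<noteq> {}"
  obtains i where "i \<in> I" "\<And>l. l \<in> I \<Longrightarrow> t l \<le> t i"
proof -
  have "Max (t ` I) \<in> t ` I" using assms by (intro Max_in) auto
  then obtain i where "i \<in> I" "t i = Max (t ` I)" by auto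
  with assms that show ?thesis by (metis Max_ge finite_imageI imageI)
qed

lemma sine_sum_pos: "proper_angles I t \<Longrightarrow> I \<noteq> {} \<Longrightarrow> 0 < sine_sum I t"
  using slack_le[of I _ t] by (fastforce simp: proper_angles_def)

text \<open>Keeps the polygons with a large ratio away from the degenerate ones, where the ratio is discontinuous.\<close>

lemma ratio_sq_le_slack:
  assumes n: "5 \<le> card I"
  shows "\<exists>M>0. \<forall>t. proper_angles I t \<longrightarrow> (\<forall>i\<in>I. (area_ratio I t)\<^sup>2 * sine_sum I t \<le> M * slack I t i)"
proof -
  define n where "n = card I"
  define K where "K = area_factor n"
  have K: "K > 0" unfolding K_def area_factor_def using n sine_low_pos[of n] by (simp add: n_def add_pos_nonneg)
  define M0 where "M0 = (K\<^sup>2)^n * 3^(4*(n-2))"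
  have M0: "M0 > 0" using K by (simp add: M0_def)
  have "(area_ratio I t)\<^sup>2 * sine_sum I t \<le> 3 * M0 * slack I t l" if a: "proper_angles I t" and l: "l \<in> I" for t l
  proof -
    have I: "finite I" "\<And>i. i \<in> I \<Longrightarrow> 0 \<le> t i" "sum t I = pi" "\<And>i. i \<in> I \<Longrightarrow> 0 < slack I t i"
      using a by (auto simp: proper_angles_def)
    define \<sigma> where "\<sigma> = sine_sum I t"
    have \<sigma>: "\<sigma> > 0" using sine_sum_pos[OF a] l by (auto simp: \<sigma>_def)
    obtain i where i: "i \<in> I" "\<And>l. l \<in> I \<Longrightarrow> t l \<le> t i" using obtain_max[of I t] I l by blast
    have "I \<noteq> {i}" using n by auto
    then have "I - {i} \<noteq> {}" using i by auto
    then obtain j where j: "j \<in> I - {i}" "\<And>l. l \<in> I - {i} \<Longrightarrow> t l \<le> t j"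
      using obtain_max[of "I - {i}" t] I(1) by (metis finite_Diff)
    define X where "X = slack I t i * slack I t j"
    define J where "J = I - {i,j}"
    define P where "P = (\<Prod>i\<in>I. slack I t i)"
    have X: "0 < X" unfolding X_def using I i j by simp
    have le: "slack I t k \<le> \<sigma>" if "k \<in> I" for k using slack_le[of I k t] I that by (simp add: \<sigma>_def)
    have X2: "X \<le> \<sigma>\<^sup>2" unfolding X_def power2_eq_square using le i j I \<sigma> by (intro mult_mono) (auto simp: less_imp_le)
    have A: "(area_sum I t)\<^sup>2 \<le> K\<^sup>2 * X * \<sigma>\<^sup>2"
      unfolding K_def n_def X_def \<sigma>_def using I n i j by (intro area_sum_sq_le) auto
    \<comment> \<open>The angle t k and the two largest add up to at most pi, so sin (t k) is the
      smallest of three sines within \<sigma> and is at most \<sigma> / 3. Only the slacks of the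
      two largest angles can therefore be small.\<close>
    have s3: "\<sigma> / 3 \<le> slack I t k" if k: "k \<in> J" for k
    proof -
      have kk: "k \<in> I" "k \<noteq> i" "k \<noteq> j" using k by (auto simp: J_def)
      have "sum t {k, j, i} \<le> sum t I" using I kk i j by (intro sum_mono2) auto
      then have s: "t k + t j + t i \<le> pi" using kk j I by simp
      have "sin (t k) \<le> sin (t j)" "sin (t k) \<le> sin (t i)"
        using s I(2)[of k] I(2)[of j] I(2)[of i] kk i j by (auto intro!: sin_le_sin_sum_le_pi)
      moreover have "sum (\<lambda>x. sin (t x)) {k, j, i} \<le> \<sigma>" unfolding \<sigma>_def sine_sum_def
      proof (intro sum_mono2)
        fix b assume "b \<in> I - {k,j,i}"
        then show "0 \<le> sin (t b)" using I member_le_sum[of b I t] by (intro sin_ge_zero) auto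
      qed (use I kk i j in auto)
      then have "sin (t k) + sin (t j) + sin (t i) \<le> \<sigma>" using kk j by simp
      ultimately show ?thesis by (simp add: slack_def flip: \<sigma>_def)
    qed
    have cJ: "card J = n - 2" using i j I by (auto simp: J_def n_def card_Diff_subset)
    have P: "P = X * (\<Prod>k\<in>J. slack I t k)"
    proof -
      have "I = insert i (insert j J)" using i j by (auto simp: J_def)
      then have "P = (\<Prod>k\<in>insert i (insert j J). slack I t k)" by (simp add: P_def)
      also have "\<dots> = X * (\<Prod>k\<in>J. slack I t k)"
      proof -
        have "finite J" "j \<notin> J" "i \<notin> insert j J" using I(1) j(1) by (auto simp: J_def)
        then show ?thesis by (simp add: X_def)
      qed
      finally show ?thesis .
    qed
    have "(\<Prod>k\<in>J. \<sigma>/3) \<le> (\<Prod>k\<in>J. slack I t k)" using s3 \<sigma> by (intro prod_mono) auto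
    then have "(\<sigma>/3)^(n-2) \<le> (\<Prod>k\<in>J. slack I t k)" by (simp add: cJ)
    then have P1: "X * (\<sigma>/3)^(n-2) \<le> P" unfolding P using X by (intro mult_left_mono) auto
    have P0: "P > 0" unfolding P_def using I by (intro prod_pos) auto
    have P4: "(X * (\<sigma>/3)^(n-2))^4 \<le> P^4" using P1 X \<sigma> by (intro power_mono) auto
    have "((area_sum I t)\<^sup>2)^n \<le> (K\<^sup>2 * X * \<sigma>\<^sup>2)^n" using A by (intro power_mono) auto
    then have "((area_sum I t)\<^sup>2)^n * \<sigma>\<^sup>2 \<le> (K\<^sup>2 * X * \<sigma>\<^sup>2)^n * \<sigma>\<^sup>2" by (intro mult_right_mono) auto
    \<comment> \<open>Here n >= 5 enters: the denominator of the squared ratio takes up X^4, and one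
      factor X is left over, which forces the ratio to be small when a slack is small.\<close>
    also have "\<dots> = (K\<^sup>2)^n * (X^5 * (\<sigma>\<^sup>2)^(n+1)) * X^(n-5)"
    proof -
      have "X^n = X^5 * X^(n-5)" using n by (simp add: n_def flip: power_add)
      then show ?thesis by (simp add: power_mult_distrib algebra_simps)
    qed
    also have "\<dots> \<le> (K\<^sup>2)^n * (X^5 * (\<sigma>\<^sup>2)^(n+1)) * (\<sigma>\<^sup>2)^(n-5)"
      using X2 X K \<sigma> by (intro mult_left_mono power_mono) auto
    also have "\<dots> = M0 * X * (X * (\<sigma>/3)^(n-2))^4"
    proof -
      have e1: "(\<sigma>\<^sup>2)^(n+1) * (\<sigma>\<^sup>2)^(n-5) = \<sigma>^(4*(n-2))"
      proof -
        have "2 * (n+1) + 2 * (n-5) = 4*(n-2)" using n by (simp add: n_def)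
        then show ?thesis by (metis power_add power_mult)
      qed
      have e2: "3^(4*(n-2)) * ((\<sigma>/3)^(n-2))^4 = \<sigma>^(4*(n-2))"
        by (simp add: power_divide mult.commute flip: power_mult)
      have "(K\<^sup>2)^n * (X^5 * (\<sigma>\<^sup>2)^(n+1)) * (\<sigma>\<^sup>2)^(n-5) = (K\<^sup>2)^n * X^5 * \<sigma>^(4*(n-2))"
        by (simp only: mult.assoc e1)
      also have "\<dots> = (K\<^sup>2)^n * X^5 * (3^(4*(n-2)) * ((\<sigma>/3)^(n-2))^4)" by (simp only: e2)
      also have "\<dots> = M0 * X * (X * (\<sigma>/3)^(n-2))^4"
        by (simp add: M0_def power_mult_distrib power_eq_if)
      finally show ?thesis .
    qed
    also have "\<dots> \<le> M0 * X * P^4" using P4 M0 X by (intro mult_left_mono) auto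
    finally have main: "((area_sum I t)\<^sup>2)^n * \<sigma>\<^sup>2 \<le> M0 * X * P^4" .
    have "(area_ratio I t)\<^sup>2 * P^4 = ((area_sum I t)\<^sup>2)^n"
    proof -
      have "(area_ratio I t)\<^sup>2 = (area_sum I t ^ n)\<^sup>2 / P^4"
        unfolding area_ratio_def P_def n_def by (simp add: power_divide flip: power_mult)
      then show ?thesis using P0 by (simp add: flip: power_mult) (simp add: mult.commute)
    qed
    with main have "((area_ratio I t)\<^sup>2 * \<sigma>\<^sup>2) * P^4 \<le> (M0 * X) * P^4" by (simp add: algebra_simps)
    then have R: "(area_ratio I t)\<^sup>2 * \<sigma>\<^sup>2 \<le> M0 * X" using P0 by (simp add: mult_le_cancel_right)
    have key: "(area_ratio I t)\<^sup>2 * \<sigma> \<le> M0 * slack I t k" if k: "k = i \<or> k = j" for k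
    proof -
      have "X \<le> slack I t k * \<sigma>" using k le[of i] le[of j] i j I
        by (auto simp: X_def less_imp_le intro!: mult_left_mono mult_right_mono simp: mult.commute)
      then have "M0 * X \<le> M0 * (slack I t k * \<sigma>)" using M0 by simp
      with R have "((area_ratio I t)\<^sup>2 * \<sigma>) * \<sigma> \<le> (M0 * slack I t k) * \<sigma>"
        by (simp add: power2_eq_square algebra_simps)
      then show ?thesis using \<sigma> by (simp add: mult_le_cancel_right)
    qed
    show "(area_ratio I t)\<^sup>2 * sine_sum I t \<le> 3 * M0 * slack I t l"
    proof (cases "l \<in> J")
      case True
      have "(area_ratio I t)\<^sup>2 * \<sigma> \<le> M0 * slack I t i" using key by auto
      also have "\<dots> \<le> M0 * \<sigma>" using le i M0 by simp
      also have "\<dots> \<le> M0 * (3 * slack I t l)" using s3[OF True] M0 by simp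
      finally show ?thesis by (simp add: \<sigma>_def)
    next
      case False
      then have "(area_ratio I t)\<^sup>2 * \<sigma> \<le> M0 * slack I t l" using key l by (auto simp: J_def)
      moreover have "0 \<le> M0 * slack I t l" using M0 I l by (simp add: less_imp_le)
      ultimately show ?thesis by (simp add: \<sigma>_def)
    qed
  qed
  then show ?thesis using M0 by (intro exI[of _ "3 * M0"]) auto
qed

text \<open>Rules out concentration of all angles at one index. If g is the sum of all angles but
  the largest, the slack of the largest is at most g^3 / 4 while the sine sum is at least g / 2, so
  g cannot be small.\<close>

lemma sine_sum_ge_of_slack:
  assumes a: "proper_angles I t" and I0: "I \<noteq> {}" and e: "0 < \<eta>" "\<And>i. i \<in> I \<Longrightarrow> \<eta> * sine_sum I t \<le> slack I t i"
  shows "sqrt (2 * \<eta>) / 2 \<le> sine_sum I t"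
proof -
  have I: "finite I" "\<And>i. i \<in> I \<Longrightarrow> 0 \<le> t i" "sum t I = pi" "\<And>i. i \<in> I \<Longrightarrow> 0 < slack I t i"
    using a by (auto simp: proper_angles_def)
  obtain i where i: "i \<in> I" "\<And>l. l \<in> I \<Longrightarrow> t l \<le> t i" using obtain_max[of I t] I I0 by blast
  define g where "g = sum t (I - {i})"
  have g: "g = pi - t i" "0 \<le> g" unfolding g_def
    using I i by (simp add: sum_remove_eq) (use I i in \<open>auto intro!: sum_nonneg\<close>)
  have tl: "0 \<le> t l \<and> t l \<le> pi/2" if l: "l \<in> I - {i}" for l
  proof -
    have "t l \<le> g" unfolding g_def using I l by (intro member_le_sum) auto
    then show ?thesis using g I l i(2)[of l] by auto
  qed
  have "(\<Sum>l\<in>I-{i}. sin (t l)) \<le> (\<Sum>l\<in>I-{i}. t l)" using tl by (intro sum_mono sin_x_le_x) auto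
  moreover have "sin (t i) = sin g" using g by simp
  ultimately have sl: "slack I t i \<le> g^3/4"
    using diff_sin_le[OF g(2)] I i by (simp add: slack_remove g_def)
  have "1/2 * g \<le> (\<Sum>l\<in>I-{i}. sin (t l))"
    unfolding g_def sum_distrib_left
  proof (rule sum_mono)
    fix l assume l: "l \<in> I - {i}"
    have "cos (pi/4) \<le> cos (t l / 2)" using tl[OF l] by (intro cos_monotone_0_pi_le) auto
    then have "(cos (pi/4))\<^sup>2 \<le> (cos (t l / 2))\<^sup>2" by (intro power_mono) (auto simp: cos_45)
    then have "1/2 * t l \<le> (cos (t l / 2))\<^sup>2 * t l" using tl[OF l] by (intro mult_right_mono) (auto simp: cos_45 power_divide)
    also have "\<dots> \<le> sin (t l)" using sin_ge_cos_half[of "t l"] tl[OF l] pi_gt_zero by (simp add: mult.commute)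
    finally show "1/2 * t l \<le> sin (t l)" .
  qed
  moreover have "0 \<le> sin (t i)" using g I i by (intro sin_ge_zero) auto
  ultimately have gs: "g / 2 \<le> sine_sum I t" using I i by (simp add: sine_sum_def sum.remove)
  have g0: "g > 0" using sl I(4)[OF i(1)] g(2) by (cases "g = 0") auto
  have "\<eta> * (g/2) \<le> \<eta> * sine_sum I t" using gs e by simp
  also have "\<dots> \<le> g^3/4" using e(2)[OF i(1)] sl by linarith
  finally have "2 * \<eta> * g \<le> g\<^sup>2 * g" by (simp add: power2_eq_square power3_eq_cube)
  then have "2 * \<eta> \<le> g\<^sup>2" using g0 by simp
  then have "sqrt (2 * \<eta>) \<le> g" using g0 by (simp add: real_le_lsqrt)
  with gs show ?thesis by linarith
qed

lemma ratio_pos: 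
  assumes "proper_angles I t" "0 < area_sum I t" shows "0 < area_ratio I t"
  using assms by (auto simp: area_ratio_def proper_angles_def intro!: divide_pos_pos zero_less_power prod_pos)

lemma continuous_on_coordinate: "continuous_on S (\<lambda>t. t i)"
  by (rule continuous_on_subset[OF continuous_on_product_coordinates]) simp

lemma continuous_on_sin_coordinate: "continuous_on S (\<lambda>t. sin (t i :: real))"
  by (rule continuous_on_compose2[of UNIV sin S "\<lambda>t. t i"]) (auto intro: continuous_on_coordinate continuous_on_sin)

lemma continuous_on_cos_coordinate: "continuous_on S (\<lambda>t. cos (t i :: real))"
  by (rule continuous_on_compose2[of UNIV cos S "\<lambda>t. t i"]) (auto intro: continuous_on_coordinate continuous_on_cos)

lemma continuous_on_sine_sum: "continuous_on S (\<lambda>t. sine_sum I t)"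
  unfolding sine_sum_def by (intro continuous_on_sum continuous_on_sin_coordinate)

lemma continuous_on_area_sum: "continuous_on S (\<lambda>t. area_sum I t)"
  unfolding area_sum_def by (intro continuous_intros continuous_on_sin_coordinate continuous_on_cos_coordinate)

lemma continuous_on_slack: "continuous_on S (\<lambda>t. slack I t i)"
  unfolding slack_def by (intro continuous_intros continuous_on_sine_sum continuous_on_sin_coordinate)

lemma continuous_on_ratio:
  assumes "\<And>t i. t \<in> S \<Longrightarrow> i \<in> I \<Longrightarrow> slack I t i \<noteq> 0" "finite I"
  shows "continuous_on S (\<lambda>t. area_ratio I t)"
  unfolding area_ratio_def using assms
  by (intro continuous_intros continuous_on_area_sum continuous_on_slack) auto

lemma regular_values:
  assumes I: "finite I" and n: "3 \<le> card I" and t: "\<And>i. i \<in> I \<Longrightarrow> t i = pi / card I"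
  shows "sine_sum I t = card I * sin (pi / card I)" "area_sum I t = card I * (sin (pi / card I) * cos (pi / card I))"
    "i \<in> I \<Longrightarrow> slack I t i = (real (card I) - 2) * sin (pi / card I)"
    "proper_angles I t" "0 < area_sum I t"
proof -
  show s: "sine_sum I t = card I * sin (pi / card I)" using t by (simp add: sine_sum_def)
  show A: "area_sum I t = card I * (sin (pi / card I) * cos (pi / card I))" using t by (simp add: area_sum_def)
  show "slack I t i = (real (card I) - 2) * sin (pi / card I)" if "i \<in> I"
    unfolding slack_def s using t that by (simp add: algebra_simps)
  show "proper_angles I t" using I n t by (intro adm_pos) auto
  show "0 < area_sum I t" unfolding A using n
    by (intro mult_pos_pos sin_gt_zero cos_gt_zero_pi) (auto simp: field_simps intro: less_le_trans[of _ 0])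
qed

lemma maximizer_exists:
  assumes I: "finite I" and n: "5 \<le> card I"
  obtains t where "proper_angles I t" "\<And>u. proper_angles I u \<Longrightarrow> area_ratio I u \<le> area_ratio I t" "0 < area_ratio I t"
proof -
  define t0 :: "'a \<Rightarrow> real" where "t0 = (\<lambda>i. if i \<in> I then pi / card I else 0)"
  have t0: "proper_angles I t0" "0 < area_sum I t0" using regular_values[OF I, of t0] n by (auto simp: t0_def)
  define r where "r = area_ratio I t0"
  have r: "r > 0" unfolding r_def using t0 by (rule ratio_pos)
  have I0: "I \<noteq> {}" using n by auto
  obtain M where M: "M > 0" "\<And>t i. proper_angles I t \<Longrightarrow> i \<in> I \<Longrightarrow> (area_ratio I t)\<^sup>2 * sine_sum I t \<le> M * slack I t i"
    using ratio_sq_le_slack[OF n] by blast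
  define \<eta> where "\<eta> = r\<^sup>2 / M"
  have \<eta>: "\<eta> > 0" using r M by (simp add: \<eta>_def)
  define \<sigma>0 where "\<sigma>0 = sqrt (2 * \<eta>) / 2"
  have \<sigma>0: "\<sigma>0 > 0" using \<eta> by (simp add: \<sigma>0_def)
  \<comment> \<open>Coordinates outside \<open>I\<close> are fixed to 0, which makes the product of
    intervals compact in the function space. The bounds with \<eta> and \<sigma>0 are closed
    conditions that keep all slacks positive.\<close>
  define K where "K = (\<Pi>\<^sub>E i\<in>UNIV. if i \<in> I then {0..pi} else {0::real}) \<inter>
     ({t. sum t I = pi} \<inter> {t. \<sigma>0 \<le> sine_sum I t} \<inter> (\<Inter>i\<in>I. {t. \<eta> * sine_sum I t \<le> slack I t i}))"
  have "compact (\<Pi>\<^sub>E i\<in>UNIV. if i \<in> I then {0..pi} else {0::real})"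
    using compactin_PiE[of "\<lambda>_. euclidean :: real topology" UNIV "\<lambda>i. if i \<in> I then {0..pi} else {0::real}"]
    by (auto simp: euclidean_product_topology)
  moreover have "closed ({t. sum t I = pi} \<inter> {t. \<sigma>0 \<le> sine_sum I t} \<inter> (\<Inter>i\<in>I. {t. \<eta> * sine_sum I t \<le> slack I t i}))"
    by (intro closed_Int closed_INT ballI closed_Collect_eq closed_Collect_le continuous_intros
      continuous_on_sine_sum continuous_on_slack continuous_on_coordinate)
  ultimately have K: "compact K" unfolding K_def by (rule compact_Int_closed)
  have Kpos: "0 < slack I t i" if "t \<in> K" "i \<in> I" for t i
  proof -
    have "\<sigma>0 \<le> sine_sum I t" "\<eta> * sine_sum I t \<le> slack I t i" using that by (auto simp: K_def)
    moreover have "0 < \<eta> * sine_sum I t" using calculation \<sigma>0 \<eta> by simp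
    ultimately show ?thesis by linarith
  qed
  have Kadm: "proper_angles I t" if "t \<in> K" for t
  proof -
    have "t i \<in> (if i \<in> I then {0..pi} else {0})" for i using that by (auto simp: K_def PiE_iff)
    then have "\<forall>i\<in>I. 0 \<le> t i" by (metis atLeastAtMost_iff)
    then show ?thesis using that Kpos[OF that] I by (auto simp: proper_angles_def K_def)
  qed
  \<comment> \<open>Every competitor at least as good as the regular polygon lies in
    \<open>K\<close> once its irrelevant coordinates are reset, so a maximum on \<open>K\<close> is
    a global one.\<close>
  have inK: "(\<lambda>i. if i \<in> I then u i else 0) \<in> K" if u: "proper_angles I u" "r \<le> area_ratio I u" for u
  proof -
    define v where "v = (\<lambda>i. if i \<in> I then u i else 0)"
    have sv: "sine_sum I v = sine_sum I u" "slack I v i = slack I u i" "sum v I = sum u I" if "i \<in> I" for i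
      using that by (auto simp: v_def sine_sum_def slack_def)
    have eta: "\<eta> * sine_sum I u \<le> slack I u i" if "i \<in> I" for i
    proof -
      have "r\<^sup>2 * sine_sum I u \<le> (area_ratio I u)\<^sup>2 * sine_sum I u"
        using u r sine_sum_pos[OF u(1) I0] by (intro mult_right_mono power_mono) auto
      also have "\<dots> \<le> M * slack I u i" using M u that by auto
      finally show ?thesis using M by (simp add: \<eta>_def field_simps)
    qed
    have "\<sigma>0 \<le> sine_sum I u" unfolding \<sigma>0_def by (rule sine_sum_ge_of_slack[OF u(1) I0 \<eta> eta])
    moreover have "0 \<le> u i \<and> u i \<le> pi" if "i \<in> I" for i
      using u that member_le_sum[of i I u] by (auto simp: proper_angles_def)
    moreover have "sum u I = pi" using u by (simp add: proper_angles_def)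
    ultimately have "v \<in> K" using eta sv I0 by (auto simp: K_def v_def[abs_def] PiE_iff)
    then show ?thesis by (simp add: v_def)
  qed
  have "t0 \<in> K" using inK[of t0] t0 by (simp add: r_def t0_def if_distrib cong: if_cong)
  then obtain t where t: "t \<in> K" "\<And>u. u \<in> K \<Longrightarrow> area_ratio I u \<le> area_ratio I t"
    using continuous_attains_sup[OF K, of "area_ratio I"] Kpos continuous_on_ratio[of K I] I
    by (metis empty_iff less_irrefl)
  have rt: "r \<le> area_ratio I t" using t \<open>t0 \<in> K\<close> by (simp add: r_def)
  show ?thesis
  proof
    show "proper_angles I t" using Kadm t by auto
    show "0 < area_ratio I t" using rt r by linarith
    fix u assume u: "proper_angles I u"
    show "area_ratio I u \<le> area_ratio I t"
    proof (cases "r \<le> area_ratio I u")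
      case True
      have "area_ratio I u = area_ratio I (\<lambda>i. if i \<in> I then u i else 0)"
        by (simp add: area_ratio_def area_sum_def slack_def sine_sum_def cong: prod.cong sum.cong)
      with t(2)[OF inK[OF u True]] show ?thesis by simp
    qed (use rt in linarith)
  qed
qed

section \<open>First-order conditions and the sharp bound\<close>

text \<open>The partial derivative of ln (\<open>area_ratio I t\<close>) with respect to t
  i.\<close>

definition gradient :: "'a set \<Rightarrow> ('a \<Rightarrow> real) \<Rightarrow> 'a \<Rightarrow> real" where
  "gradient I t i = card I * cos (2 * t i) / area_sum I t
     - 2 * cos (t i) * (\<Sum>j\<in>I. 1 / slack I t j) + 4 * cos (t i) / slack I t i"

definition maximizer :: "'a set \<Rightarrow> ('a \<Rightarrow> real) \<Rightarrow> bool" where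
  "maximizer I t \<longleftrightarrow> proper_angles I t \<and> 0 < area_ratio I t \<and> (\<forall>u. proper_angles I u \<longrightarrow> area_ratio I u \<le> area_ratio I t)"

lemma maximizer_area_pos: 
  assumes "maximizer I t" "I \<noteq> {}" shows "0 < area_sum I t"
proof -
  have "0 \<le> area_sum I t" using assms by (intro area_sum_nonneg) (auto simp: maximizer_def proper_angles_def)
  moreover have "area_sum I t \<noteq> 0"
  proof
    assume "area_sum I t = 0"
    moreover have "0 < card I" using assms by (auto simp: maximizer_def proper_angles_def card_gt_0_iff)
    ultimately have "area_ratio I t = 0" by (simp add: area_ratio_def)
    then show False using assms by (simp add: maximizer_def)
  qed
  ultimately show ?thesis by simp
qed

lemma ratio_eq_exp:
  assumes "finite I" "0 < area_sum I t" "\<And>i. i \<in> I \<Longrightarrow> 0 < slack I t i"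
  shows "area_ratio I t = exp (card I * ln (area_sum I t) - 2 * (\<Sum>i\<in>I. ln (slack I t i)))"
proof -
  have "exp (card I * ln (area_sum I t)) = area_sum I t ^ card I"
    using assms by (simp add: exp_of_nat_mult)
  moreover have "exp (2 * (\<Sum>i\<in>I. ln (slack I t i))) = (\<Prod>i\<in>I. slack I t i)\<^sup>2"
    using assms exp_of_nat_mult[of 2 "\<Sum>i\<in>I. ln (slack I t i)"] by (simp add: exp_sum)
  ultimately show ?thesis by (simp add: exp_diff area_ratio_def)
qed

text \<open>Differentiates the logarithm of the ratio along t + h d for h > 0 only: angles that
  vanish may grow but not shrink. This one-sided form is what allows a zero angle to be
  opened.\<close>

lemma maximizer_direction:
  assumes m: "maximizer I t" and I0: "I \<noteq> {}" 
    and d: "sum d I = 0" "\<And>i. i \<in> I \<Longrightarrow> t i = 0 \<Longrightarrow> 0 \<le> d i"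
  shows "(\<Sum>i\<in>I. gradient I t i * d i) \<le> 0"
proof (rule ccontr)
  assume pos: "\<not> ?thesis"
  have I: "finite I" "\<And>i. i \<in> I \<Longrightarrow> 0 \<le> t i" "sum t I = pi" "\<And>i. i \<in> I \<Longrightarrow> 0 < slack I t i"
    using m by (auto simp: proper_angles_def maximizer_def)
  have A: "0 < area_sum I t" by (rule maximizer_area_pos[OF m I0])
  define u where "u = (\<lambda>h i. t i + h * d i)"
  define g where "g = (\<lambda>h. card I * ln (area_sum I (u h)) - 2 * (\<Sum>i\<in>I. ln (slack I (u h) i)))"
  have u0: "u 0 = t" by (simp add: u_def)
  have dA: "((\<lambda>h. area_sum I (u h)) has_real_derivative (\<Sum>i\<in>I. d i * cos (2 * u h i))) (at h)" for h
  proof -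
    have "((\<lambda>h. sin (a + h * b) * cos (a + h * b)) has_real_derivative b * cos (2 * (a + h * b))) (at h)" for a b :: real
      unfolding cos_double by (auto intro!: derivative_eq_intros simp: power2_eq_square algebra_simps)
    then show ?thesis unfolding area_sum_def u_def by (intro DERIV_sum)
  qed
  have dS: "((\<lambda>h. slack I (u h) i) has_real_derivative ((\<Sum>j\<in>I. d j * cos (u h j)) - 2 * (d i * cos (u h i)))) (at h)" for h i
  proof -
    have "((\<lambda>h. sin (a + h * b)) has_real_derivative b * cos (a + h * b)) (at h)" for a b :: real
      by (auto intro!: derivative_eq_intros)
    then show ?thesis unfolding slack_def sine_sum_def u_def by (intro DERIV_diff DERIV_cmult DERIV_sum)
  qed
  define D where "D = card I * ((\<Sum>i\<in>I. d i * cos (2 * t i)) / area_sum I t)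
     - 2 * (\<Sum>i\<in>I. ((\<Sum>j\<in>I. d j * cos (t j)) - 2 * (d i * cos (t i))) / slack I t i)"
  have dg: "(g has_real_derivative D) (at 0)"
  proof -
    have 1: "((\<lambda>h. ln (area_sum I (u h))) has_real_derivative ((\<Sum>i\<in>I. d i * cos (2 * t i)) / area_sum I t)) (at 0)"
      using DERIV_chain2[OF DERIV_ln_divide dA[of 0]] A by (simp add: u0)
    have 2: "((\<lambda>h. ln (slack I (u h) i)) has_real_derivative
        (((\<Sum>j\<in>I. d j * cos (t j)) - 2 * (d i * cos (t i))) / slack I t i)) (at 0)" if "i \<in> I" for i
      using DERIV_chain2[OF DERIV_ln_divide dS[of i 0]] I(4)[OF that] by (simp add: u0)
    show ?thesis unfolding g_def D_def
      by (intro DERIV_diff DERIV_cmult DERIV_sum 1 2)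
  qed
  have "D = (\<Sum>i\<in>I. gradient I t i * d i)"
  proof -
    define E where "E = (\<Sum>j\<in>I. d j * cos (t j))"
    define W where "W = (\<Sum>j\<in>I. 1 / slack I t j)"
    have 1: "(\<Sum>i\<in>I. (E - 2 * (d i * cos (t i))) / slack I t i) =
       E * W - (\<Sum>i\<in>I. 2 * (d i * cos (t i)) / slack I t i)"
      by (simp add: W_def diff_divide_distrib sum_subtractf sum_distrib_left)
    have "(\<Sum>i\<in>I. gradient I t i * d i) = (\<Sum>i\<in>I. (card I / area_sum I t) * (d i * cos (2 * t i))
        - (2 * W) * (d i * cos (t i)) + 2 * (2 * (d i * cos (t i)) / slack I t i))"
      by (intro sum.cong refl) (simp add: gradient_def algebra_simps flip: W_def)
    also have "\<dots> = (card I / area_sum I t) * (\<Sum>i\<in>I. d i * cos (2 * t i))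
        - (2 * W) * E + 2 * (\<Sum>i\<in>I. 2 * (d i * cos (t i)) / slack I t i)"
      unfolding sum.distrib sum_subtractf by (simp add: E_def sum_distrib_left)
    also have "\<dots> = D" unfolding D_def E_def[symmetric] 1 by (simp add: algebra_simps)
    finally show ?thesis by simp
  qed
  with pos have D: "D > 0" by simp
  then obtain \<delta> where \<delta>: "\<delta> > 0" "\<And>h. 0 < h \<Longrightarrow> h < \<delta> \<Longrightarrow> g 0 < g h"
    using DERIV_pos_inc_right[OF dg] by auto
  have e0: "\<forall>\<^sub>F h in at_right 0. g 0 < g h"
    unfolding eventually_at_right_field using \<delta> by auto
  have eA: "\<forall>\<^sub>F h in at_right 0. 0 < area_sum I (u h)"
  proof -
    have "((\<lambda>h. area_sum I (u h)) \<longlongrightarrow> area_sum I (u 0)) (at_right 0)"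
      using DERIV_isCont[OF dA[of 0]] unfolding isCont_def by (rule tendsto_within_subset) simp
    then show ?thesis using A by (intro order_tendstoD(1)) (auto simp: u0)
  qed
  have eS: "\<forall>\<^sub>F h in at_right 0. \<forall>i\<in>I. 0 < slack I (u h) i"
  proof (intro eventually_ball_finite I(1) ballI)
    fix i assume i: "i \<in> I"
    have "((\<lambda>h. slack I (u h) i) \<longlongrightarrow> slack I (u 0) i) (at_right 0)"
      using DERIV_isCont[OF dS[of i 0]] unfolding isCont_def by (rule tendsto_within_subset) simp
    then show "\<forall>\<^sub>F h in at_right 0. 0 < slack I (u h) i" using I(4)[OF i] 
      by (intro order_tendstoD(1)) (auto simp: u0)
  qed
  have eN: "\<forall>\<^sub>F h in at_right 0. \<forall>i\<in>I. 0 \<le> u h i"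
  proof (intro eventually_ball_finite I(1) ballI)
    fix i assume i: "i \<in> I"
    show "\<forall>\<^sub>F h in at_right 0. 0 \<le> u h i"
    proof (cases "t i = 0")
      case True
      then show ?thesis using d(2)[OF i] by (auto simp: u_def eventually_at_right_field intro!: exI[of _ 1])
    next
      case False
      then have "0 < t i" using I(2)[OF i] by simp
      moreover have "((\<lambda>h. u h i) \<longlongrightarrow> t i + 0 * d i) (at_right 0)" unfolding u_def by (intro tendsto_intros)
      ultimately have "\<forall>\<^sub>F h in at_right 0. 0 < u h i" by (intro order_tendstoD(1)) auto
      then show ?thesis by eventually_elim auto
    qed
  qed
  have "\<forall>\<^sub>F h in at_right 0. g 0 < g h \<and> 0 < area_sum I (u h) \<and> proper_angles I (u h)"
    using e0 eA eS eN
  proof eventually_elim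
    case (elim h)
    have "sum (u h) I = pi" using I(3) d(1) by (simp add: u_def sum.distrib flip: sum_distrib_left)
    with elim I(1) show ?case by (auto simp: proper_angles_def)
  qed
  then obtain h where h: "g 0 < g h" "0 < area_sum I (u h)" "proper_angles I (u h)"
    using eventually_happens'[of "at_right (0::real)"] trivial_limit_at_right_real by blast
  have "area_ratio I t < area_ratio I (u h)"
    using h A I by (subst (1 2) ratio_eq_exp) (auto simp: proper_angles_def g_def u0)
  with h(3) m show False by (auto simp: maximizer_def)
qed

lemma maximizer_gradient_eq:
  assumes m: "maximizer I t" and ij: "i \<in> I" "j \<in> I" "0 < t i" "0 < t j"
  shows "gradient I t i = gradient I t j"
proof (cases "i = j")
  case False
  have fin: "finite I" using m by (auto simp: maximizer_def proper_angles_def)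
  have le: "gradient I t x \<le> gradient I t y" if "x \<in> I" "y \<in> I" "0 < t x" "0 < t y" "x \<noteq> y" for x y
  proof -
    define d where "d = (\<lambda>k. (if k = x then 1 else 0) - (if k = y then 1 else (0::real)))"
    have "(\<Sum>i\<in>I. gradient I t i * d i) \<le> 0"
      by (rule maximizer_direction[OF m]) (use that fin in \<open>auto simp: d_def sum_subtractf\<close>)
    moreover have "(\<Sum>i\<in>I. gradient I t i * d i) =
        (\<Sum>i\<in>I. (if i = x then gradient I t x else 0) - (if i = y then gradient I t y else 0))"
      by (intro sum.cong) (auto simp: d_def)
    then have "(\<Sum>i\<in>I. gradient I t i * d i) = gradient I t x - gradient I t y"
      using that fin by (simp add: sum_subtractf)
    ultimately show ?thesis by simp
  qed
  show ?thesis using le[of i j] le[of j i] ij False by auto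
qed simp

text \<open>If all angles are acute, every term is positive. If t i is obtuse, strict
  superadditivity puts the sum of the other tangents below tan (pi - t i) = - tan (t i). This will
  force a Lagrange multiplier to vanish.\<close>

lemma sum_tan_ne_0:
  assumes I: "finite I" "\<And>i. i \<in> I \<Longrightarrow> 0 < t i" "sum t I = pi" "3 \<le> card I" "\<And>i. i \<in> I \<Longrightarrow> t i \<noteq> pi/2"
  shows "(\<Sum>i\<in>I. tan (t i)) \<noteq> 0"
proof (cases "\<forall>i\<in>I. t i < pi/2")
  case True
  then have "0 < (\<Sum>i\<in>I. tan (t i))" using I by (intro sum_pos tan_gt_zero) auto
  then show ?thesis by simp
next
  case False
  then obtain i where i: "i \<in> I" "pi/2 < t i" using I by force
  define J where "J = I - {i}"
  have sJ: "sum t J = pi - t i" using I i by (simp add: J_def sum_remove_eq)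
  have J: "finite J" "2 \<le> card J" using I i by (auto simp: J_def)
  then obtain a where a: "a \<in> J" by fastforce
  have "J \<noteq> {a}" using J by auto
  then have ne: "J - {a} \<noteq> {}" using a by auto
  define R where "R = sum t (J - {a})"
  have "0 < R" unfolding R_def using J(1) ne I(2) by (intro sum_pos) (auto simp: J_def)
  moreover have "0 < t a" using a I(2) by (simp add: J_def)
  moreover have "sum t J = t a + R" unfolding R_def using J(1) a by (rule sum.remove)
  ultimately have R: "sum t J = t a + R" "0 < R" "0 < t a" by auto
  have lt: "t a + R < pi/2" using sJ i R by linarith
  have "(\<Sum>i\<in>J-{a}. tan (t i)) \<le> tan R"
    unfolding R_def
  proof (rule tan_superadditive)
    show "sum t (J - {a}) < pi/2" using lt R(3) by (simp flip: R_def)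
  qed (use J(1) I(2) in \<open>auto simp: J_def\<close>)
  moreover have "tan (t a) + tan R < tan (t a + R)" using R lt by (intro tan_add_less) auto
  moreover have "tan (t a + R) = - tan (t i)"
  proof -
    have "t a + R = pi - t i" using R sJ by simp
    then show ?thesis by (simp add: tan_def)
  qed
  moreover have "(\<Sum>i\<in>I. tan (t i)) = tan (t i) + (tan (t a) + (\<Sum>i\<in>J-{a}. tan (t i)))"
    using I i J a by (simp add: sum.remove J_def)
  ultimately show ?thesis by linarith
qed

text \<open>Equal partial derivatives only say that cos (t k) H k is a constant \<rho>, where 2 H k
  is the derivative of the log ratio with respect to the half side length. Scale invariance gives
  \<Sum> sin (t k) H k = 0, so \<rho> \<noteq> 0 would make \<rho> times the sum of tangents
  vanish.\<close>

lemma maximizer_critical: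
  assumes m: "maximizer I t" and pos: "\<And>i. i \<in> I \<Longrightarrow> 0 < t i" and n: "3 \<le> card I" and i: "i \<in> I"
  shows "card I * cos (t i) / area_sum I t + 2 / slack I t i = (\<Sum>j\<in>I. 1 / slack I t j)"
proof -
  have I: "finite I" "sum t I = pi" "\<And>i. i \<in> I \<Longrightarrow> 0 < slack I t i"
    using m by (auto simp: proper_angles_def maximizer_def)
  have A: "0 < area_sum I t" using maximizer_area_pos[OF m] i by auto
  define W where "W = (\<Sum>j\<in>I. 1 / slack I t j)"
  define H where "H = (\<lambda>i. card I * cos (t i) / area_sum I t + 2 / slack I t i - W)"
  have G: "gradient I t k = 2 * (cos (t k) * H k) - card I / area_sum I t" for k
    unfolding gradient_def W_def[symmetric] H_def cos_double_cos
    by (simp add: power2_eq_square algebra_simps diff_divide_distrib)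
  define \<rho> where "\<rho> = cos (t i) * H i"
  have \<rho>: "cos (t k) * H k = \<rho>" if "k \<in> I" for k
    using maximizer_gradient_eq[OF m that i pos[OF that] pos[OF i]] by (simp add: G \<rho>_def)
  \<comment> \<open>Euler's identity for a function of the side lengths that is homogeneous of
    degree 0.\<close>
  have sH: "(\<Sum>k\<in>I. sin (t k) * H k) = 0"
  proof -
    have "(\<Sum>k\<in>I. sin (t k) * H k) = (\<Sum>k\<in>I. card I / area_sum I t * (sin (t k) * cos (t k)))
       + (\<Sum>k\<in>I. 2 * sin (t k) / slack I t k) - (\<Sum>k\<in>I. sin (t k) * W)"
      unfolding H_def sum.distrib[symmetric] sum_subtractf[symmetric]
      by (intro sum.cong) (auto simp: algebra_simps)
    also have "(\<Sum>k\<in>I. card I / area_sum I t * (sin (t k) * cos (t k))) = card I"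
      unfolding sum_distrib_left[symmetric] area_sum_def[symmetric] using A by simp
    also have "(\<Sum>k\<in>I. 2 * sin (t k) / slack I t k) = (\<Sum>k\<in>I. sine_sum I t * (1 / slack I t k) - 1)"
    proof (rule sum.cong[OF refl])
      fix k assume "k \<in> I"
      then have "slack I t k \<noteq> 0" using I(3) by force
      moreover have "2 * sin (t k) = sine_sum I t - slack I t k" by (simp add: slack_def)
      ultimately show "2 * sin (t k) / slack I t k = sine_sum I t * (1 / slack I t k) - 1"
        by (simp add: diff_divide_distrib)
    qed
    also have "\<dots> = sine_sum I t * W - card I" by (simp add: sum_subtractf W_def sum_distrib_left)
    also have "(\<Sum>k\<in>I. sin (t k) * W) = sine_sum I t * W" by (simp add: sine_sum_def sum_distrib_right)
    finally show ?thesis by simp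
  qed
  have tp: "0 < t k \<and> t k < pi" if "k \<in> I" for k
  proof -
    have "card (I - {k}) \<ge> 2" using I n that by simp
    then have "I - {k} \<noteq> {}" by (metis card.empty not_numeral_le_zero)
    then have "0 < sum t (I - {k})" using I pos by (intro sum_pos) auto
    then show ?thesis using pos[OF that] I that by (simp add: sum_remove_eq)
  qed
  have "\<rho> = 0"
  proof (rule ccontr)
    assume r: "\<rho> \<noteq> 0"
    have c: "cos (t k) \<noteq> 0" if "k \<in> I" for k using \<rho>[OF that] r by auto
    have "(\<Sum>k\<in>I. sin (t k) * H k) = (\<Sum>k\<in>I. \<rho> * tan (t k))"
    proof (rule sum.cong[OF refl])
      fix k assume k: "k \<in> I"
      have "H k = \<rho> / cos (t k)" using \<rho>[OF k] c[OF k] by (simp add: field_simps)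
      then show "sin (t k) * H k = \<rho> * tan (t k)" by (simp add: tan_def)
    qed
    then have "(\<Sum>k\<in>I. tan (t k)) = 0" using sH r by (simp flip: sum_distrib_left)
    moreover have "t k \<noteq> pi/2" if "k \<in> I" for k using c[OF that] by (metis cos_pi_half)
    ultimately show False using sum_tan_ne_0[of I t] I pos n by blast
  qed
  have H0: "H k = 0" if "k \<in> I" "t k \<noteq> pi/2" for k
  proof -
    have "cos (t k) \<noteq> 0" 
    proof
      assume "cos (t k) = 0"
      then have "t k = pi/2" using tp[OF that(1)] cos_inj_pi[of "t k" "pi/2"] by simp
      with that show False by simp
    qed
    with \<rho>[OF that(1)] \<open>\<rho> = 0\<close> show ?thesis by simp
  qed
  \<comment> \<open>If t i is a right angle, cos (t i) H i = 0 says nothing about H i; but no other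
    angle is right, so all other terms of the Euler identity vanish.\<close>
  have "H i = 0"
  proof (cases "t i = pi/2")
    case True
    have "t k \<noteq> pi/2" if k: "k \<in> I - {i}" for k
    proof
      assume tk: "t k = pi/2"
      have "I \<noteq> {i, k}" using n k by auto
      then have "I - {i} - {k} \<noteq> {}" using i k by auto
      then have "0 < sum t (I - {i} - {k})" using I(1) pos by (intro sum_pos) auto
      moreover have "sum t I = t i + sum t (I - {i})" using I(1) i by (rule sum.remove)
      moreover have "sum t (I - {i}) = t k + sum t (I - {i} - {k})" using I(1) k by (intro sum.remove) auto
      ultimately show False using I True tk by simp
    qed
    then have "(\<Sum>k\<in>I - {i}. sin (t k) * H k) = 0" using H0 by (intro sum.neutral) auto
    then show ?thesis using sH I i True by (simp add: sum.remove)
  qed (use H0 i in auto)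
  then show ?thesis by (simp add: H_def W_def)
qed

lemma positive_maximizer_regular:
  assumes m: "maximizer I t" and pos: "\<And>i. i \<in> I \<Longrightarrow> 0 < t i" and n: "5 \<le> card I" 
    and ij: "i \<in> I" "j \<in> I"
  shows "t i = t j"
proof (rule ccontr)
  assume ne: "t i \<noteq> t j"
  have I: "finite I" "sum t I = pi" "\<And>i. i \<in> I \<Longrightarrow> 0 < slack I t i"
    using m by (auto simp: proper_angles_def maximizer_def)
  have I0: "I \<noteq> {}" using ij by auto
  have A: "0 < area_sum I t" using maximizer_area_pos[OF m I0] .
  define N W \<sigma> where "N = real (card I)" and "W = (\<Sum>j\<in>I. 1 / slack I t j)" and "\<sigma> = sine_sum I t"
  have N: "N > 0" using n by (simp add: N_def)
  have crit: "N * cos (t k) / area_sum I t + 2 / slack I t k = W" if "k \<in> I" for k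
    unfolding N_def W_def using maximizer_critical[OF m pos _ that] n by simp
  have lt: "0 < t k \<and> t k < pi" if "k \<in> I" for k
  proof -
    have "I \<noteq> {k}" using n by auto
    then have "I - {k} \<noteq> {}" using that by auto
    then have "0 < sum t (I - {k})" using I pos by (intro sum_pos) auto
    then show ?thesis using pos[OF that] I that by (simp add: sum_remove_eq)
  qed
  have half: "sin ((x - y)/2) \<noteq> 0" if "0 < x" "x < pi" "0 < y" "y < pi" "x \<noteq> y" for x y :: real
  proof (cases "x < y")
    case True
    then have "0 < sin ((y - x)/2)" using that by (intro sin_gt_zero) auto
    then show ?thesis using sin_minus[of "(y - x)/2"] by (simp add: minus_divide_left)
  next
    case False
    then have "0 < sin ((x - y)/2)" using that by (intro sin_gt_zero) auto
    then show ?thesis by simp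
  qed
  show False
  proof (cases "\<exists>k\<in>I. t k \<noteq> t i \<and> t k \<noteq> t j")
    case True
    then obtain k where k: "k \<in> I" "t k \<noteq> t i" "t k \<noteq> t j" by auto
    define C B where "C = W * area_sum I t / N" and "B = C * \<sigma> - 2 * area_sum I t / N"
    \<comment> \<open>The critical equation multiplied out: the equation of the hyperbola, with the
      sine sum \<sigma> as the coefficient Y of Vieta's formula.\<close>
    have eqn: "sin (2 * t l) = 2 * C * sin (t l) + \<sigma> * cos (t l) - B" if l: "l \<in> I" for l
    proof -
      define x where "x = slack I t l"
      have x: "x > 0" using I l by (simp add: x_def)
      have "(N * cos (t l) / area_sum I t + 2 / x) * (area_sum I t * x) = W * (area_sum I t * x)"
        using crit[OF l] by (simp add: x_def)
      moreover have "(p / a + 2 / x) * (a * x) = p * x + 2 * a" if "a > 0" for p a :: real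
        using that x by (simp add: field_simps)
      ultimately have "N * cos (t l) * x + 2 * area_sum I t = W * (area_sum I t * x)"
        using A by simp
      then have "N * cos (t l) * x + 2 * area_sum I t = N * C * x"
        using N by (simp add: C_def)
      then have "N * (cos (t l) * x + 2 * area_sum I t / N) = N * (C * x)" using N by (simp add: algebra_simps)
      then have "cos (t l) * x + 2 * area_sum I t / N = C * x" using N by simp
      then show ?thesis unfolding x_def slack_def \<sigma>_def[symmetric] B_def
        unfolding sin_double by (simp add: algebra_simps)
    qed
    have V: "\<sigma> = sin (t i) + sin (t j) + sin (t k) + sin (t i + t j + t k)"
    proof (rule three_angle_vieta[of _ "2 * C" _ B])
      show "sin ((t i - t j)/2) \<noteq> 0" using lt ij ne by (intro half) blast+
      show "sin ((t i - t k)/2) \<noteq> 0" using lt ij k by (intro half) metis+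
      show "sin ((t j - t k)/2) \<noteq> 0" using lt ij k by (intro half) metis+
    qed (use eqn ij k in auto)
    define R where "R = I - {i, j, k}"
    have d: "i \<noteq> j" "i \<noteq> k" "j \<noteq> k" using k ne by auto
    have R: "finite R" "R \<subseteq> I" using I by (auto simp: R_def)
    have split: "sum f I = f i + f j + f k + sum f R" for f :: "'a \<Rightarrow> real"
    proof -
      have "sum f I = sum f {i,j,k} + sum f R" unfolding R_def 
        using I ij k sum.subset_diff[of "{i,j,k}" I f] by (simp add: add.commute)
      then show ?thesis using d by simp
    qed
    have "card R = card I - 3" unfolding R_def using ij k d I by (simp add: card_Diff_subset)
    \<comment> \<open>At least two angles remain because n >= 5; two positive ones are what makes
      subadditivity strict.\<close>
    then have "2 \<le> card R" using n by simp
    then obtain a b where ab: "a \<in> R" "b \<in> R" "a \<noteq> b"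
      by (meson card_2_iff' ex_card subset_iff)
    have sR: "sum t R = pi - (t i + t j + t k)" using split[of t] I by simp
    have "sin (sum t R) < (\<Sum>l\<in>R. sin (t l))"
    proof (rule sin_subadditive_strict[of _ _ a b])
      show "sum t R \<le> pi" using sR pos[OF ij(1)] pos[OF ij(2)] pos[OF k(1)] by linarith
    qed (use ab R pos in \<open>auto simp: less_imp_le subset_iff\<close>)
    moreover have "(\<Sum>l\<in>R. sin (t l)) = sin (t i + t j + t k)"
      using V split[of "\<lambda>l. sin (t l)"] unfolding \<sigma>_def sine_sum_def by linarith
    moreover have "sin (sum t R) = sin (t i + t j + t k)" unfolding sR by (rule sin_pi_minus)
    ultimately show False by simp
  next
    case False
    have main: False if ij: "i \<in> I" "j \<in> I" "t j < t i" "\<forall>k\<in>I. t k = t i \<or> t k = t j" for i j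
    proof -
      define I1 I2 where "I1 = {k\<in>I. t k = t i}" and "I2 = {k\<in>I. t k = t j}"
      have un: "I = I1 \<union> I2" "I1 \<inter> I2 = {}" "finite I1" "finite I2"
        using ij I by (auto simp: I1_def I2_def)
      have sm: "(\<Sum>k\<in>I. f (t k)) = card I1 * f (t i) + card I2 * f (t j)" for f :: "real \<Rightarrow> real"
      proof -
        have "(\<Sum>k\<in>I. f (t k)) = (\<Sum>k\<in>I1. f (t k)) + (\<Sum>k\<in>I2. f (t k))"
          unfolding un(1) using un by (intro sum.union_disjoint) auto
        also have "(\<Sum>k\<in>I1. f (t k)) = (\<Sum>k\<in>I1. f (t i))" by (intro sum.cong) (auto simp: I1_def)
        also have "(\<Sum>k\<in>I2. f (t k)) = (\<Sum>k\<in>I2. f (t j))" by (intro sum.cong) (auto simp: I2_def)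
        finally show ?thesis by simp
      qed
      have cI: "card I = card I1 + card I2" unfolding un(1) using un by (intro card_Un_disjoint) auto
      have c1: "1 \<le> card I1" "1 \<le> card I2" using un ij
        by (auto simp: Suc_le_eq card_gt_0_iff I1_def I2_def)
      define xi xj where "xi = slack I t i" and "xj = slack I t j"
      have x: "xi > 0" "xj > 0" using I ij by (auto simp: xi_def xj_def)
      have "N * cos (t i) / area_sum I t + 2 / xi = N * cos (t j) / area_sum I t + 2 / xj"
        using crit ij by (simp add: xi_def xj_def)
      then have "(N * cos (t i) / area_sum I t + 2 / xi) * (area_sum I t * xi * xj)
        = (N * cos (t j) / area_sum I t + 2 / xj) * (area_sum I t * xi * xj)" by simp
      then have "N * cos (t i) * xi * xj + 2 * area_sum I t * xj = N * cos (t j) * xi * xj + 2 * area_sum I t * xi"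
        using A x by (simp add: distrib_right)
      moreover have "xi - xj = 2 * (sin (t j) - sin (t i))" by (simp add: xi_def xj_def slack_def)
      ultimately have "N * (cos (t i) - cos (t j)) * xi * xj = 4 * area_sum I t * (sin (t j) - sin (t i))"
        by algebra
      \<comment> \<open>The multiplicities of the larger and the smaller angle become m1 and
        m2.\<close>
      then show False
        using two_angle_not_critical[of "card I1" "card I2" "t j" "t i"] sm[of sin] sm[of "\<lambda>x. sin x * cos x"] sm[of "\<lambda>x. x"]
          I(2) c1 n ij lt[of j]
        unfolding xi_def xj_def slack_def N_def cI sine_sum_def area_sum_def by simp
    qed
    show False
    proof (cases "t i < t j")
      case True
      show False by (rule main[OF ij(2,1) True]) (use False in auto)
    next
      case nl: False
      show False by (rule main[OF ij]) (use nl ne False in auto)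
    qed
  qed
qed

section \<open>The value at the regular polygon and the induction on the number of sides\<close>

definition regular_area_ratio :: "nat \<Rightarrow> real" where
  "regular_area_ratio n = (n * cos (pi/n) / ((real n - 2)\<^sup>2 * sin (pi/n))) ^ n"

lemma ratio_regular:
  assumes "finite I" "3 \<le> card I" "\<And>i. i \<in> I \<Longrightarrow> t i = pi / card I"
  shows "area_ratio I t = regular_area_ratio (card I)"
proof -
  define n s c where "n = card I" and "s = sin (pi/n)" and "c = cos (pi/n)"
  note r = regular_values[OF assms]
  have s: "s > 0" unfolding s_def using assms by (intro sin_gt_zero) (auto simp: n_def field_simps)
  have "(\<Prod>i\<in>I. slack I t i) = ((real n - 2) * s) ^ n"
    using r(3) by (simp add: n_def s_def)
  moreover have "area_sum I t = n * (s * c)" using r(2) by (simp add: n_def s_def c_def)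
  ultimately have "area_ratio I t = (n * (s * c)) ^ n / (((real n - 2) * s) ^ n)\<^sup>2"
    by (simp add: area_ratio_def flip: n_def)
  also have "(((real n - 2) * s) ^ n)\<^sup>2 = (((real n - 2) * s)\<^sup>2) ^ n"
    by (metis power_mult mult.commute)
  finally have "area_ratio I t = (n * (s * c)) ^ n / (((real n - 2) * s)\<^sup>2) ^ n" .
  also have "(n * (s * c)) ^ n / (((real n - 2) * s)\<^sup>2) ^ n = ((n * (s * c)) / ((real n - 2) * s)\<^sup>2) ^ n" by (simp add: power_divide)
  also have "(n * (s * c)) / ((real n - 2) * s)\<^sup>2 = n * c / ((real n - 2)\<^sup>2 * s)"
    using s by (simp add: power2_eq_square)
  finally show ?thesis by (simp add: regular_area_ratio_def n_def s_def c_def)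
qed

lemma regular_of_equal:
  fixes t :: "'a \<Rightarrow> real"
  assumes "finite I" "sum t I = pi" "\<And>i j. i \<in> I \<Longrightarrow> j \<in> I \<Longrightarrow> t i = t j" "i \<in> I"
  shows "t i = pi / card I"
proof -
  have "sum t I = (\<Sum>j\<in>I. t i)" by (rule sum.cong[OF refl]) (rule assms(3), assumption, rule assms(4))
  then have "card I * t i = pi" using assms(2) by simp
  moreover have "0 < card I" using assms(1,4) by (auto simp: card_gt_0_iff)
  ultimately show ?thesis by (simp add: field_simps)
qed

text \<open>Deleting a zero angle leaves an extra factor, the ordinary isoperimetric quotient A /
  \<sigma>^2. The inequality of arithmetic and geometric means for the slacks derives its sharp
  bound from that of \<open>area_ratio\<close>.\<close>

lemma area_sum_le_of_ratio_le:
  assumes a: "proper_angles I t" and n: "3 \<le> card I" and r: "area_ratio I t \<le> regular_area_ratio (card I)"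
  shows "area_sum I t \<le> cos (pi / card I) / (card I * sin (pi / card I)) * (sine_sum I t)\<^sup>2"
proof -
  have I: "finite I" "\<And>i. i \<in> I \<Longrightarrow> 0 \<le> t i" "sum t I = pi" "\<And>i. i \<in> I \<Longrightarrow> 0 < slack I t i"
    using a by (auto simp: proper_angles_def)
  define n P b where "n = card I" and "P = (\<Prod>i\<in>I. slack I t i)" and "b = n * cos (pi/n) / ((real n - 2)\<^sup>2 * sin (pi/n))"
  have n0: "n > 0" "I \<noteq> {}" using n by (auto simp: n_def)
  have P: "P > 0" unfolding P_def using I by (intro prod_pos) auto
  have b: "b \<ge> 0" unfolding b_def using n
    by (intro divide_nonneg_nonneg mult_nonneg_nonneg cos_ge_zero sin_ge_zero) (auto simp: n_def field_simps intro: order_trans[of _ 0])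
  have "area_sum I t ^ n \<le> b^n * P\<^sup>2"
    using r P by (simp add: area_ratio_def regular_area_ratio_def divide_le_eq flip: n_def P_def b_def)
  also have "P \<le> (((real n - 2) * sine_sum I t) / n) ^ n"
  proof -
    have "P powr (1 / card I) \<le> (\<Sum>i\<in>I. slack I t i / card I)"
      unfolding P_def using I n0 by (intro arith_geom_mean) (auto simp: less_imp_le)
    then have "root (card I) P \<le> (\<Sum>i\<in>I. slack I t i) / card I"
      using P n0 by (simp add: root_powr_inverse sum_divide_distrib n_def)
    then have "root n P \<le> ((real n - 2) * sine_sum I t) / n" using sum_slack[OF I(1)] by (simp add: n_def)
    then have "root n P ^ n \<le> (((real n - 2) * sine_sum I t) / n) ^ n"
      using P n0 by (intro power_mono) auto
    then show ?thesis using P n0 by simp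
  qed
  then have "b^n * P\<^sup>2 \<le> b^n * ((((real n - 2) * sine_sum I t) / n) ^ n)\<^sup>2"
    using P b by (intro mult_left_mono power_mono) auto
  also have "\<dots> = (b * (((real n - 2) * sine_sum I t) / n)\<^sup>2) ^ n"
    by (simp add: power_mult_distrib flip: power_mult) (simp add: mult.commute)
  finally have "area_sum I t ^ n \<le> (b * (((real n - 2) * sine_sum I t) / n)\<^sup>2) ^ n" .
  then have "area_sum I t \<le> b * (((real n - 2) * sine_sum I t) / n)\<^sup>2"
    using b by (metis power_le_imp_le_base Suc_pred n0(1) mult_nonneg_nonneg zero_le_power2)
  also have "\<dots> = cos (pi/n) / (n * sin (pi/n)) * (sine_sum I t)\<^sup>2"
    using n n0 unfolding b_def by (simp add: power2_eq_square n_def)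
  finally show ?thesis by (simp add: n_def)
qed

text \<open>If some angle vanished, the regular polygon with one side less would be a maximizer too, but opening
  its zero angle increases the ratio.\<close>

lemma maximizer_pos:
  assumes m: "maximizer I t" and n: "5 \<le> card I"
    and IH: "\<And>z. z \<in> I \<Longrightarrow> proper_angles (I - {z}) t \<Longrightarrow> area_ratio (I - {z}) t \<le> regular_area_ratio (card (I - {z}))"
    and z: "z \<in> I"
  shows "0 < t z"
proof (rule ccontr)
  assume "\<not> 0 < t z"
  moreover have "0 \<le> t z" using m z by (simp add: maximizer_def proper_angles_def)
  ultimately have tz: "t z = 0" by simp
  have I: "finite I" "\<And>i. i \<in> I \<Longrightarrow> 0 \<le> t i" "sum t I = pi" "\<And>i. i \<in> I \<Longrightarrow> 0 < slack I t i"
    using m by (auto simp: proper_angles_def maximizer_def)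
  define J k where "J = I - {z}" and "k = card J"
  have cI: "card I = Suc k" unfolding J_def k_def using I(1) z by (rule card.remove)
  have k4: "4 \<le> k" using n cI by simp
  have J: "finite J" "z \<notin> J" "J \<subseteq> I" and Ic: "\<And>i. i \<in> I \<Longrightarrow> i = z \<or> i \<in> J"
    using I z by (auto simp: J_def)
  have I0: "I \<noteq> {}" using z by auto
  have sumI: "sum f I = f z + sum f J" for f :: "'a \<Rightarrow> real" unfolding J_def using I(1) z by (rule sum.remove)
  have prodI: "prod f I = f z * prod f J" for f :: "'a \<Rightarrow> real" unfolding J_def using I(1) z by (rule prod.remove)
  have drop: "sine_sum I u = sine_sum J u" "area_sum I u = area_sum J u" "slack I u i = slack J u i" "sum u I = sum u J"
    "slack I u z = sine_sum J u" if "u z = 0" for u :: "'a \<Rightarrow> real" and i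
    using that by (simp_all add: sine_sum_def area_sum_def slack_def sumI)
  \<comment> \<open>The zero angle contributes the slack \<sigma> and raises the exponent of the
    area by one.\<close>
  have rat: "area_ratio I u = area_ratio J u * (area_sum J u / (sine_sum J u)\<^sup>2)" if "u z = 0" for u
  proof -
    have "(\<Prod>i\<in>I. slack I u i) = sine_sum J u * (\<Prod>i\<in>J. slack J u i)"
      unfolding prodI by (simp only: drop(5)[where u=u, OF that]) (simp add: drop(3)[where u=u, OF that])
    then show ?thesis unfolding area_ratio_def cI drop(2)[where u=u, OF that] by (simp add: k_def power_mult_distrib mult.commute)
  qed
  have aJ: "proper_angles J t" unfolding proper_angles_def
  proof (intro conjI ballI)
    show "sum t J = pi" using I(3) drop(4)[where u=t, OF tz] by simp
    fix i assume "i \<in> J"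
    then have i: "i \<in> I" using J(3) by auto
    show "0 \<le> t i" "0 < slack J t i"
      using I(2)[OF i] I(4)[OF i] drop(3)[where u=t and i=i, OF tz] by auto
  qed (rule J(1))
  have rJ: "area_ratio J t \<le> regular_area_ratio k" using IH[OF z] aJ by (simp add: J_def k_def)
  have \<sigma>: "0 < sine_sum J t" using aJ k4 by (intro sine_sum_pos) (auto simp: k_def)
  have "area_sum J t \<le> cos (pi / k) / (k * sin (pi / k)) * (sine_sum J t)\<^sup>2"
    unfolding k_def by (rule area_sum_le_of_ratio_le[OF aJ]) (use k4 rJ in \<open>auto simp: k_def\<close>)
  then have AJ: "area_sum J t / (sine_sum J t)\<^sup>2 \<le> cos (pi / k) / (k * sin (pi / k))"
    using \<sigma> by (simp add: divide_le_eq)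
  have AJ0: "0 \<le> area_sum J t" using aJ by (intro area_sum_nonneg) (auto simp: proper_angles_def)
  define s c where "s = sin (pi/k)" and "c = cos (pi/k)"
  have sc: "s > 0" "c > 0" unfolding s_def c_def using k4
    by (auto intro!: sin_gt_zero cos_gt_zero_pi simp: field_simps intro: less_le_trans[of _ 0])
  define v where "v = (\<lambda>i. if i = z then 0 else pi / k)"
  have vz: "v z = 0" by (simp add: v_def)
  have cJ3: "3 \<le> card J" using k4 by (simp add: k_def)
  have vJ: "v i = pi / card J" if "i \<in> J" for i using that J(2) by (auto simp: k_def v_def)
  have rv: "sine_sum J v = k * s" "area_sum J v = k * (s * c)" "proper_angles J v" "0 < area_sum J v" "area_ratio J v = regular_area_ratio k"
    using regular_values[of J v] ratio_regular[of J v] J(1) cJ3 vJ by (simp_all add: k_def s_def c_def)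
  have rvs: "slack J v i = (real k - 2) * s" if "i \<in> J" for i
    using regular_values(3)[of J v i] J(1) cJ3 vJ that by (simp add: k_def s_def)
  have rm: "0 < regular_area_ratio k" using ratio_pos[of J v] rv(3,4,5) by simp
  have "area_ratio I t \<le> regular_area_ratio k * (c / (k * s))"
    unfolding rat[where u=t, OF tz] using rJ AJ AJ0 \<sigma> rm by (intro mult_mono) (auto simp: s_def c_def)
  also have "\<dots> = area_ratio I v"
    unfolding rat[where u=v, OF vz] rv(5) rv(1,2) using sc k4 by (simp add: power2_eq_square)
  finally have tv: "area_ratio I t \<le> area_ratio I v" .
  have "proper_angles I v" unfolding proper_angles_def
  proof (intro conjI ballI)
    show "finite I" by (rule I(1))
    show "sum v I = pi" using rv(3) drop(4)[where u=v, OF vz] by (simp add: proper_angles_def)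
    fix i assume i: "i \<in> I"
    show "0 \<le> v i" by (simp add: v_def)
    show "0 < slack I v i"
    proof (cases "i = z")
      case True
      then show ?thesis using drop(5)[where u=v, OF vz] rv(1) sc k4 by simp
    next
      case False
      then show ?thesis using Ic[OF i] drop(3)[where u=v, OF vz] rv(3) by (simp add: proper_angles_def)
    qed
  qed
  with tv m have mv: "maximizer I v" unfolding maximizer_def by (meson order_trans less_le_trans)
  \<comment> \<open>Opens the zero angle at unit speed and takes the same amount from each of the k
    others, so the angle sum is kept.\<close>
  define d where "d = (\<lambda>i. if i = z then 1 else - 1 / real k)"
  have le0: "(\<Sum>i\<in>I. gradient I v i * d i) \<le> 0"
  proof (rule maximizer_direction[OF mv I0])
    have "sum d J = (\<Sum>i\<in>J. - 1 / real k)" using J(2) by (intro sum.cong) (auto simp: d_def)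
    then have "sum d J = -1" using k4 by (simp add: k_def)
    then show "sum d I = 0" unfolding sumI by (simp add: d_def)
  next
    fix i assume "i \<in> I" "v i = 0"
    then show "0 \<le> d i" using k4 by (auto simp: v_def d_def split: if_splits)
  qed
  define W where "W = (\<Sum>j\<in>I. 1 / slack I v j)"
  have gz: "gradient I v z = (k + 1) / (k * (s * c)) - 2 * W + 4 / (k * s)"
    unfolding gradient_def W_def[symmetric] using drop[where u=v, OF vz] vz rv cI by simp
  have gJ: "gradient I v i = (k + 1) * (2 * c\<^sup>2 - 1) / (k * (s * c)) - 2 * c * W + 4 * c / ((real k - 2) * s)" if "i \<in> J" for i
  proof -
    have vi: "v i = pi / k" using that J(2) by (auto simp: v_def)
    show ?thesis unfolding gradient_def W_def[symmetric] unfolding drop(2,3)[where u=v, OF vz] rv(2) rvs[OF that] vi cos_double_cos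
      using cI by (simp add: c_def)
  qed
  have W: "W = 1 / (k * s) + k / ((real k - 2) * s)"
  proof -
    have "W = 1 / sine_sum J v + (\<Sum>j\<in>J. 1 / slack J v j)"
      unfolding W_def sumI by (simp only: drop(5)[where u=v, OF vz]) (simp add: drop(3)[where u=v, OF vz])
    then show ?thesis using rv(1) rvs by (simp add: k_def)
  qed
  have "(\<Sum>i\<in>I. gradient I v i * d i) = gradient I v z + (\<Sum>i\<in>J. gradient I v i * d i)"
    unfolding sumI by (simp add: d_def)
  also have "(\<Sum>i\<in>J. gradient I v i * d i) = (\<Sum>i\<in>J. ((k + 1) * (2 * c\<^sup>2 - 1) / (k * (s * c)) - 2 * c * W + 4 * c / ((real k - 2) * s)) * (- 1 / real k))"
    using J(2) by (intro sum.cong) (auto simp: gJ d_def)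
  also have "\<dots> = - ((k + 1) * (2 * c\<^sup>2 - 1) / (k * (s * c)) - 2 * c * W + 4 * c / ((real k - 2) * s))"
    using k4 by (simp flip: k_def)
  finally have "(\<Sum>i\<in>I. gradient I v i * d i) = gradient I v z - ((k + 1) * (2 * c\<^sup>2 - 1) / (k * (s * c)) - 2 * c * W + 4 * c / ((real k - 2) * s))"
    by simp
  also have "\<dots> = 2 / s * (((1 - c) * ((real k)\<^sup>2 - k + 2) - 4) / (k * c * (real k - 2)))"
    unfolding gz W using sc k4 by (simp add: divide_simps) (simp add: power2_eq_square algebra_simps)
  \<comment> \<open>With 1 + c = 2 cos^2 x and 1 - c = 2 sin^2 x for x = pi / (2 k), the bracket is
    positive exactly by \<open>tan_pi_div_double_gt\<close>.\<close>
  also have "\<dots> > 0"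
  proof -
    define x where "x = pi / (2 * real k)"
    have kx: "pi / k = 2 * x" using k4 by (simp add: x_def)
    have cx: "cos x > 0" by (rule cos_gt_zero_pi) (use k4 in \<open>auto simp: x_def field_simps intro: less_le_trans[of _ 0]\<close>)
    have "2 < real k * (real k - 1) * (tan x)\<^sup>2" unfolding x_def using k4 by (intro tan_pi_div_double_gt) auto
    then have "2 * (cos x)\<^sup>2 < real k * (real k - 1) * (sin x)\<^sup>2" using cx by (simp add: tan_def power_divide field_simps)
    moreover have "2 * (cos x)\<^sup>2 = 1 + c" "2 * (sin x)\<^sup>2 = 1 - c"
      unfolding c_def kx cos_double_cos using sin_cos_squared_add[of x] by linarith+
    moreover have "2 * (2 * (cos x)\<^sup>2) < real k * (real k - 1) * (2 * (sin x)\<^sup>2)" using calculation(1) by linarith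
    ultimately have "2 * (1 + c) < real k * (real k - 1) * (1 - c)" by simp
    then have "0 < (1 - c) * ((real k)\<^sup>2 - k + 2) - 4" by (simp add: power2_eq_square algebra_simps)
    then show ?thesis using sc k4 by simp
  qed
  finally show False using le0 by simp
qed

text \<open>By Brahmagupta's formula the ratio is constantly 1 here. The base case thus gives the
  bound but no uniqueness, which begins with n = 5.\<close>

lemma ratio_le_four:
  assumes a: "proper_angles I t" and n: "card I = 4"
  shows "area_ratio I t \<le> regular_area_ratio (card I)"
proof -
  obtain a b c d where abcd: "I = {a,b,c,d}" "distinct [a,b,c,d]"
    using n by (auto simp: card_Suc_eq numeral_eq_Suc)
  have "(area_sum I t)\<^sup>2 = (\<Prod>i\<in>I. slack I t i)"
  proof -
    have "t a + t b + t c + t d = pi" using a abcd by (simp add: proper_angles_def add.assoc)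
    from brahmagupta[OF this] show ?thesis
      using abcd by (simp add: area_sum_def slack_def sine_sum_def mult.assoc add.assoc)
  qed
  then have "area_sum I t ^ 4 = (\<Prod>i\<in>I. slack I t i)\<^sup>2"
    using power_mult[of "area_sum I t" 2 2] by simp
  moreover have "0 < (\<Prod>i\<in>I. slack I t i)" using a by (intro prod_pos) (auto simp: proper_angles_def)
  ultimately have "area_ratio I t = 1" using n by (simp add: area_ratio_def)
  moreover have "regular_area_ratio 4 = 1" by (simp add: regular_area_ratio_def sin_45 cos_45)
  ultimately show ?thesis using n by simp
qed

lemma ratio_le_max:
  assumes "proper_angles I t" "4 \<le> card I"
  shows "area_ratio I t \<le> regular_area_ratio (card I)"
  using assms
proof (induction "card I" arbitrary: I t rule: less_induct)
  case less
  show ?case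
  proof (cases "card I = 4")
    case True
    with less.prems show ?thesis by (intro ratio_le_four)
  next
    case False
    then have n: "5 \<le> card I" using less.prems by simp
    have I: "finite I" using less.prems by (simp add: proper_angles_def)
    obtain u where u: "maximizer I u" using maximizer_exists[OF I n] by (metis maximizer_def)
    have pos: "0 < u z" if "z \<in> I" for z
    proof (rule maximizer_pos[OF u n _ that])
      fix z assume z: "z \<in> I" "proper_angles (I - {z}) u"
      have "card (I - {z}) < card I" "4 \<le> card (I - {z})" using n I z(1) by simp_all
      with z(2) show "area_ratio (I - {z}) u \<le> regular_area_ratio (card (I - {z}))" by (intro less.hyps)
    qed
    have "u i = pi / card I" if "i \<in> I" for i
    proof (rule regular_of_equal[OF I _ _ that])
      show "sum u I = pi" using u by (simp add: maximizer_def proper_angles_def)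
    qed (rule positive_maximizer_regular[OF u pos n])
    then have "area_ratio I u = regular_area_ratio (card I)" using I n by (intro ratio_regular) auto
    with u less.prems show ?thesis by (auto simp: maximizer_def)
  qed
qed

lemma ratio_eq_max_regular:
  assumes a: "proper_angles I t" and n: "5 \<le> card I" and pos: "\<And>i. i \<in> I \<Longrightarrow> 0 < t i"
    and r: "area_ratio I t = regular_area_ratio (card I)" and i: "i \<in> I"
  shows "t i = pi / card I"
proof -
  have I: "finite I" "sum t I = pi" using a by (auto simp: proper_angles_def)
  have "0 < regular_area_ratio (card I)"
    using ratio_regular[of I "\<lambda>_. pi / card I"] ratio_pos[of I "\<lambda>_. pi / card I"]
      regular_values(4,5)[of I "\<lambda>_. pi / card I"] I n by simp
  then have "maximizer I t" using a r ratio_le_max[where I=I] n by (simp add: maximizer_def)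
  then show ?thesis by (intro regular_of_equal[OF I _ i] positive_maximizer_regular[OF _ pos n])
qed

section \<open>Convex polygons and their area\<close>

definition cross2 :: "real^2 \<Rightarrow> real^2 \<Rightarrow> real" where
  "cross2 p q = p $ 1 * q $ 2 - p $ 2 * q $ 1"

text \<open>The sign \<open>s\<close> allows clockwise and anticlockwise vertex lists to be treated alike.\<close>

definition orient :: "real \<Rightarrow> real^2 \<Rightarrow> real^2 \<Rightarrow> real^2 \<Rightarrow> real" where
  "orient s p q x = s * cross2 (q - p) (x - p)"

definition rot90 :: "real^2 \<Rightarrow> real^2" where "rot90 d = vector [- d $ 2, d $ 1]"

lemma rot90_nth [simp]: "rot90 d $ 1 = - d $ 2" "rot90 d $ 2 = d $ 1"
  by (simp_all add: rot90_def)

lemma vec2_eq_iff: "x = y \<longleftrightarrow> x $ 1 = y $ 1 \<and> x $ 2 = y $ 2" for x y :: "real^2"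
  by (simp add: vec_eq_iff forall_2)

text \<open>Exhibits the orientation as an affine function of x, so facts about half-spaces and
  hyperplanes apply.\<close>

lemma orient_inner: "orient s p q x = (s *\<^sub>R rot90 (q - p)) \<bullet> x - (s *\<^sub>R rot90 (q - p)) \<bullet> p"
  by (simp add: orient_def cross2_def inner_vec_def sum_2 algebra_simps)

lemma orient_expand: "orient s p q x = s * ((q $ 1 - p $ 1) * (x $ 2 - p $ 2) - (q $ 2 - p $ 2) * (x $ 1 - p $ 1))"
  by (simp add: orient_def cross2_def)

lemma orient_cycle: "orient s p q x = orient s q x p"
  by (simp add: orient_expand algebra_simps)

lemma orient_self [simp]: "orient s p q p = 0" "orient s p q q = 0" "orient s p p q = 0"
  by (simp_all add: orient_expand)

lemma orient_swap: "orient s q p x = - orient s p q x"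
  by (simp add: orient_expand algebra_simps)

lemma orient_affine: "orient s p q ((1 - t) *\<^sub>R x + t *\<^sub>R y) = (1 - t) * orient s p q x + t * orient s p q y"
  by (simp add: orient_expand algebra_simps)

lemma rot90_eq_0 [simp]: "rot90 d = 0 \<longleftrightarrow> d = 0"
  by (auto simp: vec2_eq_iff)

lemma halfplane_ge: "{x. 0 \<le> orient s p q x} = {x. (s *\<^sub>R rot90 (q - p)) \<bullet> x \<ge> (s *\<^sub>R rot90 (q - p)) \<bullet> p}"
  by (auto simp: orient_inner)

lemma halfplane_gt: "{x. 0 < orient s p q x} = {x. (s *\<^sub>R rot90 (q - p)) \<bullet> x > (s *\<^sub>R rot90 (q - p)) \<bullet> p}"
  by (auto simp: orient_inner)

lemma convex_orient_ge: "convex {x. 0 \<le> orient s p q x}"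
  unfolding halfplane_ge by (rule convex_halfspace_ge)

lemma open_orient_gt: "open {x. 0 < orient s p q x}"
  unfolding halfplane_gt by (rule open_halfspace_gt)

lemma interior_orient_ge: "s \<noteq> 0 \<Longrightarrow> p \<noteq> q \<Longrightarrow> interior {x. 0 \<le> orient s p q x} = {x. 0 < orient s p q x}"
  unfolding halfplane_ge halfplane_gt by (rule interior_halfspace_ge) simp

lemma negligible_orient_eq: "s \<noteq> 0 \<Longrightarrow> p \<noteq> q \<Longrightarrow> negligible {x. orient s p q x = 0}"
proof -
  assume "s \<noteq> 0" "p \<noteq> q"
  then have "negligible {x. (s *\<^sub>R rot90 (q - p)) \<bullet> x = (s *\<^sub>R rot90 (q - p)) \<bullet> p}"
    by (intro negligible_hyperplane) auto
  then show ?thesis by (simp add: orient_inner)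
qed

lemma orient_eq_0_param:
  assumes "orient s p q x = 0" "s \<noteq> 0" "p \<noteq> q"
  obtains t where "x = (1 - t) *\<^sub>R p + t *\<^sub>R q"
proof (cases "q $ 1 = p $ 1")
  case True
  then have q2: "q $ 2 \<noteq> p $ 2" using assms(3) by (auto simp: vec2_eq_iff)
  then have "x $ 1 = p $ 1" using assms True by (auto simp: orient_expand)
  moreover define t where "t = (x $ 2 - p $ 2) / (q $ 2 - p $ 2)"
  then have "x $ 2 = p $ 2 + t * (q $ 2 - p $ 2)" using q2 by simp
  ultimately show ?thesis using True by (intro that[of t]) (simp add: vec2_eq_iff algebra_simps)
next
  case False
  have "(q $ 1 - p $ 1) * (x $ 2 - p $ 2) = (q $ 2 - p $ 2) * (x $ 1 - p $ 1)"
    using assms by (simp add: orient_expand)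
  then have x2: "x $ 2 = p $ 2 + (x $ 1 - p $ 1) / (q $ 1 - p $ 1) * (q $ 2 - p $ 2)"
    using False by (simp add: field_simps)
  define t where "t = (x $ 1 - p $ 1) / (q $ 1 - p $ 1)"
  have x1: "x $ 1 = p $ 1 + t * (q $ 1 - p $ 1)" using False by (simp add: t_def)
  show ?thesis using x1 x2[folded t_def]
    by (intro that[of t]) (simp add: vec2_eq_iff algebra_simps)
qed

section \<open>Triangles, fans and the area of convex regions\<close>

lemma triangle_eq_halfplanes:
  assumes D: "0 < orient s p q r"
  shows "convex hull {p, q, r} = {x. 0 \<le> orient s p q x \<and> 0 \<le> orient s q r x \<and> 0 \<le> orient s r p x}" (is "_ = ?T")
proof
  have "?T = {x. 0 \<le> orient s p q x} \<inter> {x. 0 \<le> orient s q r x} \<inter> {x. 0 \<le> orient s r p x}" by auto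
  then have "convex ?T" by (simp only:) (intro convex_Int convex_orient_ge)
  moreover have "orient s q r p = orient s p q r" "orient s r p q = orient s p q r"
    by (simp_all add: orient_cycle[of s p q r] orient_cycle[of s q r p])
  ultimately show "convex hull {p, q, r} \<subseteq> ?T" using D by (intro hull_minimal) auto
next
  show "?T \<subseteq> convex hull {p, q, r}"
  proof
    fix x assume x: "x \<in> ?T"
    define D where "D = orient s p q r"
    \<comment> \<open>Barycentric coordinates of x as quotients of oriented areas.\<close>
    define u v w where "u = orient s q r x / D" and "v = orient s r p x / D" and "w = orient s p q x / D"
    have D0: "D > 0" using assms by (simp add: D_def)
    have "orient s q r x + orient s r p x + orient s p q x = D"
      by (simp add: D_def orient_expand algebra_simps)
    then have sum: "u + v + w = 1" using D0 by (simp add: u_def v_def w_def flip: add_divide_distrib)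
    have "D * x $ 1 = orient s q r x * p $ 1 + orient s r p x * q $ 1 + orient s p q x * r $ 1"
      "D * x $ 2 = orient s q r x * p $ 2 + orient s r p x * q $ 2 + orient s p q x * r $ 2"
      unfolding D_def orient_expand by algebra+
    then have "x $ 1 = u * p $ 1 + v * q $ 1 + w * r $ 1" "x $ 2 = u * p $ 2 + v * q $ 2 + w * r $ 2"
      using D0 by (simp_all add: u_def v_def w_def field_simps)
    then have "x = u *\<^sub>R p + v *\<^sub>R q + w *\<^sub>R r" by (simp add: vec2_eq_iff)
    moreover have "0 \<le> u" "0 \<le> v" "0 \<le> w" using x D0 by (auto simp: u_def v_def w_def)
    ultimately show "x \<in> convex hull {p, q, r}" using sum unfolding convex_hull_3 by blast
  qed
qed

lemma triangle_measure:
  assumes D: "0 < orient s p q r" and s: "\<bar>s\<bar> = 1"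
  shows "measure lebesgue (convex hull {p, q, r}) = orient s p q r / 2"
proof -
  have "measure lebesgue (convex hull {p, q, r}) = measure lborel (convex hull {p, q, r})"
    by (intro measure_completion) (auto intro!: borel_compact finite_imp_compact_convex_hull)
  also have "\<dots> = \<bar>(r $ 1 - p $ 1) * (q $ 2 - p $ 2) - (q $ 1 - p $ 1) * (r $ 2 - p $ 2)\<bar> / 2"
    by (rule content_triangle)
  also have "\<dots> = \<bar>orient s p q r\<bar> / 2"
    using s by (simp add: orient_expand abs_mult abs_minus_commute mult.commute)
  finally show ?thesis using D by simp
qed

text \<open>The three affine forms for pq, qr and qd all vanish at q, so they are linearly
  dependent; the signs of the coefficients express that the line qd supports the angle at q.\<close>

lemma orient_corner:
  assumes "0 < orient s p q r" "0 < orient s p q d" "0 < orient s q d r"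
    and "0 \<le> orient s p q x" "0 \<le> orient s q r x"
  shows "0 \<le> orient s q d x"
proof -
  have "orient s p q r * orient s q d x = orient s q d r * orient s p q x + orient s p q d * orient s q r x"
    unfolding orient_expand by algebra
  moreover have "0 \<le> orient s q d r * orient s p q x + orient s p q d * orient s q r x"
    using assms by (intro add_nonneg_nonneg mult_nonneg_nonneg) auto
  ultimately show ?thesis using assms(1) by (metis zero_le_mult_iff less_le_not_le)
qed

text \<open>Here m is the last index, so there are m + 1 vertices. Half-planes instead of a convex
  hull let interior and frontier be read off edge by edge.\<close>

definition fan_region :: "real \<Rightarrow> (nat \<Rightarrow> real^2) \<Rightarrow> nat \<Rightarrow> (real^2) set" where
  "fan_region s v m = {x. (\<forall>i<m. 0 \<le> orient s (v i) (v (Suc i)) x) \<and> 0 \<le> orient s (v m) (v 0) x}"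

lemma convex_fan_region: "convex (fan_region s v m)"
proof -
  have "fan_region s v m = (\<Inter>i\<in>{..<m}. {x. 0 \<le> orient s (v i) (v (Suc i)) x}) \<inter> {x. 0 \<le> orient s (v m) (v 0) x}"
    by (auto simp: fan_region_def)
  then show ?thesis by (simp only:) (intro convex_Int convex_INT convex_orient_ge)
qed

text \<open>A new vertex attaches the triangle on the diagonal from v 0 to v m. The two pieces meet
  only on that line, a null set, so the measures add.\<close>

lemma fan_region_measure:
  assumes s: "\<bar>s\<bar> = 1" and m: "2 \<le> m"
    and pos: "\<And>i j k. i < j \<Longrightarrow> j < k \<Longrightarrow> k \<le> m \<Longrightarrow> 0 < orient s (v i) (v j) (v k)"
  shows "compact (fan_region s v m) \<and>
    measure lebesgue (fan_region s v m) = (\<Sum>i=1..<m. orient s (v 0) (v i) (v (Suc i))) / 2"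
  using m pos
proof (induction m rule: dec_induct)
  case base
  have p: "0 < orient s (v 0) (v 1) (v 2)" by (rule base) auto
  have "fan_region s v 2 = convex hull {v 0, v 1, v 2}"
    unfolding triangle_eq_halfplanes[OF p] fan_region_def
    by (auto simp: numeral_2_eq_2 less_Suc_eq)
  then show ?case using triangle_measure[OF p s] by (auto simp: finite_imp_compact_convex_hull numeral_2_eq_2)
next
  case (step m)
  have IH: "compact (fan_region s v m)" 
    "measure lebesgue (fan_region s v m) = (\<Sum>i=1..<m. orient s (v 0) (v i) (v (Suc i))) / 2"
    using step.IH step.prems by auto
  have p: "0 < orient s (v 0) (v m) (v (Suc m))" by (rule step.prems) (use step.hyps in auto)
  define T where "T = convex hull {v 0, v m, v (Suc m)}"
  have T: "T = {x. 0 \<le> orient s (v 0) (v m) x \<and> 0 \<le> orient s (v m) (v (Suc m)) x \<and> 0 \<le> orient s (v (Suc m)) (v 0) x}"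
    unfolding T_def by (rule triangle_eq_halfplanes[OF p])
  have inT: "v k \<in> fan_region s v (Suc m)" if k: "k \<le> Suc m" for k
    unfolding fan_region_def
  proof (intro CollectI conjI allI impI)
    fix i assume i: "i < Suc m"
    consider "k < i" | "k = i" | "k = Suc i" | "Suc i < k" by linarith
    then show "0 \<le> orient s (v i) (v (Suc i)) (v k)"
    proof cases
      case 1
      then have "0 < orient s (v k) (v i) (v (Suc i))" by (intro step.prems) (use i in auto)
      then show ?thesis by (simp add: orient_cycle[of s "v k"])
    next
      case 4
      then have "0 < orient s (v i) (v (Suc i)) (v k)" by (intro step.prems) (use k in auto)
      then show ?thesis by simp
    qed auto
  next
    show "0 \<le> orient s (v (Suc m)) (v 0) (v k)"
    proof (cases "k = 0 \<or> k = Suc m")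
      case False
      then have "0 < orient s (v 0) (v k) (v (Suc m))" by (intro step.prems) (use k in auto)
      then show ?thesis by (simp add: orient_cycle[of s "v (Suc m)"])
    qed auto
  qed
  have sub1: "T \<subseteq> fan_region s v (Suc m)"
    unfolding T_def by (rule hull_minimal) (use inT convex_fan_region in auto)
  have sub2: "fan_region s v m \<subseteq> fan_region s v (Suc m)"
  proof
    fix x assume x: "x \<in> fan_region s v m"
    have e: "0 \<le> orient s (v i) (v (Suc i)) x" if "i < m" for i using x that by (simp add: fan_region_def)
    have d: "0 \<le> orient s (v m) (v 0) x" using x by (simp add: fan_region_def)
    have "0 \<le> orient s (v m) (v (Suc m)) x"
    proof (rule orient_corner[of s "v (m - 1)" "v m" "v 0"])
      have "0 < orient s (v 0) (v (m-1)) (v m)" by (rule step.prems) (use step.hyps in auto)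
      then show "0 < orient s (v (m - 1)) (v m) (v 0)" by (simp add: orient_cycle[of s "v 0"])
      show "0 < orient s (v (m - 1)) (v m) (v (Suc m))" by (rule step.prems) (use step.hyps in auto)
      show "0 < orient s (v m) (v (Suc m)) (v 0)" using p by (simp add: orient_cycle[of s "v 0"])
      show "0 \<le> orient s (v (m - 1)) (v m) x" using e[of "m - 1"] step.hyps by simp
      show "0 \<le> orient s (v m) (v 0) x" by (rule d)
    qed
    moreover have "0 \<le> orient s (v (Suc m)) (v 0) x"
    proof -
      \<comment> \<open>The corner at v 0 is the mirror image of the one at v m, so the same lemma
        is used with reversed orientation.\<close>
      have "0 \<le> orient (- s) (v 0) (v (Suc m)) x"
      proof (rule orient_corner[of "-s" "v 1" "v 0" "v m"])
        have "0 < orient s (v 0) (v 1) (v m)" "0 < orient s (v 0) (v 1) (v (Suc m))"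
          by (rule step.prems; use step.hyps in auto)+
        then show "0 < orient (-s) (v 1) (v 0) (v m)" "0 < orient (-s) (v 1) (v 0) (v (Suc m))"
          by (simp_all add: orient_expand algebra_simps)
        show "0 < orient (-s) (v 0) (v (Suc m)) (v m)" using p by (simp add: orient_expand algebra_simps)
        show "0 \<le> orient (-s) (v 1) (v 0) x" using e[of 0] step.hyps by (simp add: orient_expand algebra_simps)
        show "0 \<le> orient (-s) (v 0) (v m) x" using d by (simp add: orient_expand algebra_simps)
      qed
      then show ?thesis by (simp add: orient_expand algebra_simps)
    qed
    ultimately show "x \<in> fan_region s v (Suc m)" using e by (auto simp: fan_region_def less_Suc_eq)
  qed
  have un: "fan_region s v (Suc m) = fan_region s v m \<union> T"
  proof
    show "fan_region s v (Suc m) \<subseteq> fan_region s v m \<union> T"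
      unfolding T using orient_swap[of s "v 0" "v m"] by (auto simp: fan_region_def)
  qed (use sub1 sub2 in auto)
  have cT: "compact T" unfolding T_def by (simp add: finite_imp_compact_convex_hull)
  have "v 0 \<noteq> v m" using p by auto
  then have "negligible {x. orient s (v 0) (v m) x = 0}" using s by (intro negligible_orient_eq) auto
  moreover have "fan_region s v m \<inter> T \<subseteq> {x. orient s (v 0) (v m) x = 0}"
    unfolding T using orient_swap[of s "v m" "v 0"] by (auto simp: fan_region_def intro: antisym)
  ultimately have neg: "negligible (fan_region s v m \<inter> T)" by (rule negligible_subset)
  have "measure lebesgue (fan_region s v (Suc m)) = measure lebesgue (fan_region s v m) + measure lebesgue T"
    unfolding un using IH(1) cT measure_Un3[of "fan_region s v m" lebesgue T] negligible_imp_measure0[OF neg]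
    by (simp add: lmeasurable_compact)
  also have "\<dots> = (\<Sum>i=1..<Suc m. orient s (v 0) (v i) (v (Suc i))) / 2"
    unfolding IH(2) T_def triangle_measure[OF p s] using step.hyps by (simp add: add_divide_distrib)
  finally show ?case using IH(1) cT un by (auto intro: compact_Un)
qed

text \<open>Demanding this of all increasing triples, not only consecutive ones, makes every
  diagonal available; for points in order on a circle it is no harder to prove.\<close>

definition ordered_convex :: "real \<Rightarrow> nat \<Rightarrow> (nat \<Rightarrow> real^2) \<Rightarrow> bool" where
  "ordered_convex s n v \<longleftrightarrow> 3 \<le> n \<and> \<bar>s\<bar> = 1 \<and>
     (\<forall>i j k. i < j \<longrightarrow> j < k \<longrightarrow> k < n \<longrightarrow> 0 < orient s (v i) (v j) (v k))"

lemma Suc_mod_if: "i < n \<Longrightarrow> Suc i mod n = (if Suc i = n then 0 else Suc i)"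
  by (cases "Suc i = n") auto

lemma ordered_convex_edge:
  assumes c: "ordered_convex s n v" and i: "i < n" and k: "k < n" "k \<noteq> i" "k \<noteq> Suc i mod n"
  shows "0 < orient s (v i) (v (Suc i mod n)) (v k)"
proof (cases "Suc i = n")
  case True
  then have "0 < k" "k < i" using k i by (auto simp: Suc_mod_if)
  then have "0 < orient s (v 0) (v k) (v i)" using c i by (auto simp: ordered_convex_def)
  then show ?thesis using True by (simp add: orient_cycle[of s "v i"])
next
  case False
  then have m: "Suc i mod n = Suc i" using i by (simp add: Suc_mod_if)
  show ?thesis
  proof (cases "k < i")
    case True
    then have "0 < orient s (v k) (v i) (v (Suc i))" using c i False by (auto simp: ordered_convex_def)
    then show ?thesis unfolding m by (simp add: orient_cycle[of s "v k"])
  next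
    case nk: False
    then have "Suc i < k" using k m by auto
    then show ?thesis unfolding m using c k by (auto simp: ordered_convex_def)
  qed
qed

lemma ordered_convex_edge_ge:
  assumes c: "ordered_convex s n v" and i: "i < n" and k: "k < n"
  shows "0 \<le> orient s (v i) (v (Suc i mod n)) (v k)"
  using ordered_convex_edge[OF c i k] by (cases "k = i \<or> k = Suc i mod n") auto

lemma ordered_convex_inj:
  assumes c: "ordered_convex s n v"
  shows "inj_on v {..<n}"
proof -
  have "v i \<noteq> v j" if ij: "i < j" "j < n" for i j
  proof -
    have "3 \<le> n" using c by (simp add: ordered_convex_def)
    then consider "Suc j < n" | "j = n - 1" "0 < i" | "j = n - 1" "i = 0" "1 < j" using ij by linarith
    then show ?thesis
    proof cases
      case 1
      then have "0 < orient s (v i) (v j) (v (Suc j))" using c ij by (auto simp: ordered_convex_def)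
      then show ?thesis by auto
    next
      case 2
      then have "0 < orient s (v 0) (v i) (v j)" using c ij by (auto simp: ordered_convex_def)
      then show ?thesis by auto
    next
      case 3
      then have "0 < orient s (v 0) (v 1) (v j)" using c ij by (auto simp: ordered_convex_def)
      then show ?thesis using 3 by auto
    qed
  qed
  then show ?thesis by (intro inj_onI) (metis lessThan_iff linorder_neqE_nat)
qed

lemma fan_region_eq:
  assumes n: "3 \<le> n"
  shows "fan_region s v (n - 1) = {x. \<forall>i<n. 0 \<le> orient s (v i) (v (Suc i mod n)) x}"
proof -
  have "(\<forall>i<n. 0 \<le> orient s (v i) (v (Suc i mod n)) x) \<longleftrightarrow>
      (\<forall>i<n-1. 0 \<le> orient s (v i) (v (Suc i)) x) \<and> 0 \<le> orient s (v (n-1)) (v 0) x" for x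
  proof -
    have "{..<n} = insert (n-1) {..<n-1}" using n by auto
    then have "(\<forall>i<n. 0 \<le> orient s (v i) (v (Suc i mod n)) x) \<longleftrightarrow>
       (\<forall>i\<in>insert (n-1) {..<n-1}. 0 \<le> orient s (v i) (v (Suc i mod n)) x)" by (metis lessThan_iff)
    then show ?thesis using n by auto
  qed
  then show ?thesis by (auto simp: fan_region_def)
qed

text \<open>The neighbouring edges cut the line of side i down to the side: the next one gives t
  \<le> 1, the previous one t >= 0.\<close>

lemma ordered_convex_side:
  assumes c: "ordered_convex s n v" and i: "i < n"
    and x: "\<And>k. k < n \<Longrightarrow> 0 \<le> orient s (v k) (v (Suc k mod n)) x"
    and x0: "orient s (v i) (v (Suc i mod n)) x = 0"
  shows "x \<in> side n v i"
proof -
  have n: "3 \<le> n" "s \<noteq> 0" using c by (auto simp: ordered_convex_def)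
  define j where "j = Suc i mod n"
  define h where "h = (if i = 0 then n - 1 else i - 1)"
  have hn: "h < n" "Suc h mod n = i" using i n by (auto simp: h_def Suc_mod_if)
  have jn: "j < n" "j \<noteq> i" "j \<noteq> h" using i n by (auto simp: j_def h_def Suc_mod_if split: if_splits)
  have ij: "i \<noteq> Suc j mod n" using i n by (auto simp: j_def Suc_mod_if split: if_splits)
  have "v i \<noteq> v j" using ordered_convex_inj[OF c] i jn by (auto simp: inj_on_def)
  then obtain t where t: "x = (1 - t) *\<^sub>R v i + t *\<^sub>R v j"
    using orient_eq_0_param[OF x0[folded j_def] n(2)] by metis
  have "0 \<le> (1 - t) * orient s (v j) (v (Suc j mod n)) (v i)"
    using x[OF jn(1)] unfolding t orient_affine by simp
  moreover have "0 < orient s (v j) (v (Suc j mod n)) (v i)" using ordered_convex_edge[OF c jn(1) i] jn ij by auto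
  ultimately have t1: "t \<le> 1" by (simp add: zero_le_mult_iff)
  have "0 \<le> t * orient s (v h) (v i) (v j)"
    using x[OF hn(1)] unfolding hn(2) t orient_affine by simp
  moreover have "0 < orient s (v h) (v i) (v j)" using ordered_convex_edge[OF c hn(1) jn(1)] jn hn by auto
  ultimately have "0 \<le> t" by (simp add: zero_le_mult_iff)
  with t t1 show ?thesis unfolding side_def j_def[symmetric] in_segment by auto
qed

text \<open>The affine form of side i is positive at every vertex except its own two ends. If it
  vanishes at a point of side j, every end of side j with positive weight must be an end of side
  i.\<close>

lemma ordered_convex_polygon:
  assumes c: "ordered_convex s n v"
  shows "polygon n v"
  unfolding polygon_def
proof (intro conjI allI impI)
  have n: "3 \<le> n" using c by (simp add: ordered_convex_def)
  then show "3 \<le> n" .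
  show inj: "inj_on v {..<n}" by (rule ordered_convex_inj[OF c])
  fix i j assume ij: "i < n" "j < n" "i \<noteq> j"
  show "side n v i \<inter> side n v j \<subseteq> side_ends n v i \<inter> side_ends n v j"
  proof
    fix x assume x: "x \<in> side n v i \<inter> side n v j"
    define i' j' where "i' = Suc i mod n" and "j' = Suc j mod n"
    have n': "i' < n" "j' < n" using n by (auto simp: i'_def j'_def)
    obtain u where u: "x = (1 - u) *\<^sub>R v i + u *\<^sub>R v i'" "0 \<le> u" "u \<le> 1"
      using x by (auto simp: side_def in_segment i'_def)
    obtain t where t: "x = (1 - t) *\<^sub>R v j + t *\<^sub>R v j'" "0 \<le> t" "t \<le> 1"
      using x by (auto simp: side_def in_segment j'_def)
    define f where "f = orient s (v i) (v i')"
    have "f x = 0" unfolding f_def u(1) orient_affine by simp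
    then have sum0: "(1 - t) * f (v j) + t * f (v j') = 0" unfolding t(1) f_def orient_affine by simp
    have ge: "0 \<le> f (v j)" "0 \<le> f (v j')"
      unfolding f_def i'_def using ordered_convex_edge_ge[OF c] ij n' by auto
    have gt: "0 < f (v k)" if "k < n" "k \<noteq> i" "k \<noteq> i'" for k
      unfolding f_def i'_def using that ordered_convex_edge[OF c ij(1)] by (auto simp: i'_def)
    have z: "(1 - t) * f (v j) = 0" "t * f (v j') = 0"
      using sum0 ge t mult_nonneg_nonneg[of "1-t" "f (v j)"] mult_nonneg_nonneg[of t "f (v j')"] by linarith+
    have "\<not> (j = i' \<and> j' = i)" using ij n by (auto simp: i'_def j'_def Suc_mod_if split: if_splits)
    moreover have "i' \<noteq> j'" using ij n by (auto simp: i'_def j'_def Suc_mod_if split: if_splits)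
    ultimately have "j \<notin> {i, i'} \<or> j' \<notin> {i, i'}" using ij by auto
    then show "x \<in> side_ends n v i \<inter> side_ends n v j"
    proof
      assume "j \<notin> {i, i'}"
      then have "t = 1" using z(1) gt[of j] ij by auto
      then have xj: "x = v j'" using t by simp
      have "j' \<in> {i, i'}" using z(2) gt[of j'] n' \<open>t = 1\<close> by force
      then show ?thesis using xj by (auto simp: side_ends_def i'_def j'_def)
    next
      assume "j' \<notin> {i, i'}"
      then have "t = 0" using z(2) gt[of j'] n' by auto
      then have xj: "x = v j" using t by simp
      have "j \<in> {i, i'}" using z(1) gt[of j] ij \<open>t = 0\<close> by force
      then show ?thesis using xj by (auto simp: side_ends_def i'_def j'_def)
    qed
  qed
qed

text \<open>The sides form the frontier of the compact convex region \<open>K\<close>, so what they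
  enclose is its interior, and the frontier of a convex set is negligible.\<close>

lemma ordered_convex_area:
  assumes c: "ordered_convex s n v"
  shows "area n v = (\<Sum>i=1..<n-1. orient s (v 0) (v i) (v (Suc i))) / 2"
proof -
  have n: "3 \<le> n" "\<bar>s\<bar> = 1" "s \<noteq> 0" using c by (auto simp: ordered_convex_def)
  define K where "K = fan_region s v (n - 1)"
  have "compact K \<and> measure lebesgue K = (\<Sum>i=1..<n-1. orient s (v 0) (v i) (v (Suc i))) / 2"
    unfolding K_def by (rule fan_region_measure) (use c n in \<open>auto simp: ordered_convex_def\<close>)
  then have K: "compact K" "measure lebesgue K = (\<Sum>i=1..<n-1. orient s (v 0) (v i) (v (Suc i))) / 2" by auto
  have Keq: "K = {x. \<forall>i<n. 0 \<le> orient s (v i) (v (Suc i mod n)) x}"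
    unfolding K_def by (rule fan_region_eq[OF n(1)])
  have cK: "convex K" unfolding K_def by (rule convex_fan_region)
  define U where "U = {x. \<forall>i<n. 0 < orient s (v i) (v (Suc i mod n)) x}"
  have "U = (\<Inter>i\<in>{..<n}. {x. 0 < orient s (v i) (v (Suc i mod n)) x})" by (auto simp: U_def)
  then have "open U" by (simp only:) (intro open_INT open_orient_gt ballI finite_lessThan)
  moreover have "U \<subseteq> K" by (force simp: U_def Keq)
  ultimately have "U \<subseteq> interior K" by (intro interior_maximal)
  moreover have "interior K \<subseteq> U"
  proof
    fix x assume x: "x \<in> interior K"
    have "0 < orient s (v i) (v (Suc i mod n)) x" if i: "i < n" for i
    proof -
      have "Suc i mod n \<noteq> i" using i n by (auto simp: Suc_mod_if)
      then have "v i \<noteq> v (Suc i mod n)" using ordered_convex_inj[OF c] i n by (auto simp: inj_on_def)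
      moreover have "interior K \<subseteq> interior {x. 0 \<le> orient s (v i) (v (Suc i mod n)) x}"
        using i by (intro interior_mono) (auto simp: Keq)
      ultimately show ?thesis using x n interior_orient_ge by fastforce
    qed
    then show "x \<in> U" by (simp add: U_def)
  qed
  ultimately have int: "interior K = U" by auto
  have "frontier K = (\<Union>i<n. side n v i)"
  proof -
    have "frontier K = K - U" using int K(1) by (simp add: frontier_def compact_imp_closed closure_closed)
    also have "\<dots> = (\<Union>i<n. side n v i)"
    proof
      show "K - U \<subseteq> (\<Union>i<n. side n v i)"
      proof
        fix x assume x: "x \<in> K - U"
        then obtain i where i: "i < n" "\<not> 0 < orient s (v i) (v (Suc i mod n)) x" by (auto simp: U_def)
        have "orient s (v i) (v (Suc i mod n)) x = 0" using x i by (auto simp: Keq intro: antisym)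
        then have "x \<in> side n v i" using x i by (intro ordered_convex_side[OF c]) (auto simp: Keq)
        then show "x \<in> (\<Union>i<n. side n v i)" using i by auto
      qed
      show "(\<Union>i<n. side n v i) \<subseteq> K - U"
      proof
        fix x assume "x \<in> (\<Union>i<n. side n v i)"
        then obtain i where i: "i < n" "x \<in> side n v i" by auto
        have "v k \<in> K" if "k < n" for k using that ordered_convex_edge_ge[OF c] by (auto simp: Keq)
        then have "side n v i \<subseteq> K" unfolding side_def using i n by (intro closed_segment_subset cK) auto
        moreover have "orient s (v i) (v (Suc i mod n)) x = 0"
          using i(2) by (auto simp: side_def in_segment orient_affine)
        ultimately show "x \<in> K - U" using i by (force simp: U_def)
      qed
    qed
    finally show ?thesis .
  qed
  then have "inside (\<Union>i<n. side n v i) = interior K"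
    using inside_frontier_eq_interior[of K] compact_imp_bounded[OF K(1)] cK by simp
  moreover have "measure lebesgue (interior K) = measure lebesgue K"
    by (intro measure_interior compact_imp_bounded K(1) negligible_convex_frontier cK)
  ultimately show ?thesis using K(2) by (simp add: area_def)
qed

section \<open>Points on a circle\<close>

definition circle_pt :: "real^2 \<Rightarrow> real \<Rightarrow> real \<Rightarrow> real \<Rightarrow> real \<Rightarrow> real^2" where
  "circle_pt c r \<psi> s a = c + vector [r * cos (\<psi> + s * a), r * sin (\<psi> + s * a)]"

lemma circle_pt_nth [simp]:
  "circle_pt c r \<psi> s a $ 1 = c $ 1 + r * cos (\<psi> + s * a)"
  "circle_pt c r \<psi> s a $ 2 = c $ 2 + r * sin (\<psi> + s * a)"
  by (simp_all add: circle_pt_def)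

lemma orient_circle_pt:
  assumes s: "\<bar>s\<bar> = 1"
  shows "orient s (circle_pt c r \<psi> s a) (circle_pt c r \<psi> s b) (circle_pt c r \<psi> s d) =
    r\<^sup>2 * (sin (b - a) + sin (d - b) - sin (d - a))"
proof -
  have sn: "s * sin (s * x) = sin x" for x using s by (cases "s = 1") (auto simp: abs_if split: if_splits)
  have "orient s (circle_pt c r \<psi> s a) (circle_pt c r \<psi> s b) (circle_pt c r \<psi> s d) =
     r\<^sup>2 * (s * sin ((\<psi> + s * b) - (\<psi> + s * a)) + s * sin ((\<psi> + s * d) - (\<psi> + s * b)) - s * sin ((\<psi> + s * d) - (\<psi> + s * a)))"
    unfolding orient_expand circle_pt_nth sin_diff by (simp add: power2_eq_square algebra_simps)
  also have "\<dots> = r\<^sup>2 * (s * sin (s * (b - a)) + s * sin (s * (d - b)) - s * sin (s * (d - a)))"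
    by (simp add: algebra_simps)
  finally show ?thesis unfolding sn .
qed

lemma orient_circle_pt_prod:
  assumes s: "\<bar>s\<bar> = 1"
  shows "orient s (circle_pt c r \<psi> s a) (circle_pt c r \<psi> s b) (circle_pt c r \<psi> s d) =
    4 * r\<^sup>2 * (sin ((b - a)/2) * sin ((d - b)/2) * sin ((d - a)/2))"
  using sin_add_sin_diff[of "b - a" "d - b"] unfolding orient_circle_pt[OF s] by simp

lemma dist_circle_pt:
  assumes s: "\<bar>s\<bar> = 1" and r: "0 \<le> r"
  shows "dist (circle_pt c r \<psi> s a) (circle_pt c r \<psi> s b) = 2 * r * \<bar>sin ((b - a)/2)\<bar>"
proof -
  have "(dist (circle_pt c r \<psi> s a) (circle_pt c r \<psi> s b))\<^sup>2 = 
    (r * cos (\<psi> + s * a) - r * cos (\<psi> + s * b))\<^sup>2 + (r * sin (\<psi> + s * a) - r * sin (\<psi> + s * b))\<^sup>2"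
    by (simp add: dist_vec_def L2_set_def sum_2 dist_real_def)
  also have "\<dots> = r\<^sup>2 * (2 - 2 * cos ((\<psi> + s * b) - (\<psi> + s * a)))"
  proof -
    define x y where "x = \<psi> + s * a" and "y = \<psi> + s * b"
    have "(sin x)\<^sup>2 + (cos x)\<^sup>2 = 1" "(sin y)\<^sup>2 + (cos y)\<^sup>2 = 1" by auto
    then show ?thesis unfolding x_def[symmetric] y_def[symmetric] cos_diff by algebra
  qed
  also have "cos ((\<psi> + s * b) - (\<psi> + s * a)) = cos (s * (b - a))" by (simp add: algebra_simps)
  also have "\<dots> = cos (b - a)"
    using s cos_minus[of "b - a"] by (cases "s = 1") (auto simp: abs_if split: if_splits)
  also have "cos (b - a) = 1 - 2 * (sin ((b - a)/2))\<^sup>2" 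
    using cos_double_sin[of "(b - a)/2"] by (metis field_sum_of_halves mult_2)
  also have "r\<^sup>2 * (2 - 2 * (1 - 2 * (sin ((b - a)/2))\<^sup>2)) = (2 * r * \<bar>sin ((b - a)/2)\<bar>)\<^sup>2"
    by (simp add: power_mult_distrib)
  finally show ?thesis using r by (intro power2_eq_imp_eq[of "dist _ _"]) auto
qed

section \<open>Polygons inscribed in a circle\<close>

text \<open>The additional value \<open>p n = 2 * pi\<close> stands for the return to
  \<open>v 0\<close>, so that the last side also spans from \<open>p i\<close> to
  \<open>p (Suc i)\<close>. The sign \<open>s\<close> absorbs the direction of the vertex
  list.\<close>

definition circular :: "nat \<Rightarrow> (nat \<Rightarrow> real^2) \<Rightarrow> real^2 \<Rightarrow> real \<Rightarrow> real \<Rightarrow> real \<Rightarrow> (nat \<Rightarrow> real) \<Rightarrow> bool" where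
  "circular n v c r \<psi> s p \<longleftrightarrow> 3 \<le> n \<and> \<bar>s\<bar> = 1 \<and> 0 < r \<and> p 0 = 0 \<and> p n = 2 * pi \<and>
     (\<forall>i<n. p i < p (Suc i)) \<and> (\<forall>i<n. v i = circle_pt c r \<psi> s (p i))"

definition half_angle :: "(nat \<Rightarrow> real) \<Rightarrow> nat \<Rightarrow> real" where
  "half_angle p i = (p (Suc i) - p i) / 2"

lemma circle_pt_2pi: "\<bar>s\<bar> = 1 \<Longrightarrow> circle_pt c r \<psi> s (a + 2 * pi) = circle_pt c r \<psi> s a"
proof -
  assume "\<bar>s\<bar> = 1"
  then consider "s = 1" | "s = - 1" by linarith
  then show ?thesis
  proof cases
    case 1
    have "\<psi> + s * (a + 2 * pi) = (\<psi> + s * a) + 2 * pi" using 1 by simp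
    then show ?thesis unfolding circle_pt_def by (simp only: sin_periodic cos_periodic)
  next
    case 2
    have "(\<psi> + s * (a + 2 * pi)) + 2 * pi = \<psi> + s * a" using 2 by simp
    then have "sin (\<psi> + s * (a + 2 * pi)) = sin (\<psi> + s * a)" "cos (\<psi> + s * (a + 2 * pi)) = cos (\<psi> + s * a)"
      by (metis sin_periodic, metis cos_periodic)
    then show ?thesis unfolding circle_pt_def by simp
  qed
qed

context
  fixes n v c r \<psi> s p
  assumes circ: "circular n v c r \<psi> s p"
begin

lemma circ_basic: "3 \<le> n" "\<bar>s\<bar> = 1" "0 < r" "p 0 = 0" "p n = 2 * pi"
  "\<And>i. i < n \<Longrightarrow> p i < p (Suc i)" "\<And>i. i < n \<Longrightarrow> v i = circle_pt c r \<psi> s (p i)"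
  using circ by (auto simp: circular_def)

lemma circ_mono: "i < j \<Longrightarrow> j \<le> n \<Longrightarrow> p i < p j"
proof (induction j rule: nat_induct)
  case (Suc j)
  then show ?case using circ_basic(6)[of j] by (cases "i = j") auto
qed simp

lemma circ_range: "i \<le> n \<Longrightarrow> 0 \<le> p i" "i \<le> n \<Longrightarrow> p i \<le> 2 * pi"
  using circ_mono[of 0 i] circ_mono[of i n] circ_basic(4,5) by (cases "i = 0"; cases "i = n"; auto)+

lemma circ_next: "i < n \<Longrightarrow> v (Suc i mod n) = circle_pt c r \<psi> s (p (Suc i))"
  using circ_basic(7)[of 0] circ_basic(7)[of "Suc i"] circ_basic(1,4,5) circle_pt_2pi[OF circ_basic(2), of c r \<psi> 0]
  by (auto simp: Suc_mod_if)

lemma circ_half_angle_pos: "i < n \<Longrightarrow> 0 < half_angle p i"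
  using circ_basic(6) by (simp add: half_angle_def)

lemma circ_half_angle_sum: "sum (half_angle p) {..<n} = pi"
proof -
  have "sum (half_angle p) {..<n} = (\<Sum>i<n. p (Suc i) - p i) / 2"
    by (simp add: half_angle_def sum_divide_distrib)
  then show ?thesis using circ_basic(4,5) by (simp add: sum_lessThan_telescope)
qed

lemma circ_half_angle_adm: "proper_angles {..<n} (half_angle p)"
  using circ_half_angle_pos circ_half_angle_sum circ_basic(1) by (intro adm_pos) auto

lemma circ_half_angle_less: "i < n \<Longrightarrow> half_angle p i < pi"
  using circ_range(1)[of i] circ_range(2)[of "Suc i"] circ_mono[of 0 i] circ_mono[of "Suc i" n] circ_basic(1,4,5)
  by (cases "i = 0") (auto simp: half_angle_def)

lemma circ_ordered_convex: "ordered_convex s n v"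
  unfolding ordered_convex_def
proof (intro conjI allI impI)
  fix i j k assume ijk: "i < j" "j < k" "k < n"
  have "p i < p j" "p j < p k" "p k < 2 * pi" "0 \<le> p i"
    using ijk circ_mono circ_range[of i] circ_basic(5) by (metis less_imp_le order.strict_trans, metis less_imp_le, metis order_refl, auto)
  then have "0 < sin ((p j - p i)/2) * sin ((p k - p j)/2) * sin ((p k - p i)/2)"
    by (intro mult_pos_pos sin_gt_zero) auto
  then show "0 < orient s (v i) (v j) (v k)"
    using ijk circ_basic by (simp add: orient_circle_pt_prod)
qed (use circ_basic in auto)

lemma circ_side_length: "i < n \<Longrightarrow> side_length n v i = 2 * r * sin (half_angle p i)"
proof -
  assume i: "i < n"
  have "0 < sin (half_angle p i)" using i circ_half_angle_pos circ_half_angle_less by (intro sin_gt_zero) auto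
  then show ?thesis unfolding side_length_def circ_next[OF i]
    using circ_basic(7)[OF i] dist_circle_pt[OF circ_basic(2), of r c \<psi> "p i" "p (Suc i)"] circ_basic(3)
    by (simp add: half_angle_def)
qed

text \<open>In the fan from v 0 the terms sin (p i) telescope, and their boundary values are just
  the contributions of the first and the last side.\<close>

lemma circ_area: "area n v = r\<^sup>2 * area_sum {..<n} (half_angle p)"
proof -
  obtain m where m: "n = Suc (Suc (Suc m))" using circ_basic(1) by (metis Suc_le_D numeral_3_eq_3 Suc_le_mono)
  have "(\<Sum>i=1..<n-1. orient s (v 0) (v i) (v (Suc i))) = (\<Sum>i=1..<n-1. r\<^sup>2 * (sin (p i) + sin (p (Suc i) - p i) - sin (p (Suc i))))"
    using circ_basic by (intro sum.cong) (auto simp: orient_circle_pt)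
  also have "\<dots> = r\<^sup>2 * ((\<Sum>i=1..<n-1. sin (p (Suc i) - p i)) - (\<Sum>i=1..<n-1. sin (p (Suc i)) - sin (p i)))"
    unfolding sum_subtractf[symmetric] sum_distrib_left by (intro sum.cong) (auto simp: algebra_simps)
  also have "(\<Sum>i=1..<n-1. sin (p (Suc i)) - sin (p i)) = sin (p (n - 1)) - sin (p 1)"
    using m by (intro sum_Suc_diff') auto
  also have "(\<Sum>i=1..<n-1. sin (p (Suc i) - p i)) - (sin (p (n - 1)) - sin (p 1)) = (\<Sum>i<n. sin (p (Suc i) - p i))"
  proof -
    have "{..<n} = insert 0 (insert (n-1) {1..<n-1})" using m by auto
    then have "(\<Sum>i<n. sin (p (Suc i) - p i)) = sin (p 1 - p 0) + (sin (p n - p (n - 1)) + (\<Sum>i=1..<n-1. sin (p (Suc i) - p i)))"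
      using m by simp
    moreover have "sin (p n - p (n - 1)) = - sin (p (n - 1))" using circ_basic(5) by (simp add: sin_diff)
    ultimately show ?thesis using circ_basic(4) by simp
  qed
  also have "(\<Sum>i<n. sin (p (Suc i) - p i)) = 2 * area_sum {..<n} (half_angle p)"
  proof -
    have "2 * half_angle p i = p (Suc i) - p i" for i by (simp add: half_angle_def)
    then show ?thesis by (simp add: area_sum_double)
  qed
  finally show ?thesis unfolding ordered_convex_area[OF circ_ordered_convex] by simp
qed

lemma circ_cyclic_polygon: "cyclic_polygon n v"
proof -
  have "v i \<in> sphere c r" if "i < n" for i
  proof -
    have "(dist c (v i))\<^sup>2 = r\<^sup>2 * (cos (\<psi> + s * p i))\<^sup>2 + r\<^sup>2 * (sin (\<psi> + s * p i))\<^sup>2"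
      using circ_basic(7)[OF that] by (simp add: dist_vec_def L2_set_def sum_2 dist_real_def power_mult_distrib)
    also have "\<dots> = r\<^sup>2" by (metis distrib_left mult.right_neutral sin_cos_squared_add2)
    finally have "(dist c (v i))\<^sup>2 = r\<^sup>2" .
    then show ?thesis using circ_basic(3) by (simp add: power2_eq_iff_nonneg)
  qed
  then show ?thesis unfolding cyclic_polygon_def using ordered_convex_polygon[OF circ_ordered_convex] by blast
qed

lemma circ_regular:
  assumes eq: "\<And>i j. i < n \<Longrightarrow> j < n \<Longrightarrow> half_angle p i = half_angle p j"
  shows "regular_polygon n v"
  unfolding regular_polygon_def
proof (intro conjI allI impI)
  show "polygon n v" using circ_cyclic_polygon by (simp add: cyclic_polygon_def)
  have n0: "0 < n" using circ_basic(1) by simp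
  define t where "t = half_angle p 0"
  have ht: "half_angle p i = t" if "i < n" for i unfolding t_def by (rule eq[OF that n0])
  show "side_length n v i = side_length n v j" if "i < n" "j < n" for i j
    using that by (simp add: circ_side_length ht)
  define a where "a = 2 * r * sin t"
  define b where "b = 2 * r * \<bar>sin (2 * t)\<bar>"
  have "vertex_angle n v i = arccos (((2 * a\<^sup>2 - b\<^sup>2) / 2) / (a * a))" if i: "i < n" for i
  proof -
    define h where "h = (i + n - 1) mod n"
    have h: "h < n" "Suc h mod n = i"
    proof -
      show "h < n" using n0 by (simp add: h_def)
      show "Suc h mod n = i" using i n0 unfolding h_def
        by (cases "i = 0") (auto simp: mod_Suc_eq Suc_mod_if)
    qed
    define x y where "x = v h - v i" and "y = v (Suc i mod n) - v i"
    have nx: "norm x = a" using circ_side_length[OF h(1)] h(2) ht[OF h(1)]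
      by (simp add: side_length_def x_def a_def dist_norm)
    have ny: "norm y = a" using circ_side_length[OF i] ht[OF i]
      by (simp add: side_length_def y_def a_def dist_norm norm_minus_commute)
    \<comment> \<open>By the law of cosines the angle depends only on the two sides a and the short
      diagonal b, which subtends the half angle 2 t.\<close>
    have "norm (x - y) = b"
    proof -
      have vi: "v i = circle_pt c r \<psi> s (p (Suc h))" using circ_next[OF h(1)] h(2) by simp
      have vh: "v h = circle_pt c r \<psi> s (p h)" by (rule circ_basic(7)[OF h(1)])
      have d1: "p (Suc h) - p h = 2 * t" using ht[OF h(1)] by (simp add: half_angle_def)
      have d2: "p (Suc i) - p i = 2 * t" using ht[OF i] by (simp add: half_angle_def)
      have "v (Suc i mod n) = circle_pt c r \<psi> s (p (Suc h) + 2 * t)"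
      \<comment> \<open>At vertex 0 the previous side ends at angle 2 pi instead of 0.\<close>
      proof (cases "i = 0")
        case True
        then have "Suc h = n" using h i n0 by (simp add: Suc_mod_if split: if_splits)
        then have "p (Suc h) + 2 * t = p (Suc i) + 2 * pi" using d2 True circ_basic(4,5) by simp
        then show ?thesis using circ_next[OF i] circle_pt_2pi[OF circ_basic(2)] by metis
      next
        case False
        then have "Suc h = i" using h i by (simp add: Suc_mod_if split: if_splits)
        then show ?thesis using circ_next[OF i] d2 by (simp add: algebra_simps)
      qed
      then have "dist (v h) (v (Suc i mod n)) = 2 * r * \<bar>sin ((p (Suc h) + 2 * t - p h)/2)\<bar>"
        using vh dist_circle_pt[OF circ_basic(2)] circ_basic(3) by simp
      also have "(p (Suc h) + 2 * t - p h)/2 = 2 * t" using d1 by simp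
      finally show ?thesis by (simp add: x_def y_def b_def dist_norm)
    qed
    then have "x \<bullet> y = (2 * a\<^sup>2 - b\<^sup>2) / 2" using nx ny by (simp add: dot_norm_neg)
    then show ?thesis unfolding vertex_angle_def Let_def h_def[symmetric] x_def[symmetric] y_def[symmetric] nx ny by (simp only:)
  qed
  then show "vertex_angle n v i = vertex_angle n v j" if "i < n" "j < n" for i j using that by simp
qed

end

section \<open>The vertices of a cyclic polygon are in angular order\<close>

lemma segment_dist_center:
  fixes a b c :: "'a::real_inner"
  assumes "dist c a = r" "dist c b = r"
  shows "(dist c ((1 - u) *\<^sub>R a + u *\<^sub>R b))\<^sup>2 = r\<^sup>2 - u * (1 - u) * (dist a b)\<^sup>2"
proof -
  define P Q where "P = a - c" and "Q = b - c"
  have r: "P \<bullet> P = r\<^sup>2" "Q \<bullet> Q = r\<^sup>2"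
    using assms by (auto simp: P_def Q_def dist_norm norm_minus_commute simp flip: power2_norm_eq_inner)
  have "(1 - u) *\<^sub>R a + u *\<^sub>R b - c = (1 - u) *\<^sub>R P + u *\<^sub>R Q" by (simp add: P_def Q_def algebra_simps)
  then have "(dist c ((1 - u) *\<^sub>R a + u *\<^sub>R b))\<^sup>2 = ((1 - u) *\<^sub>R P + u *\<^sub>R Q) \<bullet> ((1 - u) *\<^sub>R P + u *\<^sub>R Q)"
    by (metis dist_commute dist_norm power2_norm_eq_inner)
  also have "\<dots> = (1 - u)\<^sup>2 * (P \<bullet> P) + u\<^sup>2 * (Q \<bullet> Q) + 2 * u * (1 - u) * (P \<bullet> Q)"
    by (simp add: inner_simps inner_commute power2_eq_square algebra_simps)
  finally have 1: "(dist c ((1 - u) *\<^sub>R a + u *\<^sub>R b))\<^sup>2 = (1 - u)\<^sup>2 * r\<^sup>2 + u\<^sup>2 * r\<^sup>2 + 2 * u * (1 - u) * (P \<bullet> Q)"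
    by (simp add: r)
  have "a - b = P - Q" by (simp add: P_def Q_def)
  then have "(dist a b)\<^sup>2 = (P - Q) \<bullet> (P - Q)" by (simp add: dist_norm power2_norm_eq_inner)
  also have "\<dots> = 2 * r\<^sup>2 - 2 * (P \<bullet> Q)" using r by (simp add: inner_simps inner_commute)
  finally have 2: "(dist a b)\<^sup>2 = 2 * r\<^sup>2 - 2 * (P \<bullet> Q)" .
  show ?thesis unfolding 1 2 by (simp add: power2_eq_square algebra_simps)
qed

text \<open>The segment from p to q meets the line ab in a point strictly inside the circle, and the
  points of that line inside the circle are those between a and b.\<close>

lemma chords_cross:
  assumes S: "dist c a = r" "dist c b = r" "dist c p = r" "dist c q = r"
    and opp: "orient 1 a b p < 0" "0 < orient 1 a b q"
  obtains x where "x \<in> closed_segment a b" "x \<in> closed_segment p q" "dist c x < r"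
proof -
  define f where "f = orient 1 a b"
  define t where "t = - f p / (f q - f p)"
  have f: "f p < 0" "0 < f q" using opp by (auto simp: f_def)
  have t: "0 < t" "t < 1" using f by (auto simp: t_def field_simps)
  define x where "x = (1 - t) *\<^sub>R p + t *\<^sub>R q"
  have "f x = f p + t * (f q - f p)" 
    unfolding x_def f_def orient_affine by (simp add: algebra_simps)
  then have fx: "f x = 0" using f by (simp add: t_def)
  have ab: "a \<noteq> b" using opp by auto
  obtain u where u: "x = (1 - u) *\<^sub>R a + u *\<^sub>R b"
    using orient_eq_0_param[OF fx[unfolded f_def] _ ab] by auto
  have "p \<noteq> q" using f by auto
  then have "0 < t * (1 - t) * (dist p q)\<^sup>2" using t by simp
  then have lt: "(dist c x)\<^sup>2 < r\<^sup>2" using segment_dist_center[OF S(3,4), of t] by (simp add: x_def)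
  have r: "0 \<le> r" using S(1) zero_le_dist[of c a] by linarith
  have d: "dist c x < r" by (rule power2_less_imp_less[OF lt r])
  have e: "(dist c x)\<^sup>2 = r\<^sup>2 - u * (1 - u) * (dist a b)\<^sup>2"
    by (subst u) (rule segment_dist_center[OF S(1,2)])
  define Z where "Z = u * (1 - u)"
  have "0 < Z * (dist a b)\<^sup>2" using lt e unfolding Z_def by linarith
  then have "0 < Z" by (rule zero_less_mult_pos2) (use ab in simp)
  then have "0 < u * (1 - u)" by (simp only: Z_def)
  then have "0 < u" "u < 1" by (auto simp: zero_less_mult_iff)
  then have "x \<in> closed_segment a b" using u unfolding in_segment by (intro exI[of _ u]) auto
  moreover have "x \<in> closed_segment p q" using t x_def unfolding in_segment by (intro exI[of _ t]) auto
  ultimately show ?thesis using that d by blast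
qed

lemma circle_pt_exists:
  assumes "dist c x = r" "0 < r"
  shows "\<exists>a. 0 \<le> a \<and> a < 2 * pi \<and> x = circle_pt c r 0 1 a"
proof -
  have "(dist c x)\<^sup>2 = (x $ 1 - c $ 1)\<^sup>2 + (x $ 2 - c $ 2)\<^sup>2"
    by (simp add: dist_vec_def L2_set_def sum_2 dist_real_def power2_commute)
  then have "((x $ 1 - c $ 1)/r)\<^sup>2 + ((x $ 2 - c $ 2)/r)\<^sup>2 = 1"
    unfolding power_divide add_divide_distrib[symmetric] using assms by (metis divide_self less_irrefl zero_eq_power2)
  from sincos_total_2pi[OF this] obtain a where "0 \<le> a" "a < 2 * pi" "(x $ 1 - c $ 1)/r = cos a" "(x $ 2 - c $ 2)/r = sin a"
    by metis
  then show ?thesis using assms(2) by (intro exI[of _ a]) (auto simp: vec2_eq_iff field_simps)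
qed

text \<open>The absence of self-intersections is used here. Since sides do not cross, all fan
  triangles from v 0 have one orientation s, and this makes the angles measured from v 0 in
  direction s increase.\<close>

lemma cyclic_polygon_circular:
  assumes cyc: "cyclic_polygon n v"
  obtains c r \<psi> s p where "circular n v c r \<psi> s p"
proof -
  have pol: "polygon n v" and n: "3 \<le> n" and inj: "inj_on v {..<n}"
    using cyc by (auto simp: cyclic_polygon_def polygon_def)
  obtain c r where S: "\<And>i. i < n \<Longrightarrow> dist c (v i) = r" using cyc by (auto simp: cyclic_polygon_def)
  have ne: "v i \<noteq> v j" if "i < n" "j < n" "i \<noteq> j" for i j using inj that by (auto simp: inj_on_def)
  have "r \<noteq> 0"
  proof
    assume "r = 0"
    then have "v 0 = c" "v 1 = c" using S[of 0] S[of 1] n by auto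
    then show False using ne[of 0 1] n by auto
  qed
  moreover have "0 \<le> r" using S[of 0] n by auto
  ultimately have r: "0 < r" by simp
  have "\<forall>i\<in>{..<n}. \<exists>a. 0 \<le> a \<and> a < 2 * pi \<and> v i = circle_pt c r 0 1 a"
    using circle_pt_exists[OF S r] by auto
  then obtain \<alpha> where \<alpha>: "\<And>i. i < n \<Longrightarrow> 0 \<le> \<alpha> i \<and> \<alpha> i < 2 * pi \<and> v i = circle_pt c r 0 1 (\<alpha> i)"
    using bchoice by (metis lessThan_iff)
  have nz: "orient 1 (v i) (v j) (v k) \<noteq> 0" if "i < n" "j < n" "k < n" "i \<noteq> j" "j \<noteq> k" "i \<noteq> k" for i j k
  proof -
    have s0: "sin ((\<alpha> y - \<alpha> x)/2) \<noteq> 0" if xy: "x < n" "y < n" "x \<noteq> y" for x y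
    proof
      assume 0: "sin ((\<alpha> y - \<alpha> x)/2) = 0"
      have "\<alpha> x \<noteq> \<alpha> y" using ne[OF xy] \<alpha>[OF xy(1)] \<alpha>[OF xy(2)] by metis
      moreover have "\<bar>(\<alpha> y - \<alpha> x)/2\<bar> < pi" 

      proof -
        have "0 \<le> \<alpha> x" "\<alpha> x < 2 * pi" "0 \<le> \<alpha> y" "\<alpha> y < 2 * pi" using \<alpha> xy by auto
        then have "\<bar>\<alpha> y - \<alpha> x\<bar> < 2 * pi" by linarith
        then show ?thesis by simp
      qed
      ultimately show False using 0 sin_eq_0_pi[of "(\<alpha> y - \<alpha> x)/2"] by (auto simp: abs_less_iff)
    qed
    have "orient 1 (v i) (v j) (v k) = 4 * r\<^sup>2 * (sin ((\<alpha> j - \<alpha> i)/2) * sin ((\<alpha> k - \<alpha> j)/2) * sin ((\<alpha> k - \<alpha> i)/2))"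
      using \<alpha> that by (simp add: orient_circle_pt_prod)
    then show ?thesis using s0 that r by simp
  qed
  \<comment> \<open>Otherwise sides i and j would cross inside the circle, whereas a common point of
    two sides is a vertex and lies on the circle.\<close>
  have same: "sgn (orient 1 (v i) (v (Suc i mod n)) (v j)) = sgn (orient 1 (v i) (v (Suc i mod n)) (v (Suc j mod n)))"
    if ij: "i < n" "j < n" "j \<noteq> i" "j \<noteq> Suc i mod n" "Suc j mod n \<noteq> i" "Suc j mod n \<noteq> Suc i mod n" for i j
  proof (rule ccontr)
    assume neq: "\<not> ?thesis"
    have m: "Suc i mod n < n" "Suc j mod n < n" "i \<noteq> Suc i mod n" "j \<noteq> Suc j mod n" using n ij by (auto simp: Suc_mod_if)
    define f where "f = orient 1 (v i) (v (Suc i mod n))"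
    have "f (v j) \<noteq> 0" "f (v (Suc j mod n)) \<noteq> 0" unfolding f_def by (rule nz; use ij m in auto)+
    then consider "f (v j) < 0" "0 < f (v (Suc j mod n))" | "f (v (Suc j mod n)) < 0" "0 < f (v j)"
      using neq by (fastforce simp: f_def sgn_if split: if_splits)
    then obtain x where x: "x \<in> side n v i" "x \<in> side n v j" "dist c x < r"
    proof cases
      case 1
      show ?thesis
        by (rule chords_cross[of c "v i" r "v (Suc i mod n)" "v j" "v (Suc j mod n)"])
          (use 1 S ij m that in \<open>auto simp: f_def side_def\<close>)
    next
      case 2
      show ?thesis
        by (rule chords_cross[of c "v i" r "v (Suc i mod n)" "v (Suc j mod n)" "v j"])
          (use 2 S ij m that in \<open>auto simp: f_def side_def closed_segment_commute\<close>)
    qed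
    then have "x \<in> side_ends n v i" using pol ij by (auto simp: polygon_def)
    then have "dist c x = r" using S ij m by (auto simp: side_ends_def)
    with x show False by simp
  qed
  define F where "F = (\<lambda>i. orient 1 (v 0) (v i) (v (Suc i)))"
  have step: "sgn (F i) = sgn (F (Suc i))" if i: "1 \<le> i" "Suc (Suc i) < n" for i
  proof -
    have m: "Suc i mod n = Suc i" "Suc (Suc i) mod n = Suc (Suc i)" using i by auto
    \<comment> \<open>Following the boundary from v (i + 2) to v (n - 1) and on to v 0 never crosses
      the line of side i; likewise the path from v 0 to v i for side i + 1. The triangle of v i, v
      (i + 1), v (i + 2) links the two signs.\<close>
    have a: "sgn (orient 1 (v i) (v (Suc i)) (v (Suc (Suc i) + k))) = sgn (orient 1 (v i) (v (Suc i)) (v (Suc (Suc i))))"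
      if "Suc (Suc i) + k < n" for k using that
    proof (induction k)
      case (Suc k)
      then show ?case using same[of i "Suc (Suc i) + k"] i m by simp
    qed simp
    define k where "k = n - 1 - Suc (Suc i)"
    have k: "Suc (Suc i) + k = n - 1" using i by (simp add: k_def)
    have "sgn (orient 1 (v i) (v (Suc i)) (v (n - 1))) = sgn (orient 1 (v i) (v (Suc i)) (v 0))"
      using same[of i "n - 1"] i m n by simp
    then have 1: "sgn (orient 1 (v i) (v (Suc i)) (v 0)) = sgn (orient 1 (v i) (v (Suc i)) (v (Suc (Suc i))))"
      using a[of k] k i by simp
    have b: "sgn (orient 1 (v (Suc i)) (v (Suc (Suc i))) (v k)) = sgn (orient 1 (v (Suc i)) (v (Suc (Suc i))) (v 0))"
      if "k \<le> i" for k using that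
    proof (induction k)
      case (Suc k)
      then show ?case using same[of "Suc i" k] i m by simp
    qed simp
    have "sgn (F (Suc i)) = sgn (orient 1 (v (Suc i)) (v (Suc (Suc i))) (v i))"
      using b[of i] by (simp add: F_def orient_cycle[of 1 "v 0"])
    also have "\<dots> = sgn (orient 1 (v i) (v (Suc i)) (v (Suc (Suc i))))" by (simp add: orient_cycle[of 1 "v i"])
    also have "\<dots> = sgn (F i)" using 1 by (simp add: F_def orient_cycle[of 1 "v 0"])
    finally show ?thesis by simp
  qed
  define s where "s = sgn (F 1)"
  have F: "sgn (F (Suc k)) = s" if "Suc (Suc k) < n" for k using that
  proof (induction k)
    case (Suc k)
    then show ?case using step[of "Suc k"] by simp
  qed (simp add: s_def)
  have "F 1 \<noteq> 0" unfolding F_def by (rule nz) (use n in auto)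
  then have s: "\<bar>s\<bar> = 1" "s = 1 \<or> s = -1" by (auto simp: s_def sgn_if)
  define \<beta> where "\<beta> = (\<lambda>i. if \<alpha> i < \<alpha> 0 then \<alpha> i - \<alpha> 0 + 2 * pi else \<alpha> i - \<alpha> 0)"
  have \<beta>: "0 < \<beta> i \<and> \<beta> i < 2 * pi \<and> v i = circle_pt c r (\<alpha> 0) 1 (\<beta> i)" if i: "i < n" "i \<noteq> 0" for i
  proof -
    have a: "0 \<le> \<alpha> i" "\<alpha> i < 2 * pi" "v i = circle_pt c r 0 1 (\<alpha> i)" "0 \<le> \<alpha> 0" "\<alpha> 0 < 2 * pi" "v 0 = circle_pt c r 0 1 (\<alpha> 0)"
      using \<alpha>[of i] \<alpha>[of 0] i n by auto
    have "\<alpha> i \<noteq> \<alpha> 0" using ne[of i 0] a i n by auto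
    moreover have "circle_pt c r (\<alpha> 0) 1 (\<beta> i) = circle_pt c r 0 1 (\<alpha> i)"
      by (auto simp: circle_pt_def \<beta>_def)
    ultimately show ?thesis using a by (auto simp: \<beta>_def)
  qed
  \<comment> \<open>\<beta> measures angles counterclockwise from v 0; for a clockwise list they are
    reflected to 2 pi - \<beta>.\<close>
  define p where "p = (\<lambda>i. if i = 0 then 0 else if i = n then 2 * pi else if s = 1 then \<beta> i else 2 * pi - \<beta> i)"
  have p: "0 < p i \<and> p i < 2 * pi" if "0 < i" "i < n" for i using \<beta>[of i] that by (auto simp: p_def)
  have p0: "p 0 = 0" by (simp add: p_def)
  have vp: "v i = circle_pt c r (\<alpha> 0) s (p i)" if i: "i < n" for i
  proof (cases "i = 0")
    case True
    then show ?thesis using \<alpha>[of 0] i by (simp add: p_def circle_pt_def)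
  next
    case False
    show ?thesis
    proof (cases "s = 1")
      case True
      then show ?thesis using \<beta>[OF i False] False i by (simp add: p_def)
    next
      case s1: False
      then have "s = -1" using s by auto
      then have "\<alpha> 0 + s * p i = (\<alpha> 0 + 1 * \<beta> i) - 2 * pi" using False i by (simp add: p_def)
      then show ?thesis using \<beta>[OF i False] by (simp only: circle_pt_def) (simp add: sin_diff cos_diff)
    qed
  qed
  have inc: "p i < p (Suc i)" if i: "i < n" for i
  proof -
    consider "i = 0" | "Suc i = n" "i \<noteq> 0" | "0 < i" "Suc i < n" using i by linarith
    then show ?thesis
    proof cases
      case 1
      then show ?thesis using p[of 1] n by (simp add: p_def)
    next
      case 2
      then show ?thesis using p[of i] i n by (simp add: p_def)
    next
      case 3
      have "orient s (v 0) (v i) (v (Suc i)) = s * F i" by (simp add: F_def orient_expand)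
      \<comment> \<open>By the product formula this sign is that of sin ((p (i + 1) - p i) / 2),
        since the other two sines are positive.\<close>
      also have "s * F i > 0" using F[of "i - 1"] 3 s by (auto simp: sgn_if split: if_splits)
      finally have "0 < 4 * r\<^sup>2 * (sin (p i / 2) * sin ((p (Suc i) - p i)/2) * sin (p (Suc i) / 2))"
        using vp[of 0] vp[of i] vp[of "Suc i"] 3 n s(1) by (simp add: orient_circle_pt_prod p0)
      moreover have "0 < sin (p i / 2)" "0 < sin (p (Suc i) / 2)" using p[of i] p[of "Suc i"] 3 by (auto intro!: sin_gt_zero)
      ultimately have pos: "0 < sin ((p (Suc i) - p i)/2)" using r by (simp add: zero_less_mult_iff)
      show ?thesis
      proof (rule ccontr)
        assume "\<not> ?thesis"
        then have "0 \<le> sin ((p i - p (Suc i))/2)" using p[of i] p[of "Suc i"] 3 by (intro sin_ge_zero) auto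
        then show False using pos sin_minus[of "(p (Suc i) - p i)/2"] by (simp add: minus_divide_left)
      qed
    qed
  qed
  have "circular n v c r (\<alpha> 0) s p"
    unfolding circular_def using n s r inc vp by (auto simp: p_def)
  then show ?thesis by (rule that)
qed

section \<open>Bounds for the regular polygon\<close>

text \<open>The first diagonal Pade approximant of ln (1 + x); inverted, it also gives the bound on
  exp.\<close>

lemma ln_one_plus_ge:
  fixes x :: real
  assumes "0 \<le> x"
  shows "2 * x / (2 + x) \<le> ln (1 + x)"
proof -
  have "(\<lambda>x. ln (1 + x) - 2 * x / (2 + x)) 0 \<le> (\<lambda>x. ln (1 + x) - 2 * x / (2 + x)) x"
  proof (rule DERIV_nonneg_imp_nondecreasing[OF assms])
    fix y assume y: "0 \<le> y" "y \<le> x"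
    have "((\<lambda>x. ln (1 + x) - 2 * x / (2 + x)) has_real_derivative
        (1 / (1 + y) - (2 * (2 + y) - 2 * y) / ((2 + y) * (2 + y)))) (at y)"
      using y by (auto intro!: derivative_eq_intros)
    moreover have "1 / (1 + y) - (2 * (2 + y) - 2 * y) / ((2 + y) * (2 + y)) = y\<^sup>2 / ((1 + y) * (2 + y)\<^sup>2)"
      using y by (simp add: divide_simps) (simp add: power2_eq_square algebra_simps)
    ultimately show "\<exists>d. ((\<lambda>x. ln (1 + x) - 2 * x / (2 + x)) has_real_derivative d) (at y) \<and> 0 \<le> d"
      using y by (intro exI[of _ "y\<^sup>2 / ((1 + y) * (2 + y)\<^sup>2)"]) auto
  qed
  then show ?thesis by simp
qed

lemma ln_one_plus_le:
  fixes x :: real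
  assumes "0 \<le> x"
  shows "ln (1 + x) \<le> x * (2 + x) / (2 * (1 + x))"
proof -
  have "(\<lambda>x. x * (2 + x) / (2 * (1 + x)) - ln (1 + x)) 0 \<le> (\<lambda>x. x * (2 + x) / (2 * (1 + x)) - ln (1 + x)) x"
  proof (rule DERIV_nonneg_imp_nondecreasing[OF assms])
    fix y assume y: "0 \<le> y" "y \<le> x"
    have "((\<lambda>x. x * (2 + x) / (2 * (1 + x)) - ln (1 + x)) has_real_derivative
        (((2 + y) + y) * (2 * (1 + y)) - y * (2 + y) * 2) / ((2 * (1 + y)) * (2 * (1 + y))) - 1 / (1 + y)) (at y)"
      using y by (auto intro!: derivative_eq_intros)
    moreover have "(((2 + y) + y) * (2 * (1 + y)) - y * (2 + y) * 2) / ((2 * (1 + y)) * (2 * (1 + y))) - 1 / (1 + y)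
        = y\<^sup>2 / (2 * (1 + y)\<^sup>2)"
      using y by (simp add: divide_simps) (simp add: power2_eq_square algebra_simps)
    ultimately show "\<exists>d. ((\<lambda>x. x * (2 + x) / (2 * (1 + x)) - ln (1 + x)) has_real_derivative d) (at y) \<and> 0 \<le> d"
      using y by (intro exI[of _ "y\<^sup>2 / (2 * (1 + y)\<^sup>2)"]) auto
  qed
  then show ?thesis by simp
qed

lemma ln_one_minus_bounds:
  fixes y :: real
  assumes "0 \<le> y" "y < 1"
  shows "ln (1 - y) \<le> - 2 * y / (2 - y)" "- y * (2 - y) / (2 * (1 - y)) \<le> ln (1 - y)"
proof -
  define u where "u = y / (1 - y)"
  have u: "0 \<le> u" using assms by (simp add: u_def)
  have 1: "1 - y = 1 / (1 + u)" using assms by (simp add: u_def field_simps)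
  have ln: "ln (1 - y) = - ln (1 + u)" unfolding 1 using u by (simp add: ln_div)
  have "2 * u / (2 + u) = 2 * y / (2 - y)" using assms by (simp add: u_def divide_simps)
  then show "ln (1 - y) \<le> - 2 * y / (2 - y)" using ln_one_plus_ge[OF u] ln by simp
  have "u * (2 + u) / (2 * (1 + u)) = y * (2 - y) / (2 * (1 - y))"
    using assms by (simp add: u_def divide_simps)
  then show "- y * (2 - y) / (2 * (1 - y)) \<le> ln (1 - y)" using ln_one_plus_le[OF u] ln by simp
qed

lemma exp_le_pade:
  fixes x :: real
  assumes "0 \<le> x" "x < 2"
  shows "exp x \<le> (2 + x) / (2 - x)"
proof -
  define u where "u = 2 * x / (2 - x)"
  have u: "0 \<le> u" using assms by (simp add: u_def)
  have "2 * u / (2 + u) = x" using assms by (simp add: u_def divide_simps)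
  then have "x \<le> ln (1 + u)" using ln_one_plus_ge[OF u] by simp
  then have "exp x \<le> 1 + u" using u by (simp add: ln_ge_iff)
  also have "1 + u = (2 + x) / (2 - x)" using assms by (simp add: u_def divide_simps)
  finally show ?thesis .
qed

text \<open>The upper Becker-Stark inequality. Up to pi/3, which suffices for pi / n, the derivative
  is controlled by cos y >= 1/2 and pi^2 \<le> 10 alone.\<close>

lemma tan_le_becker_stark:
  fixes x :: real
  assumes "0 \<le> x" "x \<le> pi/3"
  shows "(pi\<^sup>2 - 4 * x\<^sup>2) * tan x \<le> pi\<^sup>2 * x"
proof -
  have p: "pi\<^sup>2 \<le> 10"
    using power_mono[of pi "315/100" 2] pi_bounds by (simp add: power2_eq_square)
  define q where "q = (\<lambda>x. pi\<^sup>2 * (x * cos x) - (pi\<^sup>2 - 4 * x\<^sup>2) * sin x)"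
  have "q 0 \<le> q x"
  proof (rule DERIV_nonneg_imp_nondecreasing[OF assms(1)])
    fix y assume y: "0 \<le> y" "y \<le> x"
    have "(q has_real_derivative (y * (4 * y * cos y - (pi\<^sup>2 - 8) * sin y))) (at y)"
      unfolding q_def by (auto intro!: derivative_eq_intros simp: power2_eq_square algebra_simps)
    moreover have "0 \<le> y * (4 * y * cos y - (pi\<^sup>2 - 8) * sin y)"
    proof -
      have "cos (pi/3) \<le> cos y" using y assms by (intro cos_monotone_0_pi_le) auto
      then have "4 * y * (1/2) \<le> 4 * y * cos y" using y by (intro mult_left_mono) (auto simp: cos_60)
      moreover have "sin y \<le> y" "0 \<le> sin y" using y assms pi_gt_zero by (auto intro!: sin_x_le_x sin_ge_zero)
      then have "(pi\<^sup>2 - 8) * sin y \<le> 2 * y" using p by (intro mult_mono) auto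
      ultimately show ?thesis using y by simp
    qed
    ultimately show "\<exists>d. (q has_real_derivative d) (at y) \<and> 0 \<le> d" by blast
  qed
  moreover have "0 < cos x" by (rule cos_gt_zero_pi; use assms pi_gt_zero in linarith)
  ultimately show ?thesis by (simp add: q_def tan_def field_simps)
qed

definition inv_phi0 :: "nat \<Rightarrow> real" where
  "inv_phi0 n = n * tan (pi / n) * (1 - 2 / n) powr (n / 2)"

lemma phi0_eq: "phi0 n = 1 / inv_phi0 n"
  by (simp add: phi0_def inv_phi0_def)

lemma tan_pi_div_pos: "3 \<le> n \<Longrightarrow> 0 < tan (pi / real n)"
  by (intro tan_gt_zero) (auto simp: field_simps)

lemma regular_B_pos: "3 \<le> n \<Longrightarrow> 0 < inv_phi0 n"
  using tan_pi_div_pos[of n] by (auto simp: inv_phi0_def field_simps intro!: mult_pos_pos)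

lemma regular_B_sq:
  assumes "3 \<le> n"
  shows "(inv_phi0 n)\<^sup>2 = (n * tan (pi / n))\<^sup>2 * (1 - 2 / n) ^ n"
proof -
  have p: "0 < 1 - 2 / real n" using assms by (simp add: field_simps)
  have "((1 - 2 / real n) powr (n / 2))\<^sup>2 = (1 - 2 / real n) powr (n / 2 + n / 2)"
    by (simp only: power2_eq_square powr_add)
  also have "\<dots> = (1 - 2 / real n) ^ n" using p by (simp add: powr_realpow)
  finally show ?thesis by (simp add: inv_phi0_def power_mult_distrib)
qed

text \<open>The bound pi / e is the limit for n to infinity. With y = 2 / n it splits into n tan (pi
  / n) \<le> pi / (1 - y^2), by Becker-Stark, and e (1 - y)^(1/y) \<le> 1 - y^2, by the logarithm
  bounds; the factors 1 - y^2 cancel.\<close>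

lemma regular_B_le:
  assumes n: "3 \<le> n"
  shows "inv_phi0 n \<le> pi / exp 1"
proof -
  define y where "y = 2 / real n"
  have y: "0 < y" "y \<le> 2/3" using n by (auto simp: y_def field_simps)
  have x: "pi / n = pi * y / 2" by (simp add: y_def)
  have "(pi\<^sup>2 - 4 * (pi / n)\<^sup>2) * tan (pi / n) \<le> pi\<^sup>2 * (pi / n)"
    by (rule tan_le_becker_stark) (use n in \<open>auto simp: field_simps\<close>)
  then have "pi\<^sup>2 * ((1 - y\<^sup>2) * tan (pi / n)) \<le> pi\<^sup>2 * (pi / n)"
    unfolding x by (simp add: power2_eq_square algebra_simps)
  then have "(1 - y\<^sup>2) * tan (pi / n) \<le> pi / n" by (rule mult_left_le_imp_le) simp
  then have t: "(1 - y\<^sup>2) * (n * tan (pi / n)) \<le> pi" using n by (simp add: field_simps)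
  have "(1 - y) * ln (1 - y) + y \<le> (1 - y) * (- 2 * y / (2 - y)) + y"
    using ln_one_minus_bounds(1)[of y] y by (intro add_right_mono mult_left_mono) auto
  also have "\<dots> = y * (y / (2 - y))" using y by (simp add: field_simps)
  also have "\<dots> \<le> y * (2 * y / (2 + y))"
  proof (rule mult_left_mono)
    have "y * (2 + y) \<le> 2 * y * (2 - y)" using y by (simp add: algebra_simps)
    then show "y / (2 - y) \<le> 2 * y / (2 + y)" using y by (simp add: frac_le_eq divide_simps)
  qed (use y in auto)
  also have "\<dots> \<le> y * ln (1 + y)" using ln_one_plus_ge[of y] y by (intro mult_left_mono) auto
  finally have "y * (ln (1 - y) / y + 1) \<le> y * (ln (1 - y) + ln (1 + y))"
    using y by (simp add: algebra_simps)
  then have "ln (1 - y) / y + 1 \<le> ln (1 - y) + ln (1 + y)" using y by simp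
  then have "exp (ln (1 - y) / y + 1) \<le> exp (ln (1 - y) + ln (1 + y))" by simp
  also have "\<dots> = 1 - y\<^sup>2" using y by (simp add: exp_add power2_eq_square algebra_simps)
  finally have e: "exp (ln (1 - y) / y) * exp 1 \<le> 1 - y\<^sup>2" by (simp add: exp_add)
  have pw: "(1 - 2 / n) powr (n / 2) = exp (ln (1 - y) / y)"
    using y n by (simp add: powr_def y_def)
  have "inv_phi0 n * exp 1 = (n * tan (pi / n)) * (exp (ln (1 - y) / y) * exp 1)"
    unfolding inv_phi0_def pw by simp
  also have "\<dots> \<le> (n * tan (pi / n)) * (1 - y\<^sup>2)"
    using e tan_pi_div_pos[OF n] by (intro mult_left_mono) auto
  also have "\<dots> \<le> pi" using t by (simp add: mult.commute)
  finally show ?thesis by (simp add: field_simps)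
qed

text \<open>The value is exactly 1 for n = 3 and n = 4, so a margin exists only from 5 on, and it is
  small at first. The crude estimate n tan (pi / n) >= pi is used from n = 10; smaller n are
  computed one by one.\<close>

lemma regular_B_gt:
  assumes n: "5 \<le> n"
  shows "1 < inv_phi0 n"
proof -
  have n3: "3 \<le> n" using n by simp
  have sq: "1 < inv_phi0 n" if "1 < (inv_phi0 n)\<^sup>2"
    using that regular_B_pos[OF n3] power2_less_imp_less[of 1 "inv_phi0 n"] by simp
  have cub: "1 < (inv_phi0 n)\<^sup>2"
    if x: "0 < x" "x \<le> pi / n" and le: "1 < (real n * (x + x^3/3))\<^sup>2 * (1 - 2 / n) ^ n" for x
  proof -
    have "x + x^3/3 \<le> pi / n + (pi / n)^3/3" using x by (intro add_mono divide_right_mono power_mono) auto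
    also have "\<dots> \<le> tan (pi / n)" using n by (intro tan_add_cubic_le) (auto simp: field_simps)
    finally have "(real n * (x + x^3/3))\<^sup>2 \<le> (n * tan (pi / n))\<^sup>2"
      using x by (intro power_mono mult_left_mono mult_nonneg_nonneg add_nonneg_nonneg) auto
    then have "(real n * (x + x^3/3))\<^sup>2 * (1 - 2 / n) ^ n \<le> (n * tan (pi / n))\<^sup>2 * (1 - 2 / n) ^ n"
      using n by (intro mult_right_mono) (auto simp: field_simps)
    with le show ?thesis unfolding regular_B_sq[OF n3] by linarith
  qed
  consider "n = 5" | "n = 6" | "n = 7" | "n = 8" | "n = 9" | "10 \<le> n" using n by linarith
  then show ?thesis
  proof cases
    case 1
    \<comment> \<open>At pi/5 the cubic bound for tan is too weak; applied at pi/10 and then doubled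
      it suffices.\<close>
    define h where "h = tan (pi/10)"
    have "314/1000 + (314/1000)^3/3 \<le> pi/10 + (pi/10)^3/3"
      using pi_bounds by (intro add_mono divide_right_mono power_mono) auto
    also have "\<dots> \<le> h" unfolding h_def by (rule tan_add_cubic_le) auto
    finally have "314/1000 + (314/1000)^3/3 \<le> h" .
    moreover have "324/1000 < (314/1000::real) + (314/1000)^3/3" by (simp add: power3_eq_cube)
    ultimately have h: "324/1000 < h" by linarith
    have "tan (pi/10) < tan (pi/4)" by (rule tan_monotone) auto
    then have h1: "h < 1" by (simp add: h_def tan_45)
    have c: "cos (pi/10) \<noteq> 0" "cos (pi/5) \<noteq> 0"
      using cos_gt_zero_pi[of "pi/10"] cos_gt_zero_pi[of "pi/5"] by auto
    have T: "tan (pi/5) = 2 * h / (1 - h\<^sup>2)" using tan_double[of "pi/10"] c by (simp add: h_def)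
    have h2: "0 < 1 - h\<^sup>2" "(324/1000)\<^sup>2 \<le> h\<^sup>2"
      using h h1 power_strict_mono[of h 1 2] by (auto intro!: power_mono)
    have "72/100 * (1 - h\<^sup>2) \<le> 72/100 * (1 - (324/1000)\<^sup>2)" using h2 by simp
    also have "\<dots> \<le> 2 * h" using h by (simp add: power2_eq_square)
    finally have "72/100 \<le> tan (pi/5)" unfolding T using h2 by (simp add: le_divide_eq)
    then have "(72/100)\<^sup>2 \<le> (tan (pi/5))\<^sup>2" by (intro power_mono) auto
    moreover have "(inv_phi0 n)\<^sup>2 = 25 * (243/3125) * (tan (pi/5))\<^sup>2"
      unfolding regular_B_sq[OF n3] using 1 by (simp add: power_mult_distrib power_divide)
    ultimately show ?thesis by (intro sq) (simp add: power2_eq_square)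
  next
    case 2
    have "(inv_phi0 n)\<^sup>2 = 36 * (1/3) * (64/729)"
      unfolding regular_B_sq[OF n3] using 2 by (simp add: power_mult_distrib power_divide tan_30)
    then show ?thesis by (intro sq) simp
  next
    case 3
    show ?thesis by (rule sq, rule cub[of "314/700"]) (use 3 pi_bounds in \<open>auto simp: field_simps power2_eq_square power3_eq_cube power_divide\<close>)
  next
    case 4
    show ?thesis by (rule sq, rule cub[of "314/800"]) (use 4 pi_bounds in \<open>auto simp: field_simps power2_eq_square power3_eq_cube power_divide\<close>)
  next
    case 5
    show ?thesis by (rule sq, rule cub[of "314/900"]) (use 5 pi_bounds in \<open>auto simp: field_simps power2_eq_square power3_eq_cube power_divide\<close>)
  next
    case 6
    define y where "y = 2 / real n"
    have y: "0 < y" "y \<le> 1/5" using 6 by (auto simp: y_def field_simps)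
    have pw: "(1 - 2 / n) powr (n / 2) = exp (ln (1 - y) / y)"
      using y n by (simp add: powr_def y_def)
    \<comment> \<open>The number 9/8 is the value of (2 - y) / (2 (1 - y)) at the largest y,
      1/5.\<close>
    have "- 9/8 \<le> - (2 - y) / (2 * (1 - y))" using y by (simp add: divide_simps)
    also have "\<dots> = (- y * (2 - y) / (2 * (1 - y))) / y" using y by (simp add: field_simps)
    also have "\<dots> \<le> ln (1 - y) / y" using ln_one_minus_bounds(2)[of y] y by (intro divide_right_mono) auto
    finally have "exp (- 9/8) \<le> (1 - 2 / n) powr (n / 2)" unfolding pw by simp
    moreover have "1 < pi * exp (- 9/8)"
    proof -
      \<comment> \<open>The Pade bound is sharp only for small arguments, so 9/8 is split into four
        equal parts.\<close>
      have "exp (9/32) \<le> (2 + 9/32) / (2 - 9/32 :: real)" by (rule exp_le_pade) auto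
      then have "exp (9/32) ^ 4 \<le> ((2 + 9/32) / (2 - 9/32 :: real)) ^ 4" by (rule power_mono) simp
      also have "\<dots> < 314/100" by (simp add: power_divide)
      also have "\<dots> < pi" by (rule pi_bounds)
      finally have "exp (9/8) < pi" by (simp add: exp_of_nat_mult[symmetric])
      then show ?thesis by (simp add: exp_minus field_simps)
    qed
    moreover have "pi \<le> n * tan (pi / n)"
    proof -
      have "pi / n \<le> tan (pi / n)" using n by (intro tan_ge_self) (auto simp: field_simps)
      then show ?thesis using n by (simp add: field_simps)
    qed
    moreover have "0 \<le> n * tan (pi / n)" using tan_pi_div_pos[OF n3] by simp
    ultimately have "1 < pi * exp (- 9/8)" "pi * exp (- 9/8) \<le> n * tan (pi / n) * (1 - 2 / n) powr (n / 2)"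
      by (auto intro!: mult_mono)
    then show ?thesis unfolding inv_phi0_def by linarith
  qed
qed

lemma regular_B_3_4: "inv_phi0 3 = 1" "inv_phi0 4 = 1"
proof -
  have "(inv_phi0 3)\<^sup>2 = 1" "(inv_phi0 4)\<^sup>2 = 1"
    by (simp_all add: regular_B_sq tan_60 tan_45 power_mult_distrib power_divide)
  then show "inv_phi0 3 = 1" "inv_phi0 4 = 1"
    using regular_B_pos[of 3] regular_B_pos[of 4] by (auto simp: power2_eq_1_iff)
qed

lemma regular_B_ge: "3 \<le> n \<Longrightarrow> 1 \<le> inv_phi0 n"
proof -
  assume "3 \<le> n"
  then consider "n = 3" | "n = 4" | "5 \<le> n" by linarith
  then show ?thesis using regular_B_gt[of n] regular_B_3_4 by cases auto
qed

lemma phi0_bounds: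
  assumes "3 \<le> n"
  shows "0 < phi0 n" "phi0 n \<le> 1" "exp 1 / pi \<le> phi0 n"
proof -
  show "0 < phi0 n" "phi0 n \<le> 1" using regular_B_pos[OF assms] regular_B_ge[OF assms] by (auto simp: phi0_eq)
  show "exp 1 / pi \<le> phi0 n" using regular_B_le[OF assms] regular_B_pos[OF assms]
    by (simp add: phi0_eq field_simps)
qed

section \<open>Cyclic polygons\<close>

text \<open>The equality case of the inequality of arithmetic and geometric means: the non-negative
  numbers z - 1 - ln z with z = y i / m add up to 0.\<close>

lemma prod_max_imp_equal:
  fixes y :: "'a \<Rightarrow> real" and m :: real
  assumes I: "finite I" "\<And>i. i \<in> I \<Longrightarrow> 0 < y i" and m: "0 < m" "sum y I = card I * m" "prod y I = m ^ card I" and i: "i \<in> I"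
  shows "y i = m"
proof -
  define g where "g = (\<lambda>i. (y i / m - 1) - ln (y i / m))"
  have g0: "0 \<le> g j" if "j \<in> I" for j using ln_le_minus_one[of "y j / m"] I that m by (simp add: g_def)
  have nz: "y j \<noteq> 0" if "j \<in> I" for j using I(2)[OF that] by simp
  then have "(\<Sum>j\<in>I. ln (y j / m)) = ln (\<Prod>j\<in>I. y j / m)" using I m by (subst ln_prod) auto
  also have "(\<Prod>j\<in>I. y j / m) = 1" using m by (simp add: prod_dividef)
  finally have "sum g I = 0" using m by (simp add: g_def sum_subtractf flip: sum_divide_distrib)
  then have "g i = 0" using sum_nonneg_eq_0_iff[of I g] I g0 i by auto
  then have "ln (y i / m) = y i / m - 1" by (simp add: g_def)
  then have "y i / m = 1" using ln_eq_minus_one[of "y i / m"] I(2)[OF i] m(1) by simp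
  then show ?thesis using m by simp
qed

section \<open>The constants of a cyclic polygon as functions of its angles\<close>

definition slack_prod :: "nat \<Rightarrow> (nat \<Rightarrow> real) \<Rightarrow> real" where
  "slack_prod n t = (\<Prod>i<n. slack {..<n} t i / sine_sum {..<n} t)"

text \<open>The quotient of perimeter and pseudo-perimeter.\<close>

definition perimeter_quotient :: "nat \<Rightarrow> (nat \<Rightarrow> real) \<Rightarrow> real" where
  "perimeter_quotient n t = (1 - 2 / real n) / root n (slack_prod n t)"

lemma slack_prod_pos: "3 \<le> n \<Longrightarrow> proper_angles {..<n} t \<Longrightarrow> 0 < slack_prod n t"
  unfolding slack_prod_def
  by (intro prod_pos divide_pos_pos sine_sum_pos) (auto simp: proper_angles_def)

lemma sum_slack_div:
  assumes n: "3 \<le> n" and a: "proper_angles {..<n} t"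
  shows "(\<Sum>i<n. slack {..<n} t i / sine_sum {..<n} t) = real n * (1 - 2 / real n)"
proof -
  have "0 < sine_sum {..<n} t" by (rule sine_sum_pos[OF a]) (use n in \<open>auto simp: lessThan_empty_iff\<close>)
  then show ?thesis using sum_slack[of "{..<n}" t] n
    unfolding sum_divide_distrib[symmetric] by (simp add: right_diff_distrib)
qed

lemma regularity_ge:
  assumes n: "3 \<le> n" and a: "proper_angles {..<n} t"
  shows "1 \<le> perimeter_quotient n t"
proof -
  have I: "finite {..<n}" "{..<n} \<noteq> {}" using n by (auto simp: lessThan_empty_iff)
  have \<sigma>: "0 < sine_sum {..<n} t" by (rule sine_sum_pos[OF a I(2)])
  have "slack_prod n t powr (1 / card {..<n}) \<le> (\<Sum>i<n. slack {..<n} t i / sine_sum {..<n} t / card {..<n})"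
    unfolding slack_prod_def using a \<sigma> by (intro arith_geom_mean I) (auto simp: proper_angles_def less_imp_le)
  also have "\<dots> = (\<Sum>i<n. slack {..<n} t i / sine_sum {..<n} t) / n"
    by (simp add: sum_divide_distrib)
  also have "\<dots> = 1 - 2 / real n" unfolding sum_slack_div[OF n a] using n by simp
  finally have "root n (slack_prod n t) \<le> 1 - 2 / real n"
    using slack_prod_pos[OF n a] n by (simp add: root_powr_inverse)
  then show ?thesis using slack_prod_pos[OF n a] n by (simp add: perimeter_quotient_def le_divide_eq)
qed

lemma regularity_eq_1:
  assumes n: "3 \<le> n" and pos: "\<And>i. i < n \<Longrightarrow> 0 < t i" and s: "sum t {..<n} = pi" and r: "perimeter_quotient n t = 1"
    and i: "i < n"
  shows "t i = pi / n"
proof -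
  have a: "proper_angles {..<n} t" using n pos s by (intro adm_pos) auto
  have \<sigma>: "0 < sine_sum {..<n} t" using n by (intro sine_sum_pos[OF a]) (auto simp: lessThan_empty_iff)
  have S: "0 < slack_prod n t" by (rule slack_prod_pos[OF n a])
  have "root n (slack_prod n t) = 1 - 2 / real n" using r S n by (simp add: perimeter_quotient_def field_simps)
  then have SP: "slack_prod n t = (1 - 2 / real n) ^ n" using real_root_pow_pos2[of n "slack_prod n t"] S n by simp
  have eq: "slack {..<n} t j / sine_sum {..<n} t = 1 - 2 / real n" if "j < n" for j
  proof (rule prod_max_imp_equal[of "{..<n}" "\<lambda>j. slack {..<n} t j / sine_sum {..<n} t"])
    show "(\<Sum>j<n. slack {..<n} t j / sine_sum {..<n} t) = real (card {..<n}) * (1 - 2 / real n)"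
      using sum_slack_div[OF n a] by simp
    show "(\<Prod>j<n. slack {..<n} t j / sine_sum {..<n} t) = (1 - 2 / real n) ^ card {..<n}"
      using SP by (simp add: slack_prod_def)
    show "0 < slack {..<n} t i / sine_sum {..<n} t" if "i \<in> {..<n}" for i
      using a \<sigma> that by (simp add: proper_angles_def)
    show "0 < 1 - 2 / real n" using n by (simp add: field_simps)
  qed (use that in auto)
  have sn: "sin (t j) = sin (t k)" if "j < n" "k < n" for j k
  proof -
    have "slack {..<n} t j = slack {..<n} t k" using eq[OF that(1)] eq[OF that(2)] \<sigma> by (simp add: field_simps)
    then show ?thesis by (simp add: slack_def)
  qed
  \<comment> \<open>Equal sines leave the possibility of supplementary angles; a third positive
    angle keeps t j + t k below pi and excludes it.\<close>
  have tt: "t j = t k" if jk: "j < n" "k < n" for j k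
  proof (rule ccontr)
    assume ne: "t j \<noteq> t k"
    then have "j \<noteq> k" by auto
    have "{..<n} \<noteq> {j, k}" 
    proof
      assume "{..<n} = {j, k}"
      then have "card {..<n} \<le> 2" by (metis card_2_iff \<open>j \<noteq> k\<close> order_refl)
      then show False using n by simp
    qed
    then have ne': "{..<n} - {j} - {k} \<noteq> {}" using jk by auto
    have "sum t {..<n} = t j + sum t ({..<n} - {j})" using jk by (intro sum.remove) auto
    also have "sum t ({..<n} - {j}) = t k + sum t ({..<n} - {j} - {k})" using jk \<open>j \<noteq> k\<close> by (intro sum.remove) auto
    finally have "t j + (t k + sum t ({..<n} - {j} - {k})) = pi" using s by simp
    moreover have "0 < sum t ({..<n} - {j} - {k})" using ne' pos by (intro sum_pos) auto
    ultimately have lt: "t j + t k < pi" by linarith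
    have "sin ((t j - t k)/2) * cos ((t j + t k)/2) = 0"
      using sin_diff_sin[of "t j" "t k"] sn[OF jk] by simp
    moreover have "0 < cos ((t j + t k)/2)"
    proof (rule cos_gt_zero_pi)
      have "0 < (t j + t k)/2" using pos jk by (simp add: add_pos_pos)
      then show "- (pi/2) < (t j + t k)/2" using pi_half_gt_zero by linarith
    qed (use lt in simp)
    ultimately have 0: "sin ((t j - t k)/2) = 0" by simp
    have "\<bar>t j - t k\<bar> < pi" using lt pos[OF jk(1)] pos[OF jk(2)] by linarith
    then have "- pi < (t j - t k)/2" "(t j - t k)/2 < pi" using pi_gt_zero unfolding abs_less_iff by simp_all
    then show False using sin_eq_0_pi[OF _ _ 0] ne by simp
  qed
  have "t i = pi / card {..<n}"
  proof (rule regular_of_equal)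
    show "t a = t b" if "a \<in> {..<n}" "b \<in> {..<n}" for a b using that by (intro tt) auto
  qed (use s i in simp_all)
  then show ?thesis by simp
qed

lemma regular_slack_prod:
  assumes n: "3 \<le> n" and t: "\<And>i. i < n \<Longrightarrow> t i = pi / n"
  shows "slack_prod n t = (1 - 2 / real n) ^ n" "perimeter_quotient n t = 1"
proof -
  have s: "sin (pi / n) > 0" using n by (intro sin_gt_zero) (auto simp: field_simps)
  have r: "sine_sum {..<n} t = n * sin (pi / n)" "\<And>i. i < n \<Longrightarrow> slack {..<n} t i = (real n - 2) * sin (pi / n)"
    using regular_values(1,3)[of "{..<n}" t] n t by auto
  have "slack_prod n t = (\<Prod>i<n. 1 - 2 / real n)"
    unfolding slack_prod_def using r s n by (intro prod.cong) (auto simp: field_simps)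
  then show S: "slack_prod n t = (1 - 2 / real n) ^ n" by simp
  have p: "0 < 1 - 2 / real n" using n by (simp add: field_simps)
  then have "root n (slack_prod n t) = 1 - 2 / real n" unfolding S using n by (simp add: real_root_power_cancel)
  then show "perimeter_quotient n t = 1" unfolding perimeter_quotient_def using p by (metis divide_self less_irrefl)
qed

text \<open>Makes sense for angle lists with zeros too, to which no polygon with n distinct vertices
  corresponds; a continuous path may start at such a list.\<close>

definition tau_angle :: "nat \<Rightarrow> (nat \<Rightarrow> real) \<Rightarrow> real" where
  "tau_angle n t = inv_phi0 n * area_sum {..<n} t / ((sine_sum {..<n} t)\<^sup>2 * sqrt (slack_prod n t))"

context
  fixes n v c r \<psi> s p
  assumes circ: "circular n v c r \<psi> s p"
begin


lemma circ_perimeter: "perimeter n v = 2 * r * sine_sum {..<n} (half_angle p)"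
  using circ_side_length[OF circ] by (simp add: perimeter_def sine_sum_def sum_distrib_left)

lemma circ_sigma_pos: "0 < sine_sum {..<n} (half_angle p)"
  using circ_basic(1)[OF circ] by (intro sine_sum_pos circ_half_angle_adm[OF circ]) (auto simp: lessThan_empty_iff)

lemma circ_side_prod: "side_prod n v = slack_prod n (half_angle p)"
  unfolding side_prod_def slack_prod_def
proof (intro prod.cong refl)
  fix i assume "i \<in> {..<n}"
  then show "1 - 2 * side_length n v i / perimeter n v = slack {..<n} (half_angle p) i / sine_sum {..<n} (half_angle p)"
    using circ_side_length[OF circ, of i] circ_sigma_pos circ_basic(3)[OF circ]
    unfolding circ_perimeter slack_def by (simp add: field_simps)
qed

lemma circ_prod_pos: "0 < slack_prod n (half_angle p)"
  using slack_prod_pos[OF circ_basic(1)[OF circ] circ_half_angle_adm[OF circ]] .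

lemma circ_phi: "phi n v = area_sum {..<n} (half_angle p) / ((sine_sum {..<n} (half_angle p))\<^sup>2 * sqrt (slack_prod n (half_angle p)))"
  unfolding phi_def P_const_def circ_side_prod circ_perimeter circ_area[OF circ]
  using circ_basic(3)[OF circ] by (simp add: power_mult_distrib)

lemma circ_tau: "tau n v = tau_angle n (half_angle p)"
  unfolding tau_def circ_phi phi0_eq tau_angle_def by simp

lemma circ_regularity_ge: "1 \<le> perimeter_quotient n (half_angle p)"
  using regularity_ge[OF circ_basic(1)[OF circ] circ_half_angle_adm[OF circ]] .

lemma circ_pseudo_perimeter: "pseudo_perimeter n v = 2 * r * sine_sum {..<n} (half_angle p) / perimeter_quotient n (half_angle p)"
  unfolding pseudo_perimeter_def circ_side_prod circ_perimeter perimeter_quotient_def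
  using circ_basic(1)[OF circ] by (simp add: field_simps)

lemma circ_nu: "nu n v = perimeter_quotient n (half_angle p) powr (real n / 2 - 2)"
  unfolding nu_def circ_pseudo_perimeter circ_perimeter
  using circ_sigma_pos circ_basic(3)[OF circ] by simp

lemma circ_tau_regularity:
  "tau n v = n * tan (pi / n) * area_sum {..<n} (half_angle p) / (sine_sum {..<n} (half_angle p))\<^sup>2 * perimeter_quotient n (half_angle p) powr (real n / 2)"
proof -
  have n: "3 \<le> n" by (rule circ_basic(1)[OF circ])
  have S: "0 < slack_prod n (half_angle p)" by (rule circ_prod_pos)
  have R: "0 < root n (slack_prod n (half_angle p))" using S n by simp
  have "sqrt (slack_prod n (half_angle p)) = root n (slack_prod n (half_angle p)) powr (real n / 2)"
    using S n by (simp add: root_powr_inverse powr_powr powr_half_sqrt)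
  moreover have "perimeter_quotient n (half_angle p) powr (real n / 2) = (1 - 2 / real n) powr (real n / 2) / root n (slack_prod n (half_angle p)) powr (real n / 2)"
    unfolding perimeter_quotient_def by (rule powr_divide)
  ultimately show ?thesis unfolding circ_tau tau_angle_def inv_phi0_def by simp
qed

text \<open>The exponents of \<tau> and \<nu> differ by 2, which is the square of the
  pseudo-perimeter. The identity covers all n >= 3, including the exceptional small ones, and part
  (iii) is immediate from it.\<close>

lemma circ_deficit: "pseudo_deficit n v * nu n v = (pseudo_perimeter n v)\<^sup>2 * (nu n v - tau n v)"
proof -
  define q where "q = perimeter_quotient n (half_angle p)"
  have q: "0 < q" using circ_regularity_ge by (simp add: q_def)
  have "q powr (real n / 2) = q powr (real n / 2 - 2) * q\<^sup>2"
    using q by (simp add: powr_diff powr_numeral)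
  then have "tau n v = n * tan (pi / n) * area_sum {..<n} (half_angle p) / (sine_sum {..<n} (half_angle p))\<^sup>2 * (nu n v * q\<^sup>2)"
    unfolding circ_tau_regularity circ_nu q_def by simp
  then have "(pseudo_perimeter n v)\<^sup>2 * tau n v = 4 * (n * tan (pi / n)) * area n v * nu n v"
    unfolding circ_pseudo_perimeter circ_area[OF circ] q_def[symmetric]
    using q circ_sigma_pos by (simp add: power_divide power_mult_distrib)
  then show ?thesis unfolding pseudo_deficit_def by (simp add: algebra_simps)
qed

lemma circ_deficit_sign:
  "0 \<le> pseudo_deficit n v \<longleftrightarrow> tau n v \<le> nu n v" "pseudo_deficit n v = 0 \<longleftrightarrow> tau n v = nu n v"
proof -
  have "0 < perimeter_quotient n (half_angle p)" using circ_regularity_ge by simp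
  then have nu: "0 < nu n v" unfolding circ_nu by simp
  have P: "0 < (pseudo_perimeter n v)\<^sup>2"
    unfolding circ_pseudo_perimeter using circ_sigma_pos circ_basic(3)[OF circ] circ_regularity_ge by simp
  have "0 \<le> pseudo_deficit n v \<longleftrightarrow> 0 \<le> pseudo_deficit n v * nu n v" using nu by (simp add: zero_le_mult_iff)
  also have "\<dots> \<longleftrightarrow> tau n v \<le> nu n v" unfolding circ_deficit using P by (simp add: zero_le_mult_iff)
  finally show "0 \<le> pseudo_deficit n v \<longleftrightarrow> tau n v \<le> nu n v" .
  have "pseudo_deficit n v = 0 \<longleftrightarrow> pseudo_deficit n v * nu n v = 0" using nu by simp
  also have "\<dots> \<longleftrightarrow> tau n v = nu n v" unfolding circ_deficit using P by auto
  finally show "pseudo_deficit n v = 0 \<longleftrightarrow> tau n v = nu n v" .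
qed

lemma circ_regular_iff: "regular_polygon n v \<longleftrightarrow> (\<forall>i<n. half_angle p i = pi / n)"
proof
  assume "\<forall>i<n. half_angle p i = pi / n"
  then show "regular_polygon n v" by (intro circ_regular[OF circ]) simp
next
  have n: "3 \<le> n" by (rule circ_basic(1)[OF circ])
  have a: "proper_angles {..<n} (half_angle p)" by (rule circ_half_angle_adm[OF circ])
  assume reg: "regular_polygon n v"
  have sn: "sin (half_angle p i) = sin (half_angle p j)" if "i < n" "j < n" for i j
  proof -
    have "side_length n v i = side_length n v j" using reg that unfolding regular_polygon_def by blast
    then show ?thesis using circ_side_length[OF circ that(1)] circ_side_length[OF circ that(2)] circ_basic(3)[OF circ] by simp
  qed
  have sl: "slack {..<n} (half_angle p) i = (sine_sum {..<n} (half_angle p) * (1 - 2 / real n))" if "i < n" for i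
  proof -
    have "sine_sum {..<n} (half_angle p) = (\<Sum>j<n. sin (half_angle p i))" 
      unfolding sine_sum_def by (rule sum.cong[OF refl]) (rule sn, simp, rule that)
    then have "sine_sum {..<n} (half_angle p) = n * sin (half_angle p i)" by simp
    then show ?thesis using n by (simp add: slack_def field_simps)
  qed
  have "slack_prod n (half_angle p) = (\<Prod>i<n. 1 - 2 / real n)"
    unfolding slack_prod_def using sl circ_sigma_pos by (intro prod.cong) auto
  then have S: "slack_prod n (half_angle p) = (1 - 2 / real n) ^ n" by simp
  have pos: "0 < 1 - 2 / real n" using n by (simp add: field_simps)
  then have "root n (slack_prod n (half_angle p)) = 1 - 2 / real n" unfolding S using n by (simp add: real_root_power_cancel)
  then have "perimeter_quotient n (half_angle p) = 1" unfolding perimeter_quotient_def using pos by (metis divide_self less_irrefl)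
  then show "\<forall>i<n. half_angle p i = pi / n"
    using regularity_eq_1[OF n circ_half_angle_pos[OF circ] circ_half_angle_sum[OF circ]] by blast
qed

lemma circ_regular_iff_regularity: "regular_polygon n v \<longleftrightarrow> perimeter_quotient n (half_angle p) = 1"
  unfolding circ_regular_iff
  using regular_slack_prod(2)[OF circ_basic(1)[OF circ], of "half_angle p"]
    regularity_eq_1[OF circ_basic(1)[OF circ] circ_half_angle_pos[OF circ] circ_half_angle_sum[OF circ]] by blast

lemma circ_regular_tau:
  assumes "regular_polygon n v"
  shows "tau n v = 1" "nu n v = 1"
proof -
  have n: "3 \<le> n" by (rule circ_basic(1)[OF circ])
  have q: "perimeter_quotient n (half_angle p) = 1" using assms circ_regular_iff_regularity by simp
  show "nu n v = 1" unfolding circ_nu q by simp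
  have t: "\<And>i. i \<in> {..<n} \<Longrightarrow> half_angle p i = pi / card {..<n}" using assms circ_regular_iff by simp
  have s: "sin (pi / n) > 0" and c: "cos (pi / n) > 0" using n
    by (auto intro!: sin_gt_zero cos_gt_zero_pi simp: field_simps intro: less_le_trans[of _ 0])
  have "sine_sum {..<n} (half_angle p) = n * sin (pi / n)" "area_sum {..<n} (half_angle p) = n * (sin (pi / n) * cos (pi / n))"
    using regular_values(1,2)[of "{..<n}" "half_angle p"] n t by auto
  then show "tau n v = 1" unfolding circ_tau_regularity q using s c n by (simp add: tan_def power2_eq_square)
qed

text \<open>With the n-th root q of the slack product, the deficit is a positive multiple of b
  \<sigma>^2 q^2 - A, while the ratio is (A / (\<sigma>^2 q^2))^n and its maximum is b^n.\<close>

lemma circ_pseudo_isoperimetric: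
  assumes n5: "5 \<le> n"
  shows "pseudo_isoperimetric n v"
proof -
  have n: "3 \<le> n" by (rule circ_basic(1)[OF circ])
  have a: "proper_angles {..<n} (half_angle p)" by (rule circ_half_angle_adm[OF circ])
  define S A b q where "S = slack_prod n (half_angle p)" and "A = area_sum {..<n} (half_angle p)"
    and "b = n * cos (pi / n) / ((real n - 2)\<^sup>2 * sin (pi / n))" and "q = root n S"
  have S: "0 < S" using circ_prod_pos by (simp add: S_def)
  have s: "sin (pi / n) > 0" and c: "cos (pi / n) > 0" using n
    by (auto intro!: sin_gt_zero cos_gt_zero_pi simp: field_simps intro: less_le_trans[of _ 0])
  have b: "0 < b" unfolding b_def using s c n by simp
  have A0: "0 \<le> A" unfolding A_def using a by (intro area_sum_nonneg) (auto simp: proper_angles_def)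
  have "(\<Prod>i<n. slack {..<n} (half_angle p) i) = (sine_sum {..<n} (half_angle p))^n * S"
    unfolding S_def slack_prod_def using circ_sigma_pos by (simp add: prod_dividef)
  also have "S = q ^ n" using S n by (simp add: q_def)
  finally have P: "(\<Prod>i<n. slack {..<n} (half_angle p) i)\<^sup>2 = ((sine_sum {..<n} (half_angle p))\<^sup>2 * q\<^sup>2) ^ n"
    by (simp add: power_mult_distrib flip: power_mult) (simp add: mult.commute)
  have q: "0 < q" using S n by (simp add: q_def)
  have Q: "0 < (sine_sum {..<n} (half_angle p))\<^sup>2 * q\<^sup>2" using q circ_sigma_pos by simp
  have rat: "area_ratio {..<n} (half_angle p) = (A / ((sine_sum {..<n} (half_angle p))\<^sup>2 * q\<^sup>2)) ^ n" unfolding area_ratio_def P A_def by (simp add: power_divide)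
  have mx: "regular_area_ratio n = b ^ n" by (simp add: regular_area_ratio_def b_def)
  have def: "pseudo_deficit n v = 4 * r\<^sup>2 * (n * tan (pi / n)) * (b * ((sine_sum {..<n} (half_angle p))\<^sup>2 * q\<^sup>2) - A)"
  proof -
    have "n * tan (pi / n) * b = (n / (real n - 2))\<^sup>2" unfolding b_def tan_def using s c n by (simp add: power2_eq_square)
    moreover have "pseudo_perimeter n v = 2 * r * sine_sum {..<n} (half_angle p) * (n / (real n - 2)) * q"
      unfolding pseudo_perimeter_def circ_side_prod circ_perimeter q_def S_def by simp
    then have "(pseudo_perimeter n v)\<^sup>2 = 4 * r\<^sup>2 * ((sine_sum {..<n} (half_angle p))\<^sup>2 * q\<^sup>2) * (n / (real n - 2))\<^sup>2"
      by (simp add: power_mult_distrib power_divide)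
    ultimately have "(pseudo_perimeter n v)\<^sup>2 = 4 * r\<^sup>2 * ((sine_sum {..<n} (half_angle p))\<^sup>2 * q\<^sup>2) * (n * tan (pi / n) * b)" by simp
    then show ?thesis unfolding pseudo_deficit_def circ_area[OF circ] A_def by (simp add: algebra_simps)
  qed
  have r: "0 < 4 * r\<^sup>2 * (n * tan (pi / n))" using circ_basic(3)[OF circ] tan_pi_div_pos[OF n] n by simp
  have "(A / ((sine_sum {..<n} (half_angle p))\<^sup>2 * q\<^sup>2)) ^ n \<le> b ^ n" using ratio_le_max[OF a] n5 rat mx by simp
  then have "A / ((sine_sum {..<n} (half_angle p))\<^sup>2 * q\<^sup>2) \<le> b" using b n by (metis power_le_imp_le_base less_imp_le Suc_pred n5 not_numeral_le_zero gr_zeroI)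
  then have "A \<le> b * ((sine_sum {..<n} (half_angle p))\<^sup>2 * q\<^sup>2)" using Q by (simp add: divide_le_eq)
  then have 1: "0 \<le> pseudo_deficit n v" unfolding def using r by simp
  have 2: "regular_polygon n v" if "pseudo_deficit n v = 0"
  proof -
    have "A = b * ((sine_sum {..<n} (half_angle p))\<^sup>2 * q\<^sup>2)" using that r unfolding def by (metis less_irrefl mult_eq_0_iff eq_iff_diff_eq_0)
    then have "A / ((sine_sum {..<n} (half_angle p))\<^sup>2 * q\<^sup>2) = b" using Q by (metis less_irrefl nonzero_mult_div_cancel_right)
    then have "area_ratio {..<n} (half_angle p) = regular_area_ratio (card {..<n})" using rat mx by simp
    then have "\<forall>i<n. half_angle p i = pi / n"
      using ratio_eq_max_regular[OF a _ _] n5 circ_half_angle_pos[OF circ] by auto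
    then show ?thesis using circ_regular_iff by simp
  qed
  have 3: "pseudo_deficit n v = 0" if "regular_polygon n v"
    using circ_regular_tau[OF that] circ_deficit_sign(2) by simp
  show ?thesis unfolding pseudo_isoperimetric_def using 1 2 3 by blast
qed

text \<open>Brahmagupta's formula with a zero fourth angle is Heron's formula, so
  \<open>P_const\<close> is the area and \<phi> = 1; and \<phi>0 is 1 for n = 3.\<close>

lemma circ_triangle_tau:
  assumes n: "n = 3"
  shows "tau n v = 1"
proof -
  have "half_angle p 0 + half_angle p 1 + half_angle p 2 + 0 = pi" using circ_half_angle_sum[OF circ] n by (simp add: eval_nat_numeral lessThan_Suc)
  from brahmagupta[OF this]
  have "(area_sum {..<n} (half_angle p))\<^sup>2 = sine_sum {..<n} (half_angle p) * (slack {..<n} (half_angle p) 0 * slack {..<n} (half_angle p) 1 * slack {..<n} (half_angle p) 2)"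
    unfolding n area_sum_def slack_def sine_sum_def by (simp add: eval_nat_numeral lessThan_Suc algebra_simps)
  moreover have "slack_prod n (half_angle p) = slack {..<n} (half_angle p) 0 * slack {..<n} (half_angle p) 1 * slack {..<n} (half_angle p) 2 / (sine_sum {..<n} (half_angle p))^3"
    unfolding slack_prod_def unfolding n by (simp add: eval_nat_numeral lessThan_Suc)
  ultimately have "slack_prod n (half_angle p) = (area_sum {..<n} (half_angle p))\<^sup>2 / (sine_sum {..<n} (half_angle p))^4"
    using circ_sigma_pos by (simp add: field_simps power_eq_if)
  also have "\<dots> = (area_sum {..<n} (half_angle p) / (sine_sum {..<n} (half_angle p))\<^sup>2)\<^sup>2" by (simp add: power_divide)
  finally have "sqrt (slack_prod n (half_angle p)) = \<bar>area_sum {..<n} (half_angle p) / (sine_sum {..<n} (half_angle p))\<^sup>2\<bar>" by simp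
  moreover have "0 \<le> area_sum {..<n} (half_angle p)"
    using circ_half_angle_adm[OF circ] by (intro area_sum_nonneg) (auto simp: proper_angles_def)
  ultimately have sq: "sqrt (slack_prod n (half_angle p)) = area_sum {..<n} (half_angle p) / (sine_sum {..<n} (half_angle p))\<^sup>2" by simp
  moreover have "0 < sqrt (slack_prod n (half_angle p))" using circ_prod_pos by simp
  ultimately have "0 < area_sum {..<n} (half_angle p)" using circ_sigma_pos by (simp add: zero_less_divide_iff)
  then show ?thesis unfolding circ_tau tau_angle_def sq using circ_sigma_pos regular_B_3_4 n by simp
qed

end

section \<open>A polygon with \<phi> at most 1 and \<tau> above 1\<close>

lemma circular_exists:
  assumes n: "3 \<le> n" and t: "\<And>i. i < n \<Longrightarrow> 0 < t i" "sum t {..<n} = pi"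
  obtains w c r \<psi> s p where "circular n w c r \<psi> s p" "half_angle p = t"
proof -
  define p where "p = (\<lambda>i. 2 * sum t {..<i})"
  define w where "w = (\<lambda>i. circle_pt 0 1 0 1 (p i))"
  have "circular n w 0 1 0 1 p" unfolding circular_def using n t by (simp add: p_def w_def)
  moreover have "half_angle p = t" by (simp add: half_angle_def p_def fun_eq_iff)
  ultimately show ?thesis by (rule that)
qed

text \<open>Along the straight path of angles from the degenerate square to the regular n-gon,
  \<tau> runs continuously from \<open>inv_phi0 n\<close> > 1 to 1. At an intermediate value, \<phi>
  = \<tau> / \<open>inv_phi0 n\<close> is below 1 although \<tau> exceeds 1.\<close>

lemma tau_gt_1_exists:
  assumes n: "5 \<le> n"
  obtains w where "cyclic_polygon n w" "phi n w \<le> 1" "1 < tau n w"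
proof -
  have n3: "3 \<le> n" using n by simp
  define a where "a = (\<lambda>i::nat. if i < 4 then pi/4 else 0)"
  define th where "th = (\<lambda>u i. (1 - u) * a i + u * (pi / n))"
  have suma: "sum a {..<n} = pi"
  proof -
    have "sum a {..<n} = (\<Sum>i\<in>{..<n} \<inter> {..<4}. pi/4)" unfolding a_def by (subst sum.inter_restrict) auto
    also have "{..<n} \<inter> {..<4} = {..<4::nat}" using n by auto
    finally show ?thesis by simp
  qed
  have sumth: "sum (th u) {..<n} = pi" for u
    using suma n by (simp add: th_def sum.distrib flip: sum_distrib_left) (simp add: algebra_simps)
  have thpos: "0 < th u i" if "0 < u" "u \<le> 1" for u i
    unfolding th_def using that n by (intro add_nonneg_pos mult_nonneg_nonneg mult_pos_pos) (auto simp: a_def)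
  have th0: "th 0 = a" by (simp add: th_def)
  have \<sigma>0: "sine_sum {..<n} a = 2 * sqrt 2"
  proof -
    have "sine_sum {..<n} a = (\<Sum>i\<in>{..<n} \<inter> {..<4}. sin (pi/4))"
      unfolding sine_sum_def a_def by (subst sum.inter_restrict) (auto intro!: sum.cong)
    also have "{..<n} \<inter> {..<4} = {..<4::nat}" using n by auto
    finally show ?thesis by (simp add: sin_45)
  qed
  have A0: "area_sum {..<n} a = 2"
  proof -
    have "area_sum {..<n} a = (\<Sum>i\<in>{..<n} \<inter> {..<4}. sin (pi/4) * cos (pi/4))"
      unfolding area_sum_def a_def by (subst sum.inter_restrict) (auto intro!: sum.cong)
    also have "{..<n} \<inter> {..<4} = {..<4::nat}" using n by auto
    finally show ?thesis by (simp add: sin_45 cos_45)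
  qed
  have sl0: "slack {..<n} a i = (if i < 4 then sqrt 2 else 2 * sqrt 2)" for i
    unfolding slack_def \<sigma>0 by (simp add: a_def sin_45)
  have proper_angles: "proper_angles {..<n} (th u)" if "0 \<le> u" "u \<le> 1" for u
  proof (cases "u = 0")
    case True
    then show ?thesis using suma sl0 by (auto simp: th0 proper_angles_def) (auto simp: a_def)
  next
    case False
    then show ?thesis using that thpos sumth n by (intro adm_pos) auto
  qed
  have S0: "slack_prod n a = 1/16"
  proof -
    have "slack_prod n a = (\<Prod>i<n. if i < 4 then 1/2 else 1)"
      unfolding slack_prod_def \<sigma>0 sl0 by (intro prod.cong) auto
    also have "\<dots> = (\<Prod>i\<in>{..<n} \<inter> {..<4}. 1/2)" by (subst prod.inter_restrict) auto
    also have "{..<n} \<inter> {..<4} = {..<4::nat}" using n by auto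
    finally show ?thesis by (simp add: power_divide)
  qed
  have T0: "tau_angle n (th 0) = inv_phi0 n"
    unfolding th0 tau_angle_def \<sigma>0 A0 S0 by (simp add: power_mult_distrib real_sqrt_divide)
  have B: "1 < inv_phi0 n" by (rule regular_B_gt[OF n])
  have cont: "continuous_on {0..1} (\<lambda>u. tau_angle n (th u))"
  proof -
    have cs: "continuous_on {0..1} (\<lambda>u. sine_sum {..<n} (th u))" "continuous_on {0..1} (\<lambda>u. area_sum {..<n} (th u))"
      unfolding sine_sum_def area_sum_def th_def using n by (auto intro!: continuous_intros)
    have cl: "continuous_on {0..1} (\<lambda>u. slack {..<n} (th u) i)" for i
      unfolding slack_def th_def using n cs(1)[unfolded th_def] by (auto intro!: continuous_intros)
    have \<sigma>n: "sine_sum {..<n} (th u) \<noteq> 0" if "u \<in> {0..1}" for u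
      using sine_sum_pos[OF proper_angles, of u] that n by (force simp: lessThan_empty_iff)
    have sp: "slack_prod n (th u) \<noteq> 0" if "u \<in> {0..1}" for u
      using slack_prod_pos[OF n3 proper_angles, of u] that by force
    have "continuous_on {0..1} (\<lambda>u. slack_prod n (th u))"
      unfolding slack_prod_def using \<sigma>n by (intro continuous_intros cl cs) auto
    then show ?thesis unfolding tau_angle_def using \<sigma>n sp by (intro continuous_intros cs) auto
  qed
  have T1: "tau_angle n (th 1) = 1"
  proof -
    have "0 < th 1 i" for i using thpos[of 1] by simp
    then obtain w c r \<psi> s p where w: "circular n w c r \<psi> s p" "half_angle p = th 1"
      using circular_exists[OF n3 _ sumth[of 1]] by blast
    have "regular_polygon n w" using circ_regular_iff[OF w(1)] w(2) by (simp add: th_def)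
    then show ?thesis using circ_regular_tau(1)[OF w(1)] circ_tau[OF w(1)] w(2) by simp
  qed
  \<comment> \<open>Being strictly below the starting value, y is not attained at u = 0, so all
    angles are positive and belong to a genuine polygon.\<close>
  define y where "y = (1 + inv_phi0 n) / 2"
  have y: "1 < y" "y < inv_phi0 n" using B by (auto simp: y_def)
  obtain u where u: "0 \<le> u" "u \<le> 1" "tau_angle n (th u) = y"
    using IVT2'[of "\<lambda>u. tau_angle n (th u)" 1 y 0] cont T0 T1 y by auto
  have "u \<noteq> 0" using u T0 y by auto
  then have u0: "0 < u" using u by simp
  obtain w c r \<psi> s p where w: "circular n w c r \<psi> s p" "half_angle p = th u"
    using circular_exists[OF n3 thpos[OF u0 u(2)] sumth] by blast
  have tw: "tau n w = y" using circ_tau[OF w(1)] w(2) u by simp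
  have "phi n w = y / inv_phi0 n" using tw B by (simp add: tau_def phi0_eq field_simps)
  then have "phi n w \<le> 1" using y B by simp
  then show ?thesis using that[of w] circ_cyclic_polygon[OF w(1)] tw y by simp
qed

theorem theorem1:
  fixes n :: nat and v :: "nat \<Rightarrow> real^2"
  assumes "cyclic_polygon n v"
  shows "(tau n v \<le> 1 \<longrightarrow> phi n v \<le> 1 \<and> (5 \<le> n \<longrightarrow> pseudo_isoperimetric n v))
       \<and> (5 \<le> n \<longrightarrow> (\<exists>w. cyclic_polygon n w \<and> phi n w \<le> 1 \<and> pseudo_isoperimetric n w \<and> \<not> tau n w \<le> 1))
       \<and> (1 \<le> tau n v \<and> tau n v \<le> nu n v \<longrightarrow>
            exp 1 / pi \<le> phi n v \<and> (n \<noteq> 4 \<longrightarrow> pseudo_isoperimetric n v))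
       \<and> (nu n v < tau n v \<longrightarrow> \<not> pseudo_isoperimetric n v)
       \<and> (n \<noteq> 4 \<longrightarrow> (1 = tau n v \<and> tau n v = nu n v \<longleftrightarrow> regular_polygon n v))"
proof -
  obtain c r \<psi> s p where circ: "circular n v c r \<psi> s p" using cyclic_polygon_circular[OF assms] by blast
  have n: "3 \<le> n" by (rule circ_basic(1)[OF circ])
  have iso: "pseudo_isoperimetric n w" if "5 \<le> n" "cyclic_polygon n w" for w
    using cyclic_polygon_circular[OF that(2)] circ_pseudo_isoperimetric that(1) by metis
  have ph: "phi n v = tau n v * phi0 n" using phi0_bounds(1)[OF n] by (simp add: tau_def)
  have q1: "1 \<le> perimeter_quotient n (half_angle p)" by (rule circ_regularity_ge[OF circ])
  have nu1: "regular_polygon n v" if "nu n v = 1" "n \<noteq> 4"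
  proof -
    \<comment> \<open>The exponent n/2 - 2 in \<nu> vanishes for n = 4 only.\<close>
    have "real n \<noteq> 4" using that(2) by linarith
    then have ne: "real n / 2 - 2 \<noteq> 0" by simp
    have "ln (perimeter_quotient n (half_angle p) powr (real n / 2 - 2)) = (real n / 2 - 2) * ln (perimeter_quotient n (half_angle p))"
      using q1 by (simp add: ln_powr)
    then have "(real n / 2 - 2) * ln (perimeter_quotient n (half_angle p)) = 0"
      using that(1) unfolding circ_nu[OF circ] by simp
    then have "ln (perimeter_quotient n (half_angle p)) = 0" using ne by simp
    then have "perimeter_quotient n (half_angle p) = 1" using q1 by (simp add: ln_eq_zero_iff)
    then show ?thesis using circ_regular_iff_regularity[OF circ] by simp
  qed
  \<comment> \<open>For a triangle the exponent is - 1/2, so \<nu> \<le> 1 = \<tau>, and \<tau>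
    \<le> \<nu> is possible only with \<nu> = 1.\<close>
  have three: "pseudo_isoperimetric n v" if "n = 3" "1 \<le> tau n v" "tau n v \<le> nu n v"
  proof -
    have t1: "tau n v = 1" by (rule circ_triangle_tau[OF circ that(1)])
    have "nu n v \<le> 1 powr (real n / 2 - 2)" unfolding circ_nu[OF circ]
      by (rule powr_mono2') (use that(1) q1 in auto)
    then have "nu n v = 1" using t1 that(3) by simp
    then show ?thesis using nu1 that(1) t1 circ_deficit_sign[OF circ] by (simp add: pseudo_isoperimetric_def)
  qed
  show ?thesis
  proof (intro conjI impI)
    assume "tau n v \<le> 1"
    then have "tau n v * phi0 n \<le> 1 * phi0 n" using phi0_bounds(1)[OF n] by (intro mult_right_mono) auto
    then show "phi n v \<le> 1" using ph phi0_bounds(2)[OF n] by simp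
  next
    assume "5 \<le> n"
    then show "pseudo_isoperimetric n v" using iso assms by blast
  next
    assume n5: "5 \<le> n"
    obtain w where "cyclic_polygon n w" "phi n w \<le> 1" "1 < tau n w" by (rule tau_gt_1_exists[OF n5])
    then show "\<exists>w. cyclic_polygon n w \<and> phi n w \<le> 1 \<and> pseudo_isoperimetric n w \<and> \<not> tau n w \<le> 1"
      using iso[OF n5] by (intro exI[of _ w]) auto
  next
    assume "1 \<le> tau n v \<and> tau n v \<le> nu n v"
    then have "1 * phi0 n \<le> tau n v * phi0 n" using phi0_bounds(1)[OF n] by (intro mult_right_mono) auto
    then show "exp 1 / pi \<le> phi n v" using ph phi0_bounds(3)[OF n] by simp
  next
    assume h: "1 \<le> tau n v \<and> tau n v \<le> nu n v" "n \<noteq> 4"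
    then consider "n = 3" | "5 \<le> n" using n by linarith
    then show "pseudo_isoperimetric n v" using three h iso assms by cases auto
  next
    assume "nu n v < tau n v"
    then show "\<not> pseudo_isoperimetric n v" using circ_deficit_sign(1)[OF circ] by (auto simp: pseudo_isoperimetric_def)
  next
    assume n4: "n \<noteq> 4"
    show "1 = tau n v \<and> tau n v = nu n v \<longleftrightarrow> regular_polygon n v"
      using nu1[OF _ n4] circ_regular_tau[OF circ] by auto
  qed
qed

end
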